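(* Let $P$ be a set of primes such that $\sum_{p\in P}1/p<\infty$. Let $f$ be an $L^1$ function on the set of isomorphism classes of symplectic abelian groups $H$ of order divisible only by primes in $P$, and extend $f$ to all symplectic abelian groups $G$ by $f(G)=f(H_G)$. Then $$\lim_{n\to\infty}\frac{\sum_{\#G\le n}f(G)w_G}{\sum_{\#G\le n}w_G}=\int f,$$ where the sums are over isomorphism classes of symplectic abelian groups $G$ with $\#G\le n$.
   Context: A symplectic abelian group is a finite abelian group $G$ with a nondegenerate alternating bilinear pairing $G\times G\to\mathbb{Q}/\mathbb{Z}$; $\mathrm{Sp}(G)$ is its group of pairing-preserving automorphisms, and $w_G=\#G/\#\mathrm{Sp}(G)$. Each $G$ decomposes as $G=H_G\times H'_G$ with $\#H_G$ divisible only by primes in $P$ and $\#H'_G$ divisible only by primes not in $P$. Sums over $H$ range over isomorphism classes of symplectic abelian groups of order divisible only by primes in $P$; one has $\sum_Hw_H<\infty$. A real-valued function $f$ on such classes is $L^1$ if $\sum_H|f(H)|w_H<\infty$, and then $\int f=\big(\sum_Hf(H)w_H\big)/\big(\sum_Hw_H\big)$. *)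

theory Defs
  imports
    "HOL-Analysis.Infinite_Sum"
    "HOL-Algebra.Bij"
    "HOL-Algebra.Sylow"
    "HOL-Algebra.Multiplicative_Group"
begin

section \<open>The group of rationals modulo integers\<close>

definition rat_group :: "rat monoid"
  where "rat_group = \<lparr>carrier = UNIV, monoid.mult = (+), one = 0\<rparr>"

definition QZ :: "rat set monoid"
  where "QZ = rat_group Mod \<int>"

lemma comm_group_rat_group: "comm_group rat_group"
proof (rule comm_groupI)
  fix x assume "x \<in> carrier rat_group"
  show "\<exists>y\<in>carrier rat_group. y \<otimes>\<^bsub>rat_group\<^esub> x = \<one>\<^bsub>rat_group\<^esub>"
    by (rule bexI[of _ "- x"]) (auto simp: rat_group_def)
qed (auto simp: rat_group_def algebra_simps)

lemma subgroup_Ints_rat_group: "subgroup \<int> rat_group"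
proof -
  interpret comm_group rat_group by (rule comm_group_rat_group)
  have "inv\<^bsub>rat_group\<^esub> x = - x" for x
    by (rule inv_equality) (auto simp: rat_group_def)
  then show ?thesis
    by (intro subgroupI) (auto simp: rat_group_def)
qed

lemma comm_group_QZ: "comm_group QZ"
  unfolding QZ_def
  by (rule comm_group.abelian_FactGroup[OF comm_group_rat_group subgroup_Ints_rat_group])

section \<open>Symplectic abelian groups\<close>

record 'a sympl = "'a monoid" +
  pairing :: "'a \<Rightarrow> 'a \<Rightarrow> rat set"

text \<open>An alternating pairing is antisymmetric, so nondegeneracy in the first argument implies it in
  the second.\<close>

locale symplectic_group = comm_group G for G :: "('a, 'c) sympl_scheme" (structure) +
  assumes fin: "finite (carrier G)"
    and pairing_hom_right: "x \<in> carrier G \<Longrightarrow> pairing G x \<in> hom G QZ"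
    and pairing_hom_left: "y \<in> carrier G \<Longrightarrow> (\<lambda>x. pairing G x y) \<in> hom G QZ"
    and alternating: "x \<in> carrier G \<Longrightarrow> pairing G x x = \<one>\<^bsub>QZ\<^esub>"
    and nondegenerate:
      "\<lbrakk>x \<in> carrier G; \<And>y. y \<in> carrier G \<Longrightarrow> pairing G x y = \<one>\<^bsub>QZ\<^esub>\<rbrakk> \<Longrightarrow> x = \<one>"

definition sympl_iso :: "('a, 'c) sympl_scheme \<Rightarrow> ('b, 'd) sympl_scheme \<Rightarrow> ('a \<Rightarrow> 'b) set"
  where "sympl_iso G H = {\<phi> \<in> iso G H.
    \<forall>x\<in>carrier G. \<forall>y\<in>carrier G. pairing H (\<phi> x) (\<phi> y) = pairing G x y}"

text \<open>Elements of \<^term>\<open>auto G\<close> are extensional, so each automorphism is counted once in the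
  cardinality below.\<close>

definition Sp :: "('a, 'c) sympl_scheme \<Rightarrow> ('a \<Rightarrow> 'a) set"
  where "Sp G = {\<phi> \<in> auto G.
    \<forall>x\<in>carrier G. \<forall>y\<in>carrier G. pairing G (\<phi> x) (\<phi> y) = pairing G x y}"

definition weight :: "('a, 'c) sympl_scheme \<Rightarrow> real"
  where "weight G = real (order G) / real (card (Sp G))"

text \<open>\<open>P_part P G\<close> is the factor \<open>H\<^sub>G\<close> of \<open>G\<close>, with the restricted pairing, and
  \<open>P_part (- P) G\<close> is \<open>H'\<^sub>G\<close>; see the lemmas \<open>P_part_decomp\<close>, \<open>P_part_Int\<close>,
  \<open>P_part_orthogonal\<close> and \<open>P_part_order\<close> below.\<close>

definition P_part :: "nat set \<Rightarrow> ('a, 'c) sympl_scheme \<Rightarrow> ('a, 'c) sympl_scheme"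
  where "P_part P G = G\<lparr>carrier := {x \<in> carrier G. prime_factors (group.ord G x) \<subseteq> P}\<rparr>"

subsection \<open>The decomposition\<close>

lemma nat_split_primes:
  fixes n :: nat
  assumes "n > 0"
  shows "\<exists>a b. n = a * b \<and> prime_factors a \<subseteq> P \<and> prime_factors b \<subseteq> - P"
  using assms
proof (induction n rule: prime_divisors_induct)
  case (unit n)
  then show ?case by (intro exI[of _ 1]) auto
next
  case (factor p n)
  then obtain a b where ab: "n = a * b" "prime_factors a \<subseteq> P" "prime_factors b \<subseteq> - P"
    by auto
  have nz: "a \<noteq> 0" "b \<noteq> 0" "p \<noteq> 0" using factor ab by auto
  show ?case
  proof (cases "p \<in> P")
    case True
    then have "p * n = (p * a) * b" "prime_factors (p * a) \<subseteq> P"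
      using ab nz factor by (auto simp: prime_factors_product prime_prime_factors)
    then show ?thesis using ab by blast
  next
    case False
    then have "p * n = a * (p * b)" "prime_factors (p * b) \<subseteq> - P"
      using ab nz factor by (auto simp: prime_factors_product prime_prime_factors)
    then show ?thesis using ab by blast
  qed
qed auto

lemma coprime_prime_factors:
  fixes a b :: nat
  assumes "a > 0" "b > 0" "prime_factors a \<subseteq> P" "prime_factors b \<subseteq> - P"
  shows "coprime a b"
proof (rule ccontr)
  assume "\<not> coprime a b"
  then obtain p where "prime p" "p dvd a" "p dvd b"
    by (metis coprime_iff_gcd_eq_1 gcd_dvd1 gcd_dvd2 dvd_trans prime_factor_nat)
  then show False using assms by (auto simp: prime_factors_dvd)
qed

lemma carrier_P_part [simp]:
  "carrier (P_part P G) = {x \<in> carrier G. prime_factors (group.ord G x) \<subseteq> P}"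
  by (simp add: P_part_def)

lemma pairing_P_part [simp]: "pairing (P_part P G) = pairing G"
  by (simp add: P_part_def)

lemma mult_P_part [simp]: "monoid.mult (P_part P G) = monoid.mult G"
  by (simp add: P_part_def)

lemma one_P_part [simp]: "\<one>\<^bsub>P_part P G\<^esub> = \<one>\<^bsub>G\<^esub>"
  by (simp add: P_part_def)

context symplectic_group
begin

lemma prime_factors_ord_iff:
  assumes "x \<in> carrier G"
  shows "prime_factors (ord x) \<subseteq> P \<longleftrightarrow>
    (\<exists>m>0. x [^] m = \<one> \<and> prime_factors m \<subseteq> P)"
proof
  assume "prime_factors (ord x) \<subseteq> P"
  then show "\<exists>m>0. x [^] m = \<one> \<and> prime_factors m \<subseteq> P"
    using assms fin ord_ge_1 by (intro exI[of _ "ord x"]) (auto simp: Suc_le_eq)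
next
  assume "\<exists>m>0. x [^] m = \<one> \<and> prime_factors m \<subseteq> P"
  then obtain m where "m > 0" "ord x dvd m" "prime_factors m \<subseteq> P"
    using assms pow_eq_id by auto
  then show "prime_factors (ord x) \<subseteq> P"
    using dvd_prime_factors[of m "ord x"] by auto
qed

lemma subgroup_P_part: "subgroup (carrier (P_part P G)) G"
proof (rule subgroupI)
  show "carrier (P_part P G) \<noteq> {}"
    using one_closed by (auto intro!: exI[of _ "\<one>"])
  fix x y assume x: "x \<in> carrier (P_part P G)"
  then show "inv x \<in> carrier (P_part P G)" by auto
  assume y: "y \<in> carrier (P_part P G)"
  have "ord x > 0" "ord y > 0" using x y fin ord_ge_1 by (auto simp: Suc_le_eq)
  moreover have "(x \<otimes> y) [^] (ord x * ord y) = \<one>"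
    using x y abelian_ord_mul_divides pow_eq_id by auto
  moreover have "prime_factors (ord x * ord y) \<subseteq> P"
    using x y calculation by (auto simp: prime_factors_product)
  ultimately have "prime_factors (ord (x \<otimes> y)) \<subseteq> P"
    using x y prime_factors_ord_iff[of "x \<otimes> y" P] by (metis (no_types, lifting)
      carrier_P_part m_closed mem_Collect_eq mult_pos_pos)
  then show "x \<otimes> y \<in> carrier (P_part P G)" using x y by auto
qed auto

lemma P_part_decomp: "carrier G = carrier (P_part P G) <#> carrier (P_part (- P) G)"
proof
  show "carrier (P_part P G) <#> carrier (P_part (- P) G) \<subseteq> carrier G"
    by (auto simp: set_mult_def)
  show "carrier G \<subseteq> carrier (P_part P G) <#> carrier (P_part (- P) G)"
  proof
    fix x assume x: "x \<in> carrier G"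
    then have ord: "ord x > 0" using fin ord_ge_1 by (auto simp: Suc_le_eq)
    from nat_split_primes[OF this, of P] obtain a b where
      ab: "ord x = a * b" "prime_factors a \<subseteq> P" "prime_factors b \<subseteq> - P" by auto
    with ord have pos: "a > 0" "b > 0" by auto
    from ab pos have "coprime (int a) (int b)" using coprime_prime_factors by auto
    then obtain u v where uv: "u * int a + v * int b = 1"
      by (metis bezout_int coprime_iff_gcd_eq_1)
    have 1: "(x [^] (v * int b)) [^] a = \<one>"
    proof -
      have "(x [^] (v * int b)) [^] int a = \<one>"
        using x ab by (auto simp: int_pow_pow int_pow_eq_id mult_ac)
      then show ?thesis by (simp add: int_pow_int)
    qed
    have 2: "(x [^] (u * int a)) [^] b = \<one>"
    proof -
      have "(x [^] (u * int a)) [^] int b = \<one>"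
        using x ab by (auto simp: int_pow_pow int_pow_eq_id mult_ac)
      then show ?thesis by (simp add: int_pow_int)
    qed
    have "x = x [^] (v * int b) \<otimes> x [^] (u * int a)"
      using x uv by (simp add: int_pow_mult[symmetric] add.commute)
    moreover have "x [^] (v * int b) \<in> carrier (P_part P G)"
      using x 1 ab pos prime_factors_ord_iff[of "x [^] (v * int b)" P] by auto
    moreover have "x [^] (u * int a) \<in> carrier (P_part (- P) G)"
      using x 2 ab pos prime_factors_ord_iff[of "x [^] (u * int a)" "- P"] by auto
    ultimately show "x \<in> carrier (P_part P G) <#> carrier (P_part (- P) G)"
      unfolding set_mult_def by blast
  qed
qed

lemma P_part_Int: "carrier (P_part P G) \<inter> carrier (P_part (- P) G) = {\<one>}"
proof -
  have "x = \<one>" if x: "x \<in> carrier (P_part P G)" "x \<in> carrier (P_part (- P) G)" for x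
  proof -
    have "ord x > 0" using x fin ord_ge_1 by (auto simp: Suc_le_eq)
    then have "coprime (ord x) (ord x)"
      using x by (intro coprime_prime_factors[where P = P]) auto
    then show ?thesis using x ord_eq_1 by auto
  qed
  then show ?thesis by auto
qed

lemma P_part_orthogonal:
  assumes "x \<in> carrier (P_part P G)" "y \<in> carrier (P_part (- P) G)"
  shows "pairing G x y = \<one>\<^bsub>QZ\<^esub>"
proof -
  interpret Q: comm_group QZ by (rule comm_group_QZ)
  have xy: "x \<in> carrier G" "y \<in> carrier G" using assms by auto
  interpret r: group_hom G QZ "pairing G x"
    using xy pairing_hom_right by unfold_locales auto
  interpret l: group_hom G QZ "\<lambda>x. pairing G x y"
    using xy pairing_hom_left by unfold_locales auto
  have "pairing G x y [^]\<^bsub>QZ\<^esub> ord x = \<one>\<^bsub>QZ\<^esub>"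
    using l.hom_nat_pow[OF xy(1), of "ord x"] xy by simp
  then have 1: "Q.ord (pairing G x y) dvd ord x" using xy Q.pow_eq_id by auto
  have "pairing G x y [^]\<^bsub>QZ\<^esub> ord y = \<one>\<^bsub>QZ\<^esub>"
    using r.hom_nat_pow[OF xy(2), of "ord y"] xy by simp
  then have 2: "Q.ord (pairing G x y) dvd ord y" using xy Q.pow_eq_id by auto
  have "ord x > 0" "ord y > 0" using xy fin ord_ge_1 by (auto simp: Suc_le_eq)
  then have "coprime (ord x) (ord y)"
    using assms by (intro coprime_prime_factors[where P = P]) auto
  with 1 2 have "Q.ord (pairing G x y) = 1" using coprime_common_divisor_nat by blast
  then show ?thesis using Q.ord_eq_1 xy by auto
qed

lemma symplectic_group_P_part: "symplectic_group (P_part P G)"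
proof -
  have eq: "P_part P G = G\<lparr>carrier := carrier (P_part P G)\<rparr>" by (simp add: P_part_def)
  interpret H: group "P_part P G"
    using subgroup_imp_group[OF subgroup_P_part[of P]] eq by simp
  interpret Q: comm_group QZ by (rule comm_group_QZ)
  show ?thesis
  proof
    show "finite (carrier (P_part P G))" using fin by auto
  next
    fix x y assume "x \<in> carrier (P_part P G)" "y \<in> carrier (P_part P G)"
    then show "x \<otimes>\<^bsub>P_part P G\<^esub> y = y \<otimes>\<^bsub>P_part P G\<^esub> x" by (auto simp: m_comm)
  next
    fix x assume "x \<in> carrier (P_part P G)"
    then show "pairing (P_part P G) x \<in> hom (P_part P G) QZ"
      using pairing_hom_right[of x] by (auto simp: hom_def)
  next
    fix x assume "x \<in> carrier (P_part P G)"
    then show "(\<lambda>y. pairing (P_part P G) y x) \<in> hom (P_part P G) QZ"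
      using pairing_hom_left[of x] by (auto simp: hom_def)
  next
    fix x assume "x \<in> carrier (P_part P G)"
    then show "pairing (P_part P G) x x = \<one>\<^bsub>QZ\<^esub>" using alternating by auto
  next
    fix x assume x: "x \<in> carrier (P_part P G)"
      and *: "\<And>y. y \<in> carrier (P_part P G) \<Longrightarrow> pairing (P_part P G) x y = \<one>\<^bsub>QZ\<^esub>"
    have "pairing G x z = \<one>\<^bsub>QZ\<^esub>" if "z \<in> carrier G" for z
    proof -
      from that obtain a b where ab: "a \<in> carrier (P_part P G)"
        "b \<in> carrier (P_part (- P) G)" "z = a \<otimes> b"
        using P_part_decomp[of P] unfolding set_mult_def by blast
      then have "pairing G x z = pairing G x a \<otimes>\<^bsub>QZ\<^esub> pairing G x b"
        using pairing_hom_right[of x] x by (auto simp: hom_def)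
      also have "\<dots> = \<one>\<^bsub>QZ\<^esub>" using *[OF ab(1)] P_part_orthogonal[OF x ab(2)] by simp
      finally show ?thesis .
    qed
    then show "x = \<one>\<^bsub>P_part P G\<^esub>" using nondegenerate x by auto
  qed
qed

lemma P_part_order: "prime_factors (order (P_part P G)) \<subseteq> P"
proof
  fix p assume p: "p \<in> prime_factors (order (P_part P G))"
  interpret H: symplectic_group "P_part P G" by (rule symplectic_group_P_part)
  from p obtain m where "order (P_part P G) = p ^ 1 * m" and pp: "prime p"
    by (auto simp: in_prime_factors_iff dvd_def)
  then obtain K where K: "subgroup K (P_part P G)" "card K = p ^ 1"
    using sylow_thm[of p "P_part P G" 1 m] H.fin H.group_axioms by auto
  then have "card K > 1" using pp prime_gt_1_nat by auto
  moreover have "card K \<le> 1" if "K \<subseteq> {\<one>}"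
    using card_mono[OF _ that] by simp
  ultimately obtain x where x: "x \<in> K" "x \<noteq> \<one>" by fastforce
  have xG: "x \<in> carrier (P_part P G)" using K(1) x subgroup.subset by blast
  interpret K: group "(P_part P G)\<lparr>carrier := K\<rparr>"
    by (rule H.subgroup_imp_group[OF K(1)])
  have "x [^]\<^bsub>(P_part P G)\<lparr>carrier := K\<rparr>\<^esub> p = \<one>"
    using K.pow_order_eq_1[of x] x K by (auto simp: order_def)
  then have "x [^] p = \<one>" by (simp add: nat_pow_def P_part_def)
  then have "ord x dvd p" using pow_eq_id xG by auto
  moreover have "ord x \<noteq> 1" using ord_eq_1 x xG by auto
  ultimately have "ord x = p" using pp by (metis prime_nat_iff)
  then show "p \<in> P" using xG pp by (auto simp: prime_prime_factors)
qed

lemma Sp_finite: "finite (Sp G)"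
proof (rule finite_subset)
  show "Sp G \<subseteq> carrier G \<rightarrow>\<^sub>E carrier G"
    by (auto simp: Sp_def auto_def hom_def Bij_def PiE_def)
  show "finite (carrier G \<rightarrow>\<^sub>E carrier G)"
    using fin by (auto intro: finite_PiE)
qed

end

subsection \<open>Invariance under isomorphism\<close>

lemma sympl_iso_refl: "(\<lambda>x. x) \<in> sympl_iso G G"
  by (simp add: sympl_iso_def iso_set_refl)

lemma sympl_iso_trans:
  assumes "h \<in> sympl_iso G H" "k \<in> sympl_iso H K"
  shows "k \<circ> h \<in> sympl_iso G K"
proof -
  have "h x \<in> carrier H" if "x \<in> carrier G" for x
    using assms(1) that by (auto simp: sympl_iso_def iso_def hom_def)
  then show ?thesis
    using assms iso_set_trans[of h G H k K] by (simp add: sympl_iso_def)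
qed

lemma sympl_iso_sym:
  assumes "symplectic_group G" "h \<in> sympl_iso G H"
  shows "inv_into (carrier G) h \<in> sympl_iso H G"
proof -
  interpret symplectic_group G by fact
  have h: "h \<in> iso G H" "bij_betw h (carrier G) (carrier H)"
    using assms by (auto simp: sympl_iso_def iso_def)
  have i: "inv_into (carrier G) h \<in> iso H G" using iso_set_sym h by auto
  have mem: "inv_into (carrier G) h x \<in> carrier G" if "x \<in> carrier H" for x
    using h(2) that by (metis bij_betw_def inv_into_into)
  have r: "h (inv_into (carrier G) h x) = x" if "x \<in> carrier H" for x
    using h(2) that by (metis bij_betw_inv_into_right)
  have "pairing G (inv_into (carrier G) h x) (inv_into (carrier G) h y) = pairing H x y"
    if "x \<in> carrier H" "y \<in> carrier H" for x y
    using assms(2) mem[OF that(1)] mem[OF that(2)] r that by (fastforce simp: sympl_iso_def)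
  then show ?thesis using i by (auto simp: sympl_iso_def)
qed

definition sympl_isomorphic :: "('a, 'c) sympl_scheme \<Rightarrow> ('b, 'd) sympl_scheme \<Rightarrow> bool"
  where "sympl_isomorphic G H \<longleftrightarrow>
    symplectic_group G \<and> symplectic_group H \<and> sympl_iso G H \<noteq> {}"

lemma sympl_isomorphic_sym: "sympl_isomorphic G H \<Longrightarrow> sympl_isomorphic H G"
  unfolding sympl_isomorphic_def using sympl_iso_sym by blast

lemma sympl_isomorphic_trans:
  "sympl_isomorphic G H \<Longrightarrow> sympl_isomorphic H K \<Longrightarrow> sympl_isomorphic G K"
  unfolding sympl_isomorphic_def using sympl_iso_trans by blast

lemma order_cong: "sympl_isomorphic G H \<Longrightarrow> order G = order H"
  by (auto simp: sympl_isomorphic_def sympl_iso_def iso_def order_def bij_betw_same_card)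

lemma card_Sp_le:
  assumes "sympl_isomorphic G H"
  shows "card (Sp G) \<le> card (Sp H)"
proof -
  from assms obtain h where G: "symplectic_group G" and H: "symplectic_group H"
    and h: "h \<in> sympl_iso G H" by (auto simp: sympl_isomorphic_def)
  define k where "k = inv_into (carrier G) h"
  have k: "k \<in> sympl_iso H G" unfolding k_def by (rule sympl_iso_sym[OF G h])
  have hb: "bij_betw h (carrier G) (carrier H)" using h by (auto simp: sympl_iso_def iso_def)
  have kh: "k (h x) = x" if "x \<in> carrier G" for x
    unfolding k_def using hb that by (meson bij_betw_inv_into_left)
  have hm: "h x \<in> carrier H" if "x \<in> carrier G" for x
    using hb that by (meson bij_betwE)
  define c where "c \<phi> = restrict (h \<circ> (\<phi> \<circ> k)) (carrier H)" for \<phi>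
  have "inj_on c (Sp G)"
  proof (rule inj_onI)
    fix \<phi> \<psi> assume s: "\<phi> \<in> Sp G" "\<psi> \<in> Sp G" and e: "c \<phi> = c \<psi>"
    have mem: "\<phi> x \<in> carrier G" "\<psi> x \<in> carrier G" if "x \<in> carrier G" for x
      using s that by (auto simp: Sp_def auto_def hom_def)
    have "\<phi> x = \<psi> x" if x: "x \<in> carrier G" for x
    proof -
      have "c \<phi> (h x) = c \<psi> (h x)" using e by simp
      then have "h (\<phi> x) = h (\<psi> x)" using x hm kh by (simp add: c_def)
      then show ?thesis using mem x kh by metis
    qed
    then show "\<phi> = \<psi>"
      using s by (intro extensionalityI[of _ "carrier G"]) (auto simp: Sp_def auto_def Bij_def)
  qed
  moreover have "c ` Sp G \<subseteq> Sp H"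
  proof (rule image_subsetI)
    fix \<phi> assume "\<phi> \<in> Sp G"
    then have "\<phi> \<in> sympl_iso G G" by (auto simp: Sp_def auto_def Bij_def sympl_iso_def iso_def)
    then have *: "h \<circ> (\<phi> \<circ> k) \<in> sympl_iso H H"
      by (rule sympl_iso_trans[OF sympl_iso_trans[OF k] h])
    interpret H: symplectic_group H by (rule H)
    have "c \<phi> \<in> iso H H"
      by (rule H.iso_eq[of "h \<circ> (\<phi> \<circ> k)"]) (use * in \<open>auto simp: sympl_iso_def c_def\<close>)
    then show "c \<phi> \<in> Sp H"
      using * by (auto simp: Sp_def auto_def Bij_def iso_def sympl_iso_def c_def)
  qed
  moreover have "finite (Sp H)" using H by (rule symplectic_group.Sp_finite)
  ultimately show ?thesis by (metis card_inj_on_le)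
qed

lemma weight_cong: "sympl_isomorphic G H \<Longrightarrow> weight G = weight H"
  unfolding weight_def
  by (metis card_Sp_le order_cong order_antisym sympl_isomorphic_sym)

lemma P_part_cong:
  assumes "sympl_isomorphic G H"
  shows "sympl_isomorphic (P_part P G) (P_part P H)"
proof -
  from assms obtain h where G: "symplectic_group G" and H: "symplectic_group H"
    and h: "h \<in> sympl_iso G H" by (auto simp: sympl_isomorphic_def)
  interpret G: symplectic_group G by (rule G)
  interpret H: symplectic_group H by (rule H)
  interpret h: group_hom G H h
    using h by unfold_locales (auto simp: sympl_iso_def iso_def)
  have hb: "bij_betw h (carrier G) (carrier H)" using h by (auto simp: sympl_iso_def iso_def)
  then have inj: "inj_on h (carrier G)" and im: "h ` carrier G = carrier H"
    by (auto simp: bij_betw_def)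
  have ord: "H.ord (h x) = G.ord x" if x: "x \<in> carrier G" for x
  proof -
    have "h x [^]\<^bsub>H\<^esub> n = \<one>\<^bsub>H\<^esub> \<longleftrightarrow> x [^]\<^bsub>G\<^esub> n = \<one>\<^bsub>G\<^esub>" for n :: nat
      using x inj by (metis G.nat_pow_closed G.one_closed h.hom_nat_pow h.hom_one inj_onD)
    then show ?thesis using x H.ord_unique G.pow_eq_id by auto
  qed
  have "h ` carrier (P_part P G) = carrier (P_part P H)"
  proof
    show "h ` carrier (P_part P G) \<subseteq> carrier (P_part P H)" using ord by auto
    show "carrier (P_part P H) \<subseteq> h ` carrier (P_part P G)"
    proof
      fix y assume y: "y \<in> carrier (P_part P H)"
      then have "y \<in> h ` carrier G" using im by auto
      then obtain x where "x \<in> carrier G" "y = h x" by auto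
      then show "y \<in> h ` carrier (P_part P G)" using y ord by auto
    qed
  qed
  moreover have "inj_on h (carrier (P_part P G))"
    using inj by (rule inj_on_subset) auto
  moreover have "h \<in> hom (P_part P G) (P_part P H)"
    using h.homh ord by (auto simp: hom_def)
  ultimately have "h \<in> iso (P_part P G) (P_part P H)"
    by (auto simp: iso_iff)
  then have "h \<in> sympl_iso (P_part P G) (P_part P H)"
    using h by (auto simp: sympl_iso_def)
  then show ?thesis
    unfolding sympl_isomorphic_def
    using G.symplectic_group_P_part H.symplectic_group_P_part by blast
qed

section \<open>Isomorphism classes\<close>

text \<open>A finite group is isomorphic to one with carrier in \<^typ>\<open>nat\<close>, so the isomorphism classes
  of groups on subsets of \<^typ>\<open>nat\<close> are all the isomorphism classes.\<close>

lemma symplectic_group_exists: "\<exists>G :: nat sympl. sympl_isomorphic G G"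
proof -
  define G :: "nat sympl"
    where "G = \<lparr>carrier = {0}, monoid.mult = (\<lambda>_ _. 0), one = 0, pairing = (\<lambda>_ _. \<one>\<^bsub>QZ\<^esub>)\<rparr>"
  interpret Q: comm_group QZ by (rule comm_group_QZ)
  interpret comm_group G by (rule comm_groupI) (auto simp: G_def)
  have "symplectic_group G"
    by unfold_locales (auto simp: G_def hom_def)
  then have "sympl_isomorphic G G"
    using sympl_iso_refl by (auto simp: sympl_isomorphic_def)
  then show ?thesis by blast
qed

quotient_type sympl_class = "nat sympl" / partial: sympl_isomorphic
proof (rule part_equivpI)
  show "\<exists>G :: nat sympl. sympl_isomorphic G G" by (rule symplectic_group_exists)
  show "symp (sympl_isomorphic :: nat sympl \<Rightarrow> nat sympl \<Rightarrow> bool)"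
    by (rule sympI) (rule sympl_isomorphic_sym)
  show "transp (sympl_isomorphic :: nat sympl \<Rightarrow> nat sympl \<Rightarrow> bool)"
    by (rule transpI) (rule sympl_isomorphic_trans)
qed

lift_definition class_order :: "sympl_class \<Rightarrow> nat" is "order :: nat sympl \<Rightarrow> nat"
  by (rule order_cong)

lift_definition class_weight :: "sympl_class \<Rightarrow> real" is "weight :: nat sympl \<Rightarrow> real"
  by (rule weight_cong)

lift_definition class_P_part :: "nat set \<Rightarrow> sympl_class \<Rightarrow> sympl_class"
  is "P_part :: nat set \<Rightarrow> nat sympl \<Rightarrow> nat sympl"
  by (rule P_part_cong)

definition P_classes :: "nat set \<Rightarrow> sympl_class set"
  where "P_classes P = {H. prime_factors (class_order H) \<subseteq> P}"

definition sympl_L1 :: "nat set \<Rightarrow> (sympl_class \<Rightarrow> real) \<Rightarrow> bool"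
  where "sympl_L1 P f \<longleftrightarrow> (\<lambda>H. \<bar>f H\<bar> * class_weight H) summable_on P_classes P"

definition sympl_integral :: "nat set \<Rightarrow> (sympl_class \<Rightarrow> real) \<Rightarrow> real"
  where "sympl_integral P f =
    (\<Sum>\<^sub>\<infinity>H\<in>P_classes P. f H * class_weight H) / (\<Sum>\<^sub>\<infinity>H\<in>P_classes P. class_weight H)"

end

(* Write b(n) for the sum of w_G over the classes of order n. Since w_G = #G / #Sp(G), the number b(n)
   is the mass of the pairs (G, x) with x in G and #G = n. If x has order d, then H = x^perp / <x> is
   symplectic of order n / d^2. Choosing also z with <x, z> = 1/d (there are n / d choices), the triple
   (G, x, z) is determined up to unique isomorphism by H and the image in H of d z. Hence
   b(n) <= sum over d^2 | n of (d / n) b(n / d^2). It follows that b vanishes off the squares and that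
   b(N^2) <= 2 b(1) / N. So the classes of order in (n / h, n] have total weight bounded in terms of
   h alone, and the total weight of the P-classes is finite because sum_{p in P} 1/p is. The groups
   (Z/N)^2 have weight at least 1/N, so the total weight of all classes diverges.

   Weights are multiplicative in G = H_G x H'_G, so both sums in the quotient have the shape
   sum_H f(H) w_H A(n / #H), where A(m) is the total weight of the H' with #H' <= m. Here
   A(n / #H) / A(n) lies in [0, 1] and tends to 1 for each H; dominated convergence concludes. *)

theory Submission
  imports Defs "HOL-Analysis.Harmonic_Numbers"
begin

section \<open>The pairing\<close>

text \<open>The factor 1 / #Sp(G) counts objects up to automorphism, so a bound on the weight can be
  read off from any data that rigidify G. A pair (G, x) leaves open how G is built from H; the
  element z closes this gap. An element g of x^perp is known from its image h in H and from t = <g,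
  z>, and the pairs (h, t) that occur are exactly those with d t = <h, c>, where c is the image of d
  z. So H and c rebuild G, each of the #H values of c carries mass at most 1, and dividing by #Sp(H)
  leaves w_H. The rate 1 / N for b(N^2) is what makes the limit work. It is attained from below by
  (Z/N)^2, so the total weight diverges, but it is a borderline rate: the orders in (n / h, n]
  contribute a bounded amount. Hence A(n) - A(n / h) stays bounded while A(n) grows, which is the
  reason for A(n / h) / A(n) tending to 1. That A itself grows follows since the total weight up to
  n is at most A(n) times the finite weight of the P-classes.\<close>

interpretation QZ: comm_group QZ by (rule comm_group_QZ)

definition qz :: "rat \<Rightarrow> rat set"
  where "qz r = \<int> #>\<^bsub>rat_group\<^esub> r"

lemma qz_in_carrier [simp]: "qz r \<in> carrier QZ"
  by (auto simp: QZ_def qz_def FactGroup_def RCOSETS_def rat_group_def)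

lemma carrier_QZ_cases:
  assumes "t \<in> carrier QZ"
  obtains r where "t = qz r"
  using assms by (auto simp: QZ_def qz_def FactGroup_def RCOSETS_def)

lemma qz_add: "qz r \<otimes>\<^bsub>QZ\<^esub> qz s = qz (r + s)"
proof -
  interpret R: comm_group rat_group by (rule comm_group_rat_group)
  interpret normal "\<int>" rat_group
    by (rule R.subgroup_imp_normal[OF subgroup_Ints_rat_group])
  show ?thesis using rcos_sum[of r s] by (simp add: QZ_def qz_def rat_group_def)
qed

lemma qz_eq_one_iff: "qz r = \<one>\<^bsub>QZ\<^esub> \<longleftrightarrow> r \<in> \<int>"
proof -
  interpret R: comm_group rat_group by (rule comm_group_rat_group)
  have "r \<in> carrier rat_group" by (simp add: rat_group_def)
  then have "qz r = \<int> \<longleftrightarrow> r \<in> \<int>"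
    unfolding qz_def
    using R.coset_join1[OF _ _ subgroup_Ints_rat_group] R.coset_join2[OF _ subgroup_Ints_rat_group]
      subgroup.subset[OF subgroup_Ints_rat_group] by metis
  then show ?thesis by (simp add: QZ_def)
qed

lemma qz_zero [simp]: "qz 0 = \<one>\<^bsub>QZ\<^esub>"
  by (simp add: qz_eq_one_iff)

lemma qz_pow: "qz r [^]\<^bsub>QZ\<^esub> (k::nat) = qz (of_nat k * r)"
  by (induction k) (auto simp: qz_add algebra_simps)

text \<open>If t is the class of r, then d r is an integer j, and the residue of j modulo d is the
  exponent. The bound \<open>k < d\<close> later limits the values of a pairing with an element of
  order d to d many.\<close>

lemma QZ_torsion:
  assumes "t \<in> carrier QZ" "t [^]\<^bsub>QZ\<^esub> (d::nat) = \<one>\<^bsub>QZ\<^esub>" "d > 0"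
  shows "\<exists>k<d. t = qz (1 / of_nat d) [^]\<^bsub>QZ\<^esub> (k::nat)"
proof -
  obtain r where r: "t = qz r" using assms(1) by (rule carrier_QZ_cases)
  then have "of_nat d * r \<in> \<int>" using assms(2) by (simp add: qz_pow qz_eq_one_iff)
  then obtain j where j: "of_nat d * r = of_int j" by (auto elim: Ints_cases)
  define k where "k = nat (j mod int d)"
  have k: "int k = j mod int d" using assms(3) by (simp add: k_def)
  have "j = int k + int d * (j div int d)" using k by simp
  then have "(of_int j :: rat) = of_nat k + of_nat d * of_int (j div int d)"
    by (metis of_int_add of_int_mult of_int_of_nat_eq)
  then have "r = of_nat k * (1 / of_nat d) + of_int (j div int d)"
    using j assms(3) by (simp add: field_simps)
  then have "qz r = qz (of_nat k * (1 / of_nat d)) \<otimes>\<^bsub>QZ\<^esub> qz (of_int (j div int d))"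
    by (simp only: qz_add)
  also have "qz (of_int (j div int d)) = \<one>\<^bsub>QZ\<^esub>" by (simp add: qz_eq_one_iff)
  finally have "t = qz (1 / of_nat d) [^]\<^bsub>QZ\<^esub> k" using r by (simp add: qz_pow)
  moreover have "k < d" using k assms(3) pos_mod_bound[of "int d" j] by linarith
  ultimately show ?thesis by blast
qed

context symplectic_group
begin

lemma pairing_closed [simp]:
  "x \<in> carrier G \<Longrightarrow> y \<in> carrier G \<Longrightarrow> pairing G x y \<in> carrier QZ"
  using pairing_hom_right[of x] by (auto simp: hom_def)

lemma pairing_mult_right:
  "x \<in> carrier G \<Longrightarrow> y \<in> carrier G \<Longrightarrow> z \<in> carrier G \<Longrightarrow>
    pairing G x (y \<otimes> z) = pairing G x y \<otimes>\<^bsub>QZ\<^esub> pairing G x z"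
  using pairing_hom_right[of x] by (auto simp: hom_def)

lemma pairing_mult_left:
  "x \<in> carrier G \<Longrightarrow> y \<in> carrier G \<Longrightarrow> z \<in> carrier G \<Longrightarrow>
    pairing G (x \<otimes> y) z = pairing G x z \<otimes>\<^bsub>QZ\<^esub> pairing G y z"
  using pairing_hom_left[of z] by (auto simp: hom_def)

lemma group_hom_pairing_right: "x \<in> carrier G \<Longrightarrow> group_hom G QZ (pairing G x)"
  using pairing_hom_right by unfold_locales auto

lemma group_hom_pairing_left: "y \<in> carrier G \<Longrightarrow> group_hom G QZ (\<lambda>x. pairing G x y)"
  using pairing_hom_left by unfold_locales auto

lemma pairing_one_right [simp]: "x \<in> carrier G \<Longrightarrow> pairing G x \<one> = \<one>\<^bsub>QZ\<^esub>"
  using group_hom.hom_one[OF group_hom_pairing_right] by blast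

lemma pairing_one_left [simp]: "y \<in> carrier G \<Longrightarrow> pairing G \<one> y = \<one>\<^bsub>QZ\<^esub>"
  using group_hom.hom_one[OF group_hom_pairing_left] by blast

lemma pairing_inv_right:
  "x \<in> carrier G \<Longrightarrow> y \<in> carrier G \<Longrightarrow> pairing G x (inv y) = inv\<^bsub>QZ\<^esub> pairing G x y"
  using group_hom.hom_inv[OF group_hom_pairing_right] by blast

lemma pairing_inv_left:
  "x \<in> carrier G \<Longrightarrow> y \<in> carrier G \<Longrightarrow> pairing G (inv x) y = inv\<^bsub>QZ\<^esub> pairing G x y"
  using group_hom.hom_inv[OF group_hom_pairing_left] by blast

lemma pairing_pow_right:
  "x \<in> carrier G \<Longrightarrow> y \<in> carrier G \<Longrightarrow>
    pairing G x (y [^] (k::nat)) = pairing G x y [^]\<^bsub>QZ\<^esub> k"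
  using group_hom.hom_nat_pow[OF group_hom_pairing_right] by blast

lemma pairing_pow_left:
  "x \<in> carrier G \<Longrightarrow> y \<in> carrier G \<Longrightarrow>
    pairing G (x [^] (k::nat)) y = pairing G x y [^]\<^bsub>QZ\<^esub> k"
  using group_hom.hom_nat_pow[OF group_hom_pairing_left] by blast

lemma pairing_swap:
  assumes "x \<in> carrier G" "y \<in> carrier G"
  shows "pairing G y x = inv\<^bsub>QZ\<^esub> pairing G x y"
proof -
  have "\<one>\<^bsub>QZ\<^esub> = pairing G (x \<otimes> y) (x \<otimes> y)" using assms by (simp add: alternating)
  also have "\<dots> = (pairing G x x \<otimes>\<^bsub>QZ\<^esub> pairing G y x) \<otimes>\<^bsub>QZ\<^esub>
      (pairing G x y \<otimes>\<^bsub>QZ\<^esub> pairing G y y)"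
    using assms by (simp add: pairing_mult_left pairing_mult_right)
  also have "\<dots> = pairing G x y \<otimes>\<^bsub>QZ\<^esub> pairing G y x"
    using assms by (simp add: alternating QZ.m_comm)
  finally have "pairing G y x \<otimes>\<^bsub>QZ\<^esub> pairing G x y = \<one>\<^bsub>QZ\<^esub>"
    using assms by (simp add: QZ.m_comm)
  then show ?thesis using assms by (simp add: QZ.inv_equality)
qed

text \<open>Nondegeneracy in the form used throughout: well-definedness, injectivity and additivity
  of maps are all checked by pairing both sides with a test element.\<close>

lemma eq_by_pairing:
  assumes x: "x \<in> carrier G" and y: "y \<in> carrier G"
    and eq: "\<And>z. z \<in> carrier G \<Longrightarrow> pairing G x z = pairing G y z"
  shows "x = y"
proof -
  have "x \<otimes> inv y = \<one>"
    by (rule nondegenerate) (use x y eq in \<open>auto simp: pairing_mult_left pairing_inv_left\<close>)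
  then show ?thesis using x y by (metis inv_equality inv_closed inv_inv)
qed

lemma order_pos: "order G > 0"
  using fin one_closed by (auto simp: order_def card_gt_0_iff)

lemma ord_pos: "x \<in> carrier G \<Longrightarrow> ord x > 0"
  using ord_ge_1 fin by (auto simp: Suc_le_eq)

end

text \<open>Nondegeneracy makes a total, surjective relation that preserves the pairing the graph of an
  injective homomorphism.\<close>

lemma sympl_iso_of_relation:
  fixes G :: "('a, 'c) sympl_scheme" and H :: "('b, 'd) sympl_scheme"
  assumes "symplectic_group G" "symplectic_group H"
    and carrier: "\<And>a b. R a b \<Longrightarrow> a \<in> carrier G \<and> b \<in> carrier H"
    and total: "\<And>a. a \<in> carrier G \<Longrightarrow> \<exists>b. R a b"
    and surj: "\<And>b. b \<in> carrier H \<Longrightarrow> \<exists>a. R a b"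
    and pres: "\<And>a b a' b'. R a b \<Longrightarrow> R a' b' \<Longrightarrow> pairing G a a' = pairing H b b'"
  obtains \<theta> where "\<theta> \<in> sympl_iso G H" "\<theta> \<in> extensional (carrier G)" "\<And>a b. R a b \<Longrightarrow> \<theta> a = b"
proof -
  interpret G: symplectic_group G by fact
  interpret H: symplectic_group H by fact
  have r_unique: "b = b'" if "R a b" "R a b'" for a b b'
  proof (rule H.eq_by_pairing)
    show "b \<in> carrier H" "b' \<in> carrier H" using that carrier by auto
    fix e assume "e \<in> carrier H"
    then obtain e' where "R e' e" using surj by blast
    then show "pairing H b e = pairing H b' e" using pres that by metis
  qed
  have l_unique: "a = a'" if "R a b" "R a' b" for a a' b
  proof (rule G.eq_by_pairing)
    show "a \<in> carrier G" "a' \<in> carrier G" using that carrier by auto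
    fix e assume "e \<in> carrier G"
    then obtain e' where "R e e'" using total by blast
    then show "pairing G a e = pairing G a' e" using pres that by metis
  qed
  define \<theta> where "\<theta> = restrict (\<lambda>a. SOME b. R a b) (carrier G)"
  have R\<theta>: "R a (\<theta> a)" if "a \<in> carrier G" for a
    unfolding \<theta>_def using that total by (simp add: someI_ex)
  have \<theta>: "\<theta> a = b" if "R a b" for a b
    using that R\<theta> r_unique carrier by blast
  have c: "\<theta> a \<in> carrier H" if "a \<in> carrier G" for a using R\<theta> carrier that by blast
  \<comment> \<open>As the relation is onto, a test element e of H has a partner e' in G, and
    additivity is inherited from the pairing of G with e'.\<close>
  have hom: "\<theta> (a \<otimes>\<^bsub>G\<^esub> b) = \<theta> a \<otimes>\<^bsub>H\<^esub> \<theta> b" if ab: "a \<in> carrier G" "b \<in> carrier G" for a b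
  proof (rule H.eq_by_pairing)
    show "\<theta> (a \<otimes>\<^bsub>G\<^esub> b) \<in> carrier H" "\<theta> a \<otimes>\<^bsub>H\<^esub> \<theta> b \<in> carrier H" using ab c by auto
    fix e assume "e \<in> carrier H"
    then obtain e' where e: "R e' e" using surj by blast
    then have "e' \<in> carrier G" "e \<in> carrier H" using carrier by auto
    then show "pairing H (\<theta> (a \<otimes>\<^bsub>G\<^esub> b)) e = pairing H (\<theta> a \<otimes>\<^bsub>H\<^esub> \<theta> b) e"
      using ab c pres[OF R\<theta> e, symmetric] by (simp add: H.pairing_mult_left G.pairing_mult_left)
  qed
  have "bij_betw \<theta> (carrier G) (carrier H)"
    unfolding bij_betw_def
  proof
    show "inj_on \<theta> (carrier G)" by (rule inj_onI) (metis R\<theta> l_unique)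
    show "\<theta> ` carrier G = carrier H"
    proof
      show "\<theta> ` carrier G \<subseteq> carrier H" using c by auto
      show "carrier H \<subseteq> \<theta> ` carrier G"
      proof
        fix b assume "b \<in> carrier H"
        then obtain a where "R a b" using surj by blast
        then have "a \<in> carrier G" "b = \<theta> a" using carrier \<theta> by auto
        then show "b \<in> \<theta> ` carrier G" by blast
      qed
    qed
  qed
  moreover have "\<theta> \<in> hom G H" using hom c by (auto simp: hom_def)
  moreover have "pairing H (\<theta> a) (\<theta> b) = pairing G a b"
    if "a \<in> carrier G" "b \<in> carrier G" for a b using pres R\<theta> that by metis
  ultimately have "\<theta> \<in> sympl_iso G H" by (auto simp: sympl_iso_def iso_def)
  moreover have "\<theta> \<in> extensional (carrier G)" by (simp add: \<theta>_def)
  ultimately show ?thesis using that \<theta> by blast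
qed

lemma Sp_eq: "Sp G = sympl_iso G G \<inter> extensional (carrier G)"
  by (auto simp: Sp_def sympl_iso_def auto_def iso_def Bij_def)

lemma sympl_isoD:
  assumes "h \<in> sympl_iso G H"
  shows "bij_betw h (carrier G) (carrier H)" "h \<in> hom G H"
    "\<And>x y. x \<in> carrier G \<Longrightarrow> y \<in> carrier G \<Longrightarrow> pairing H (h x) (h y) = pairing G x y"
  using assms by (auto simp: sympl_iso_def iso_def)

lemma card_Sp_pos:
  assumes "symplectic_group G"
  shows "card (Sp G) > 0"
proof -
  interpret symplectic_group G by fact
  have "(\<lambda>x\<in>carrier G. x) \<in> Sp G"
    unfolding Sp_eq using sympl_iso_refl[of G]
    by (auto simp: sympl_iso_def iso_def hom_def bij_betw_def inj_on_def)
  then show ?thesis using Sp_finite by (auto simp: card_gt_0_iff)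
qed

section \<open>Reduction along an element\<close>

definition perp :: "('a, 'c) sympl_scheme \<Rightarrow> 'a \<Rightarrow> 'a set"
  where "perp G x = {y \<in> carrier G. pairing G x y = \<one>\<^bsub>QZ\<^esub>}"

text \<open>The normalisation makes z dual to x: a multiple of z corrects any value of the pairing
  with x, so z and the complement of x generate the group.\<close>

definition frames :: "('a, 'c) sympl_scheme \<Rightarrow> nat \<Rightarrow> ('a \<times> 'a) set"
  where "frames G d = {(x, z). x \<in> carrier G \<and> z \<in> carrier G \<and> group.ord G x = d \<and>
    pairing G x z = qz (1 / of_nat d)}"

text \<open>Surjections of the orthogonal complement of \<open>x\<close> onto \<open>H\<close> that preserve the pairing: by
  nondegeneracy of \<open>H\<close> they identify \<open>H\<close> with the quotient of the complement by the subgroup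
  generated by \<open>x\<close>.\<close>

definition reductions :: "('a, 'c) sympl_scheme \<Rightarrow> 'a \<Rightarrow> ('b, 'd) sympl_scheme \<Rightarrow> ('a \<Rightarrow> 'b) set"
  where "reductions G x H = {\<pi> \<in> perp G x \<rightarrow>\<^sub>E carrier H. \<pi> ` perp G x = carrier H \<and>
    (\<forall>a\<in>perp G x. \<forall>b\<in>perp G x. pairing H (\<pi> a) (\<pi> b) = pairing G a b)}"

context symplectic_group
begin

lemma perp_closed: "y \<in> perp G x \<Longrightarrow> y \<in> carrier G"
  by (simp add: perp_def)

lemma finite_perp: "finite (perp G x)"
  using fin by (auto simp: perp_def)

lemma perp_subgroup:
  assumes "x \<in> carrier G"
  shows "subgroup (perp G x) G"
proof (rule subgroupI)
  have "\<one> \<in> perp G x" using assms by (simp add: perp_def)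
  then show "perp G x \<noteq> {}" by blast
qed (use assms in \<open>auto simp: perp_def pairing_inv_right pairing_mult_right\<close>)

lemma pow_self_in_perp:
  assumes "x \<in> carrier G"
  shows "x [^] (k::nat) \<in> perp G x"
  using assms by (auto simp: perp_def pairing_pow_right alternating)

lemma pairing_pow_ord:
  assumes "x \<in> carrier G" "y \<in> carrier G"
  shows "pairing G x y [^]\<^bsub>QZ\<^esub> ord x = \<one>\<^bsub>QZ\<^esub>"
  using assms by (simp flip: pairing_pow_left)

text \<open>An element z dual to x need not have an image in the reduction, but this multiple of it
  does. Its image is the parameter c that records how G is built from H.\<close>

lemma pow_ord_in_perp:
  assumes "x \<in> carrier G" "z \<in> carrier G"
  shows "z [^] ord x \<in> perp G x"
  using assms pairing_pow_ord by (simp add: perp_def pairing_pow_right)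

text \<open>The value <x, a> is killed by the order of x, hence it is j times 1 / d = <x, z> for
  some j; removing j times z moves a into the complement of x.\<close>

lemma decompose_by_frame:
  assumes xz: "(x, z) \<in> frames G d" and a: "a \<in> carrier G"
  obtains j :: nat and g where "g \<in> perp G x" "a = g \<otimes> z [^] j"
proof -
  have x: "x \<in> carrier G" "z \<in> carrier G" "ord x = d" "pairing G x z = qz (1 / of_nat d)"
    using xz by (auto simp: frames_def)
  obtain j where j: "pairing G x a = qz (1 / of_nat d) [^]\<^bsub>QZ\<^esub> (j::nat)"
    using QZ_torsion[OF pairing_closed pairing_pow_ord ord_pos] x a by metis
  have "a \<otimes> inv (z [^] j) \<in> perp G x"
    using x a j by (auto simp: perp_def pairing_mult_right pairing_inv_right pairing_pow_right)
  moreover have "a = (a \<otimes> inv (z [^] j)) \<otimes> z [^] j"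
    using x a by (simp add: m_assoc)
  ultimately show ?thesis using that by blast
qed

text \<open>Expansion by bilinearity, where the term pairing z with itself vanishes. For g and h in
  the complement of x, the right side involves only the pairing on the complement and the values
  against z, which are the data preserved by the relation \<open>M\<close> in the lifting
  argument.\<close>

lemma pairing_decomposed:
  assumes "z \<in> carrier G" "g \<in> carrier G" "h \<in> carrier G"
  shows "pairing G (g \<otimes> z [^] (i::nat)) (h \<otimes> z [^] (j::nat)) =
    pairing G g h \<otimes>\<^bsub>QZ\<^esub> (pairing G g z [^]\<^bsub>QZ\<^esub> j \<otimes>\<^bsub>QZ\<^esub> inv\<^bsub>QZ\<^esub> (pairing G h z [^]\<^bsub>QZ\<^esub> i))"
proof -
  have "pairing G (g \<otimes> z [^] i) (h \<otimes> z [^] j) =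
    (pairing G g h \<otimes>\<^bsub>QZ\<^esub> pairing G z h [^]\<^bsub>QZ\<^esub> i) \<otimes>\<^bsub>QZ\<^esub> pairing G g z [^]\<^bsub>QZ\<^esub> j"
    using assms by (simp add: pairing_mult_left pairing_mult_right pairing_pow_left
        pairing_pow_right alternating)
  also have "pairing G z h [^]\<^bsub>QZ\<^esub> i = inv\<^bsub>QZ\<^esub> (pairing G h z [^]\<^bsub>QZ\<^esub> i)"
    using assms pairing_swap[of h z] by (simp add: QZ.nat_pow_inv)
  finally show ?thesis using assms by (simp add: QZ.m_ac)
qed

end

section \<open>Lifting equal reductions to an isomorphism\<close>

lemma reductionsD:
  assumes "\<pi> \<in> reductions G x H"
  shows "\<And>a. a \<in> perp G x \<Longrightarrow> \<pi> a \<in> carrier H" "\<pi> ` perp G x = carrier H"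
    "\<And>a b. a \<in> perp G x \<Longrightarrow> b \<in> perp G x \<Longrightarrow> pairing H (\<pi> a) (\<pi> b) = pairing G a b"
    "\<pi> \<in> extensional (perp G x)"
  using assms by (auto simp: reductions_def PiE_def)

text \<open>As a reduction is onto, test elements of H come from the complement. The use is to see
  that multiples of x are invisible in H.\<close>

lemma reduction_eqI:
  assumes "symplectic_group H" "\<pi> \<in> reductions G x H" "a \<in> perp G x" "b \<in> perp G x"
    and "\<And>e. e \<in> perp G x \<Longrightarrow> pairing G a e = pairing G b e"
  shows "\<pi> a = \<pi> b"
proof -
  interpret H: symplectic_group H by fact
  note r = reductionsD[OF assms(2)]
  show ?thesis
  proof (rule H.eq_by_pairing)
    fix e assume "e \<in> carrier H"
    then obtain e' where "e' \<in> perp G x" "e = \<pi> e'" using r(2) by auto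
    then show "pairing H (\<pi> a) e = pairing H (\<pi> b) e" using r(3) assms by auto
  qed (use r assms in auto)
qed

text \<open>Multiplying \<open>g2\<close> by powers of \<open>x2\<close> changes its pairing with \<open>z2\<close> by any multiple of \<open>1 / d\<close>
  and leaves its image under \<open>\<pi>2\<close> unchanged.\<close>

lemma reduction_lift_total:
  assumes G1: "symplectic_group G1" and G2: "symplectic_group G2" and H: "symplectic_group H"
    and f1: "(x1, z1) \<in> frames G1 d" and f2: "(x2, z2) \<in> frames G2 d"
    and p1: "\<pi>1 \<in> reductions G1 x1 H" and p2: "\<pi>2 \<in> reductions G2 x2 H"
    and c: "\<pi>1 (z1 [^]\<^bsub>G1\<^esub> d) = \<pi>2 (z2 [^]\<^bsub>G2\<^esub> d)"
    and g1: "g1 \<in> perp G1 x1"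
  shows "\<exists>g2\<in>perp G2 x2. \<pi>1 g1 = \<pi>2 g2 \<and> pairing G1 g1 z1 = pairing G2 g2 z2"
proof -
  interpret G1: symplectic_group G1 by fact
  interpret G2: symplectic_group G2 by fact
  interpret H: symplectic_group H by fact
  note r1 = reductionsD[OF p1] and r2 = reductionsD[OF p2]
  have x1: "x1 \<in> carrier G1" "z1 \<in> carrier G1" "G1.ord x1 = d"
    using f1 by (auto simp: frames_def)
  have x2: "x2 \<in> carrier G2" "z2 \<in> carrier G2" "G2.ord x2 = d"
      "pairing G2 x2 z2 = qz (1 / of_nat d)"
    using f2 by (auto simp: frames_def)
  have "\<pi>1 g1 \<in> \<pi>2 ` perp G2 x2" using r1(1)[OF g1] r2(2) by simp
  then obtain g where g: "g \<in> perp G2 x2" "\<pi>1 g1 = \<pi>2 g" by auto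
  have gc: "g \<in> carrier G2" and g1c: "g1 \<in> carrier G1"
    using g g1 by (auto simp: perp_def)
  define t where "t = pairing G1 g1 z1 \<otimes>\<^bsub>QZ\<^esub> inv\<^bsub>QZ\<^esub> pairing G2 g z2"
  have t: "t \<in> carrier QZ" using gc g1c x1 x2 by (simp add: t_def)
  \<comment> \<open>Multiplied by d, the values against z become pairings with d z, which are
    computed in H from the common image c. So the defect \<open>t\<close> is killed by d, and it is
    a multiple of 1 / d that a multiple of \<open>x2\<close> can supply.\<close>
  have "pairing G1 g1 z1 [^]\<^bsub>QZ\<^esub> d = pairing H (\<pi>1 g1) (\<pi>1 (z1 [^]\<^bsub>G1\<^esub> d))"
    using r1(3) g1 g1c x1 G1.pow_ord_in_perp[of x1 z1] by (simp add: G1.pairing_pow_right)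
  also have "\<dots> = pairing G2 g z2 [^]\<^bsub>QZ\<^esub> d"
    using r2(3) g gc x2 c G2.pow_ord_in_perp[of x2 z2] by (simp add: G2.pairing_pow_right)
  finally have "t [^]\<^bsub>QZ\<^esub> d = \<one>\<^bsub>QZ\<^esub>"
    using gc g1c x1 x2 by (simp add: t_def QZ.nat_pow_distrib QZ.nat_pow_inv)
  then obtain k where k: "t = qz (1 / of_nat d) [^]\<^bsub>QZ\<^esub> (k::nat)"
    using QZ_torsion[OF t] G2.ord_pos[of x2] x2 by metis
  define g2 where "g2 = g \<otimes>\<^bsub>G2\<^esub> x2 [^]\<^bsub>G2\<^esub> k"
  have xk: "x2 [^]\<^bsub>G2\<^esub> k \<in> perp G2 x2" using x2 by (simp add: G2.pow_self_in_perp)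
  then have g2: "g2 \<in> perp G2 x2"
    using g(1) x2 G2.perp_subgroup subgroup.m_closed unfolding g2_def by metis
  have "\<pi>2 g2 = \<pi>2 g"
  proof (rule reduction_eqI[OF H p2 g2 g(1)])
    fix e assume e: "e \<in> perp G2 x2"
    then have "pairing G2 x2 e = \<one>\<^bsub>QZ\<^esub>" by (simp add: perp_def)
    then show "pairing G2 g2 e = pairing G2 g e"
      using G2.perp_closed[OF e] gc x2 by (simp add: g2_def G2.pairing_mult_left G2.pairing_pow_left)
  qed
  moreover have "pairing G2 g2 z2 = pairing G2 g z2 \<otimes>\<^bsub>QZ\<^esub> t"
    using gc x2 k by (simp add: g2_def G2.pairing_mult_left G2.pairing_pow_left)
  moreover have "\<dots> = pairing G1 g1 z1"
    using gc g1c x1 x2 by (simp add: t_def QZ.m_ac)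
  ultimately show ?thesis using g2 g by (intro bexI[of _ g2]) auto
qed

text \<open>An element of the complement is pinned down by its image in H together with its pairing
  with z. The relation \<open>M\<close> matches elements of the two complements with equal data, and
  \<open>R\<close> extends it by equal powers of z1 and z2. By \<open>pairing_decomposed\<close> the
  pairing depends on these data alone, so \<open>R\<close> is the graph of an isomorphism.\<close>

lemma reduction_lift:
  assumes G1: "symplectic_group G1" and G2: "symplectic_group G2" and H: "symplectic_group H"
    and f1: "(x1, z1) \<in> frames G1 d" and f2: "(x2, z2) \<in> frames G2 d"
    and p1: "\<pi>1 \<in> reductions G1 x1 H" and p2: "\<pi>2 \<in> reductions G2 x2 H"
    and c: "\<pi>1 (z1 [^]\<^bsub>G1\<^esub> d) = \<pi>2 (z2 [^]\<^bsub>G2\<^esub> d)"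
  obtains \<theta> where "\<theta> \<in> sympl_iso G1 G2" "\<theta> \<in> extensional (carrier G1)"
    "\<theta> x1 = x2" "\<theta> z1 = z2" "\<And>g. g \<in> perp G1 x1 \<Longrightarrow> \<pi>2 (\<theta> g) = \<pi>1 g"
proof -
  interpret G1: symplectic_group G1 by fact
  interpret G2: symplectic_group G2 by fact
  interpret H: symplectic_group H by fact
  note r1 = reductionsD[OF p1] and r2 = reductionsD[OF p2]
  have x1: "x1 \<in> carrier G1" "z1 \<in> carrier G1" "G1.ord x1 = d"
      "pairing G1 x1 z1 = qz (1 / of_nat d)"
    using f1 by (auto simp: frames_def)
  have x2: "x2 \<in> carrier G2" "z2 \<in> carrier G2" "G2.ord x2 = d"
      "pairing G2 x2 z2 = qz (1 / of_nat d)"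
    using f2 by (auto simp: frames_def)
  have one1: "\<one>\<^bsub>G1\<^esub> \<in> perp G1 x1" and one2: "\<one>\<^bsub>G2\<^esub> \<in> perp G2 x2"
    using x1 x2 by (auto simp: perp_def)
  have self1: "x1 \<in> perp G1 x1" and self2: "x2 \<in> perp G2 x2"
    using x1 x2 by (auto simp: perp_def G1.alternating G2.alternating)
  define M where "M g1 g2 \<longleftrightarrow> g1 \<in> perp G1 x1 \<and> g2 \<in> perp G2 x2 \<and>
    g1 \<in> carrier G1 \<and> g2 \<in> carrier G2 \<and> \<pi>1 g1 = \<pi>2 g2 \<and>
    pairing G1 g1 z1 = pairing G2 g2 z2" for g1 g2
  have M1: "\<exists>g2. M g1 g2" if "g1 \<in> perp G1 x1" for g1
    using reduction_lift_total[OF assms that] that G1.perp_closed G2.perp_closed unfolding M_def by metis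
  have M2: "\<exists>g1. M g1 g2" if "g2 \<in> perp G2 x2" for g2
    using reduction_lift_total[OF G2 G1 H f2 f1 p2 p1 c[symmetric] that] that
      G1.perp_closed G2.perp_closed unfolding M_def by metis
  define R where "R a b \<longleftrightarrow> (\<exists>(j::nat) g1 g2. M g1 g2 \<and> a = g1 \<otimes>\<^bsub>G1\<^esub> z1 [^]\<^bsub>G1\<^esub> j \<and>
    b = g2 \<otimes>\<^bsub>G2\<^esub> z2 [^]\<^bsub>G2\<^esub> j)" for a b
  have MR: "R g1 g2" if "M g1 g2" for g1 g2
    unfolding R_def using that x1 x2
    by (intro exI[of _ 0] exI[of _ g1] exI[of _ g2]) (auto simp: M_def)
  obtain \<theta> where \<theta>: "\<theta> \<in> sympl_iso G1 G2" "\<theta> \<in> extensional (carrier G1)"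
    "\<And>a b. R a b \<Longrightarrow> \<theta> a = b"
  proof (rule sympl_iso_of_relation[OF G1 G2, of R])
    show "a \<in> carrier G1 \<and> b \<in> carrier G2" if "R a b" for a b
      using that x1 x2 by (auto simp: R_def M_def)
    show "\<exists>b. R a b" if "a \<in> carrier G1" for a
      using G1.decompose_by_frame[OF f1 that] M1 unfolding R_def by metis
    show "\<exists>a. R a b" if "b \<in> carrier G2" for b
      using G2.decompose_by_frame[OF f2 that] M2 unfolding R_def by metis
    show "pairing G1 a a' = pairing G2 b b'" if "R a b" "R a' b'" for a b a' b'
    proof -
      obtain i g h where M: "M g h" "a = g \<otimes>\<^bsub>G1\<^esub> z1 [^]\<^bsub>G1\<^esub> (i::nat)"
          "b = h \<otimes>\<^bsub>G2\<^esub> z2 [^]\<^bsub>G2\<^esub> i"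
        using \<open>R a b\<close> unfolding R_def by blast
      obtain i' g' h' where M': "M g' h'" "a' = g' \<otimes>\<^bsub>G1\<^esub> z1 [^]\<^bsub>G1\<^esub> (i'::nat)"
          "b' = h' \<otimes>\<^bsub>G2\<^esub> z2 [^]\<^bsub>G2\<^esub> i'"
        using \<open>R a' b'\<close> unfolding R_def by blast
      have "pairing G1 g g' = pairing G2 h h'"
        using M M' r1(3) r2(3) unfolding M_def by metis
      then show ?thesis
        using M M' x1 x2
        by (simp add: G1.pairing_decomposed G2.pairing_decomposed M_def)
    qed
  qed blast
  have "\<theta> g \<in> perp G2 x2 \<and> \<pi>2 (\<theta> g) = \<pi>1 g" if g: "g \<in> perp G1 x1" for g
  proof -
    obtain h where "M g h" using M1[OF g] by blast
    then show ?thesis using \<theta>(3)[OF MR] by (auto simp: M_def)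
  qed
  moreover have p_one1: "\<pi>1 \<one>\<^bsub>G1\<^esub> = \<one>\<^bsub>H\<^esub>"
  proof (rule H.nondegenerate)
    fix e assume "e \<in> carrier H"
    then obtain e' where "e' \<in> perp G1 x1" "e = \<pi>1 e'" using r1(2) by auto
    then show "pairing H (\<pi>1 \<one>\<^bsub>G1\<^esub>) e = \<one>\<^bsub>QZ\<^esub>" using r1(3)[OF one1] G1.perp_closed by simp
  qed (use r1(1) one1 in auto)
  moreover have p_one2: "\<pi>2 \<one>\<^bsub>G2\<^esub> = \<one>\<^bsub>H\<^esub>"
  proof (rule H.nondegenerate)
    fix e assume "e \<in> carrier H"
    then obtain e' where "e' \<in> perp G2 x2" "e = \<pi>2 e'" using r2(2) by auto
    then show "pairing H (\<pi>2 \<one>\<^bsub>G2\<^esub>) e = \<one>\<^bsub>QZ\<^esub>" using r2(3)[OF one2] G2.perp_closed by simp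
  qed (use r2(1) one2 in auto)
  \<comment> \<open>x is orthogonal to its whole complement, so it has the same image in H as the
    unit; with the common value 1 / d against z this puts \<open>x1\<close> and \<open>x2\<close>
    into the relation \<open>M\<close>.\<close>
  moreover have "\<theta> x1 = x2"
  proof (rule \<theta>(3)[OF MR])
    have "\<pi>1 x1 = \<pi>1 \<one>\<^bsub>G1\<^esub>"
      by (rule reduction_eqI[OF H p1 self1 one1]) (auto simp: perp_def)
    moreover have "\<pi>2 x2 = \<pi>2 \<one>\<^bsub>G2\<^esub>"
      by (rule reduction_eqI[OF H p2 self2 one2]) (auto simp: perp_def)
    ultimately show "M x1 x2" using x1 x2 self1 self2 p_one1 p_one2 by (simp add: M_def)
  qed
  moreover have "\<theta> z1 = z2"
  proof (rule \<theta>(3))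
    have "M \<one>\<^bsub>G1\<^esub> \<one>\<^bsub>G2\<^esub>" using x1 x2 one1 one2 p_one1 p_one2 by (simp add: M_def)
    then show "R z1 z2"
      unfolding R_def using x1 x2
      by (intro exI[of _ 1] exI[of _ "\<one>\<^bsub>G1\<^esub>"] exI[of _ "\<one>\<^bsub>G2\<^esub>"]) auto
  qed
  ultimately show ?thesis using that \<theta> by blast
qed

section \<open>Counting values of the pairing, complements and frames\<close>

lemma card_eq_mult_card_image:
  assumes "finite A" "\<And>u. u \<in> f ` A \<Longrightarrow> card {a \<in> A. f a = u} = d"
  shows "card A = d * card (f ` A)"
proof -
  have "card A = (\<Sum>u\<in>f ` A. card {a \<in> A. f a = u})"
    using sum.image_gen[OF assms(1), of "\<lambda>_. 1 :: nat" f] by simp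
  also have "\<dots> = (\<Sum>u\<in>f ` A. d)" by (rule sum.cong) (auto simp: assms(2))
  finally show ?thesis by simp
qed

context symplectic_group
begin

text \<open>The values lie in the torsion of exponent \<open>ord x\<close>, so there are at most
  \<open>ord x\<close> of them. Conversely the number m of values kills every value, hence
  \<open>x [^] m\<close> pairs trivially with everything and is the unit, and \<open>ord x\<close>
  divides m.\<close>

lemma pairing_image:
  assumes x: "x \<in> carrier G"
  shows "pairing G x ` carrier G = (\<lambda>k::nat. qz (1 / of_nat (ord x)) [^]\<^bsub>QZ\<^esub> k) ` {..<ord x}"
    and "card (pairing G x ` carrier G) = ord x"
proof -
  let ?I = "pairing G x ` carrier G"
  let ?C = "(\<lambda>k::nat. qz (1 / of_nat (ord x)) [^]\<^bsub>QZ\<^esub> k) ` {..<ord x}"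
  interpret h: group_hom G QZ "pairing G x" by (rule group_hom_pairing_right[OF x])
  have sub: "?I \<subseteq> ?C"
    using QZ_torsion[OF pairing_closed pairing_pow_ord ord_pos] x by blast
  have finI: "finite ?I" using fin by simp
  interpret I: group "QZ\<lparr>carrier := ?I\<rparr>"
    by (rule QZ.subgroup_imp_group[OF h.img_is_subgroup])
  have "x [^] card ?I = \<one>"
  proof (rule nondegenerate)
    fix y assume y: "y \<in> carrier G"
    then have "pairing G x y [^]\<^bsub>QZ\<lparr>carrier := ?I\<rparr>\<^esub> card ?I = \<one>\<^bsub>QZ\<^esub>"
      using I.pow_order_eq_1[of "pairing G x y"] by (auto simp: order_def)
    then have "pairing G x y [^]\<^bsub>QZ\<^esub> card ?I = \<one>\<^bsub>QZ\<^esub>"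
      by (simp add: nat_pow_def)
    then show "pairing G (x [^] card ?I) y = \<one>\<^bsub>QZ\<^esub>"
      using x y by (simp add: pairing_pow_left)
  qed (use x in auto)
  then have "ord x dvd card ?I" using x pow_eq_id by blast
  moreover have "card ?I > 0" using finI one_closed by (auto simp: card_gt_0_iff)
  ultimately have ge: "card ?I \<ge> ord x" by (simp add: dvd_imp_le)
  have "card ?C \<le> ord x" using card_image_le[of "{..<ord x}"] by simp
  then show eq: "?I = ?C" using ge sub by (intro card_seteq) auto
  show "card ?I = ord x" using ge eq \<open>card ?C \<le> ord x\<close> by simp
qed

lemma card_pairing_fibre:
  assumes x: "x \<in> carrier G" and t: "t \<in> pairing G x ` carrier G"
  shows "card {z \<in> carrier G. pairing G x z = t} = card (perp G x)"
proof -
  obtain z0 where z0: "z0 \<in> carrier G" "t = pairing G x z0" using t by auto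
  have "{z \<in> carrier G. pairing G x z = t} = (\<lambda>y. y \<otimes> z0) ` perp G x"
  proof (intro equalityI subsetI)
    fix z assume z: "z \<in> {z \<in> carrier G. pairing G x z = t}"
    then have "z \<otimes> inv z0 \<in> perp G x"
      using x z0 by (auto simp: perp_def pairing_mult_right pairing_inv_right)
    moreover have "z = (z \<otimes> inv z0) \<otimes> z0" using z z0 by (simp add: m_assoc)
    ultimately show "z \<in> (\<lambda>y. y \<otimes> z0) ` perp G x" by blast
  qed (use x z0 in \<open>auto simp: perp_def pairing_mult_right\<close>)
  moreover have "inj_on (\<lambda>y. y \<otimes> z0) (perp G x)"
    using z0 by (auto simp: inj_on_def perp_def)
  ultimately show ?thesis by (simp add: card_image)
qed

lemma order_eq_card_perp:
  assumes x: "x \<in> carrier G"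
  shows "order G = card (perp G x) * ord x"
  using card_eq_mult_card_image[OF fin card_pairing_fibre[OF x]] pairing_image(2)[OF x]
  by (simp add: order_def)

lemma qz_in_pairing_image:
  assumes x: "x \<in> carrier G"
  shows "qz (1 / of_nat (ord x)) \<in> pairing G x ` carrier G"
\<comment> \<open>The exponent 1 lies below the order of x only if that order exceeds 1; in the
  remaining case the class of 1 / 1 is zero.\<close>
proof (cases "ord x = 1")
  case True
  then have "qz (1 / of_nat (ord x)) = pairing G x \<one>" using x by (simp add: qz_eq_one_iff)
  then show ?thesis by blast
next
  case False
  then have "1 \<in> {..<ord x}" using ord_pos[OF x] by simp
  then have "qz (1 / of_nat (ord x)) [^]\<^bsub>QZ\<^esub> (1::nat) \<in> pairing G x ` carrier G"
    unfolding pairing_image(1)[OF x] by blast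
  then show ?thesis by (simp del: image_iff)
qed

lemma frame_exists:
  assumes "x \<in> carrier G"
  obtains z where "(x, z) \<in> frames G (ord x)"
proof -
  obtain z where "z \<in> carrier G" "qz (1 / of_nat (ord x)) = pairing G x z"
    using qz_in_pairing_image[OF assms] by blast
  then show ?thesis using that[of z] assms by (simp add: frames_def)
qed

lemma card_frame_fibre:
  assumes x: "x \<in> carrier G"
  shows "card {z \<in> carrier G. pairing G x z = qz (1 / of_nat (ord x))} * ord x = order G"
  using card_pairing_fibre[OF x qz_in_pairing_image[OF x]] order_eq_card_perp[OF x] by simp

lemma card_frames:
  "card (frames G d) * d = card {x \<in> carrier G. ord x = d} * order G"
proof -
  let ?X = "{x \<in> carrier G. ord x = d}"
  let ?Z = "\<lambda>x. {z \<in> carrier G. pairing G x z = qz (1 / of_nat d)}"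
  have "frames G d = Sigma ?X ?Z" by (auto simp: frames_def)
  then have "card (frames G d) * d = (\<Sum>x\<in>?X. card (?Z x) * d)"
    using fin by (simp add: card_SigmaI sum_distrib_right)
  also have "\<dots> = (\<Sum>x\<in>?X. order G)"
    using card_frame_fibre by (intro sum.cong) auto
  finally show ?thesis by simp
qed

lemma finite_frames: "finite (frames G d)"
  by (rule finite_subset[of _ "carrier G \<times> carrier G"]) (use fin in \<open>auto simp: frames_def\<close>)

text \<open>Since y kills the complement, only its value against a dual z matters. The complement
  contains \<open>z [^] ord x\<close>, so this value is torsion and equals k times <x, z>; then y
  and k times x agree on generators. This gives the nondegeneracy of the quotient of the complement
  by the span of x.\<close>

lemma perp_perp:
  assumes x: "x \<in> carrier G" and y: "y \<in> carrier G"
    and orth: "\<And>e. e \<in> perp G x \<Longrightarrow> pairing G y e = \<one>\<^bsub>QZ\<^esub>"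
  shows "\<exists>k::nat. y = x [^] k"
proof -
  obtain z where f: "(x, z) \<in> frames G (ord x)" using frame_exists[OF x] .
  then have z: "z \<in> carrier G" "pairing G x z = qz (1 / of_nat (ord x))"
    by (auto simp: frames_def)
  have "pairing G y z [^]\<^bsub>QZ\<^esub> ord x = \<one>\<^bsub>QZ\<^esub>"
    using orth[OF pow_ord_in_perp[OF x z(1)]] y z by (simp add: pairing_pow_right)
  then obtain k where k: "pairing G y z = pairing G x z [^]\<^bsub>QZ\<^esub> (k::nat)"
    using QZ_torsion[of "pairing G y z" "ord x"] ord_pos[OF x] y z by auto
  have "y = x [^] k"
  proof (rule eq_by_pairing)
    fix a assume "a \<in> carrier G"
    then obtain g j where g: "g \<in> perp G x" "a = g \<otimes> z [^] (j::nat)"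
      using decompose_by_frame[OF f] by blast
    have gc: "g \<in> carrier G" "pairing G x g = \<one>\<^bsub>QZ\<^esub>" using g by (auto simp: perp_def)
    show "pairing G y a = pairing G (x [^] k) a"
      using gc g x y z(1) orth[OF g(1)] k
      by (simp add: pairing_mult_right pairing_pow_right pairing_pow_left)
  qed (use x y in auto)
  then show ?thesis by blast
qed

end

text \<open>The quotient is realised on the least elements of the cosets of the subgroup generated by
  \<open>x\<close>, so that its pairing is the restriction of the given one.\<close>

lemma reduction_exists:
  fixes G :: "nat sympl" (structure)
  assumes "symplectic_group G" and x: "x \<in> carrier G"
  obtains H :: "nat sympl" and \<pi> where "symplectic_group H" "\<pi> \<in> reductions G x H"
    "order G = (group.ord G x)\<^sup>2 * order H"
proof -
  interpret symplectic_group G by fact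
  define X where "X = generate G {x}"
  have subX: "subgroup X G" unfolding X_def using x by (intro generate_is_subgroup) auto
  have X: "X = {x [^] k | k. k \<in> (UNIV :: nat set)}"
    unfolding X_def using generate_pow_nat[OF x] ord_pos[OF x] by simp
  have cardX: "card X = ord x" unfolding X_def using generate_pow_card[OF x] by simp
  have subP: "subgroup (perp G x) G" by (rule perp_subgroup[OF x])
  note Pm = subgroup.m_closed[OF subP] and Pi = subgroup.m_inv_closed[OF subP]
    and P1 = subgroup.one_closed[OF subP]
  have XP: "x [^] k \<in> perp G x" for k :: nat using pow_self_in_perp[OF x] .
  have coset: "X #> a = {x [^] k \<otimes> a | k. k \<in> (UNIV :: nat set)}" for a
    unfolding X r_coset_def by auto
  define r where "r a = (LEAST b. b \<in> X #> a)" for a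
  have r_in: "r a \<in> X #> a" if "a \<in> carrier G" for a
    unfolding r_def using rcos_self[OF that subX] by (rule LeastI)
  have r_ex: "\<exists>k::nat. r a = x [^] k \<otimes> a" if "a \<in> carrier G" for a
    using r_in[OF that] by (auto simp: coset)
  have r_cong: "r b = r a" if "b \<in> X #> a" "a \<in> carrier G" for a b
    unfolding r_def using repr_independence[OF that subX] by simp
  have r_eq: "r (x [^] k \<otimes> a) = r a" if "a \<in> carrier G" for k :: nat and a
    by (rule r_cong) (use that in \<open>auto simp: coset\<close>)
  have rP: "r a \<in> perp G x" if "a \<in> perp G x" for a
    using r_ex[OF perp_closed[OF that]] Pm[OF XP that] by auto
  have r_l: "r (r a \<otimes> b) = r (a \<otimes> b)" if ab: "a \<in> carrier G" "b \<in> carrier G" for a b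
  proof -
    obtain k where "r a = x [^] (k::nat) \<otimes> a" using r_ex[OF ab(1)] by blast
    then show ?thesis using ab x r_eq[of "a \<otimes> b" k] by (simp add: m_assoc)
  qed
  have rc: "r a \<in> carrier G" if "a \<in> carrier G" for a using r_ex[OF that] that x by auto
  have r_r: "r (a \<otimes> r b) = r (a \<otimes> b)" if ab: "a \<in> carrier G" "b \<in> carrier G" for a b
    using r_l[OF ab(2,1)] ab rc by (simp add: m_comm)
  have rr: "r (r a) = r a" if "a \<in> carrier G" for a using r_cong[OF r_in] that by simp
  \<comment> \<open>A representative differs from a by a multiple of x, which the complement does
    not see.\<close>
  have pair_l: "pairing G (r a) e = pairing G a e" if ae: "a \<in> carrier G" "e \<in> perp G x" for a e
  proof -
    obtain k where "r a = x [^] (k::nat) \<otimes> a" using r_ex[OF ae(1)] by blast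
    moreover have "pairing G x e = \<one>\<^bsub>QZ\<^esub>" "e \<in> carrier G" using ae by (auto simp: perp_def)
    ultimately show ?thesis
      using ae x by (simp add: pairing_mult_left pairing_pow_left)
  qed
  have pair_r: "pairing G e (r a) = pairing G e a" if "a \<in> carrier G" "e \<in> perp G x" for a e
    using pair_l[OF that] that rc perp_closed[OF that(2)] pairing_swap by metis
  define H :: "nat sympl" where "H = \<lparr>carrier = r ` perp G x, monoid.mult = (\<lambda>u v. r (u \<otimes> v)),
    one = r \<one>, pairing = pairing G\<rparr>"
  have HP: "u \<in> perp G x" "u \<in> carrier G" "r u = u" if "u \<in> carrier H" for u
    using that rP rr perp_closed by (auto simp: H_def)
  have rH: "r a \<in> carrier H" if "a \<in> perp G x" for a using that by (auto simp: H_def)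
  interpret H: comm_group H
  proof (rule comm_groupI)
    fix u v assume u: "u \<in> carrier H" and v: "v \<in> carrier H"
    show "u \<otimes>\<^bsub>H\<^esub> v \<in> carrier H"
      using rH[OF Pm[OF HP(1)[OF u] HP(1)[OF v]]] by (simp add: H_def)
    show "u \<otimes>\<^bsub>H\<^esub> v = v \<otimes>\<^bsub>H\<^esub> u"
      using HP[OF u] HP[OF v] by (simp add: H_def m_comm)
    fix w assume w: "w \<in> carrier H"
    show "u \<otimes>\<^bsub>H\<^esub> v \<otimes>\<^bsub>H\<^esub> w = u \<otimes>\<^bsub>H\<^esub> (v \<otimes>\<^bsub>H\<^esub> w)"
      using HP[OF u] HP[OF v] HP[OF w] r_l r_r by (simp add: H_def m_assoc)
  next
    show "\<one>\<^bsub>H\<^esub> \<in> carrier H" using P1 by (auto simp: H_def)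
  next
    fix u assume u: "u \<in> carrier H"
    show "\<one>\<^bsub>H\<^esub> \<otimes>\<^bsub>H\<^esub> u = u" using HP[OF u] r_l by (simp add: H_def)
    have "r (inv u) \<in> carrier H" using rH[OF Pi[OF HP(1)[OF u]]] .
    moreover have "r (inv u) \<otimes>\<^bsub>H\<^esub> u = \<one>\<^bsub>H\<^esub>" using HP[OF u] r_l by (simp add: H_def)
    ultimately show "\<exists>v\<in>carrier H. v \<otimes>\<^bsub>H\<^esub> u = \<one>\<^bsub>H\<^esub>" by blast
  qed
  have pairH: "pairing H = pairing G" by (simp add: H_def)
  have multH: "u \<otimes>\<^bsub>H\<^esub> v = r (u \<otimes> v)" for u v by (simp add: H_def)
  have oneH: "\<one>\<^bsub>H\<^esub> = r \<one>" by (simp add: H_def)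
  have "symplectic_group H"
  proof
    show "finite (carrier H)" using finite_perp by (simp add: H_def)
    show "pairing H u \<in> hom H QZ" if u: "u \<in> carrier H" for u
      using HP u pair_r by (auto simp: hom_def pairH multH pairing_mult_right)
    show "(\<lambda>v. pairing H v u) \<in> hom H QZ" if u: "u \<in> carrier H" for u
      using HP u pair_l by (auto simp: hom_def pairH multH pairing_mult_left)
    show "pairing H u u = \<one>\<^bsub>QZ\<^esub>" if u: "u \<in> carrier H" for u
      using HP[OF u] by (simp add: pairH alternating)
    show "u = \<one>\<^bsub>H\<^esub>" if u: "u \<in> carrier H"
      and orth: "\<And>v. v \<in> carrier H \<Longrightarrow> pairing H u v = \<one>\<^bsub>QZ\<^esub>" for u
    proof -
      have "pairing G u e = \<one>\<^bsub>QZ\<^esub>" if "e \<in> perp G x" for e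
        using orth[OF rH[OF that]] pair_r[OF perp_closed[OF that] HP(1)[OF u]] by (simp add: pairH)
      then obtain k where "u = x [^] (k::nat)" using perp_perp[OF x HP(2)[OF u]] by blast
      then show ?thesis using r_eq[of \<one> k] HP[OF u] x by (simp add: oneH)
    qed
  qed
  moreover have "restrict r (perp G x) \<in> reductions G x H"
    using rH pair_l pair_r rP perp_closed by (auto simp: reductions_def H_def)
  \<comment> \<open>One factor \<open>ord x\<close> is the index of the complement in G, the other
    is the size of the cosets that \<open>r\<close> collapses.\<close>
  moreover have "order G = (ord x)\<^sup>2 * order H"
  proof -
    have "card {a \<in> perp G x. r a = u} = ord x" if u: "u \<in> r ` perp G x" for u
    proof -
      obtain b where b: "b \<in> perp G x" "u = r b" using u by blast
      have bc: "b \<in> carrier G" by (rule perp_closed[OF b(1)])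
      have "{a \<in> perp G x. r a = u} = X #> b"
      proof (intro equalityI subsetI)
        fix a assume a: "a \<in> {a \<in> perp G x. r a = u}"
        then have ac: "a \<in> carrier G" by (auto simp: perp_def)
        have "X #> a = X #> r a" using r_in[OF ac] ac subX by (intro repr_independence) auto
        also have "\<dots> = X #> b"
          using a b repr_independence[OF r_in[OF bc] bc subX] by simp
        finally show "a \<in> X #> b" using rcos_self[OF ac subX] by simp
      next
        fix a assume "a \<in> X #> b"
        then show "a \<in> {a \<in> perp G x. r a = u}"
          using b r_cong[OF _ bc] Pm[OF XP b(1)] by (auto simp: coset)
      qed
      moreover have "card (X #> b) = card X"
        using card_rcosets_equal[OF rcosetsI[OF subgroup.subset[OF subX] bc] subgroup.subset[OF subX]]
        by simp
      ultimately show ?thesis using cardX by simp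
    qed
    then have "card (perp G x) = ord x * card (r ` perp G x)"
      by (rule card_eq_mult_card_image[OF finite_perp])
    then show ?thesis
      using order_eq_card_perp[OF x] by (simp add: order_def H_def power2_eq_square)
  qed
  ultimately show ?thesis using that by blast
qed

section \<open>Mass of the classes of given order\<close>

abbreviation rp :: "sympl_class \<Rightarrow> nat sympl"
  where "rp \<equiv> rep_sympl_class"

lemma sympl_isomorphic_rep: "sympl_isomorphic (rp C) (rp C)"
  using Quotient_rep_reflp[OF Quotient_sympl_class] .

lemma symplectic_rep: "symplectic_group (rp C)"
  using sympl_isomorphic_rep by (auto simp: sympl_isomorphic_def)

lemma sympl_isomorphic_rep_iff: "sympl_isomorphic (rp C) (rp D) \<longleftrightarrow> C = D"
  using Quotient_rel_rep[OF Quotient_sympl_class] .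

lemma class_eqI: "\<theta> \<in> sympl_iso (rp C) (rp D) \<Longrightarrow> C = D"
  unfolding sympl_isomorphic_rep_iff[symmetric] sympl_isomorphic_def using symplectic_rep by blast

lemma class_exists:
  fixes G :: "nat sympl"
  assumes "symplectic_group G"
  obtains C where "sympl_isomorphic G (rp C)"
proof -
  have "sympl_isomorphic G G"
    using assms sympl_iso_refl by (auto simp: sympl_isomorphic_def)
  then have "sympl_isomorphic (rp (abs_sympl_class G)) G"
    using Quotient_rep_abs[OF Quotient_sympl_class] by blast
  then show ?thesis using that sympl_isomorphic_sym by blast
qed

lemma class_order_pos: "class_order C > 0"
  using symplectic_group.order_pos[OF symplectic_rep] by (simp add: class_order.rep_eq)

lemma class_weight_eq:
  "class_weight C = real (class_order C) / real (card (Sp (rp C)))"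
  by (simp add: class_weight.rep_eq class_order.rep_eq weight_def)

lemma class_weight_pos: "class_weight C > 0"
  using class_order_pos card_Sp_pos[OF symplectic_rep] by (simp add: class_weight_eq)

section \<open>Reductions between classes, and finiteness of the classes of given order\<close>

lemma reductions_compose_iso:
  assumes p: "\<pi> \<in> reductions G x H" and h: "h \<in> sympl_iso H K"
  shows "restrict (h \<circ> \<pi>) (perp G x) \<in> reductions G x K"
proof -
  note r = reductionsD[OF p] and hd = sympl_isoD[OF h]
  have "h ` carrier H = carrier K" using hd(1) by (simp add: bij_betw_def)
  then have "(h \<circ> \<pi>) ` perp G x = carrier K" using r(2) by (metis image_comp)
  then show ?thesis using r hd(3) by (auto simp: reductions_def)
qed

lemma finite_reductions:
  assumes "symplectic_group G" "symplectic_group H"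
  shows "finite (reductions G x H)"
proof (rule finite_subset)
  show "reductions G x H \<subseteq> perp G x \<rightarrow>\<^sub>E carrier H" by (auto simp: reductions_def)
  show "finite (perp G x \<rightarrow>\<^sub>E carrier H)"
    using symplectic_group.finite_perp[OF assms(1)] symplectic_group.fin[OF assms(2)]
    by (auto intro: finite_PiE)
qed

text \<open>Sp of H acts on the reductions by composition, freely because they are onto. One
  reduction thus produces #Sp(H) of them, and this supplies the denominator in the weight of
  H.\<close>

lemma card_Sp_le_card_reductions:
  assumes "symplectic_group G" "symplectic_group H" and p: "\<pi> \<in> reductions G x H"
  shows "card (Sp H) \<le> card (reductions G x H)"
proof (rule card_inj_on_le)
  let ?f = "\<lambda>\<sigma>. restrict (\<sigma> \<circ> \<pi>) (perp G x)"
  show "?f ` Sp H \<subseteq> reductions G x H"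
    using reductions_compose_iso[OF p] by (auto simp: Sp_eq)
  show "finite (reductions G x H)" by (rule finite_reductions) fact+
  show "inj_on ?f (Sp H)"
  proof (rule inj_onI)
    fix \<sigma> \<tau> assume s: "\<sigma> \<in> Sp H" "\<tau> \<in> Sp H" and e: "?f \<sigma> = ?f \<tau>"
    have "\<sigma> u = \<tau> u" if u: "u \<in> carrier H" for u
    proof -
      obtain a where a: "a \<in> perp G x" "u = \<pi> a" using u reductionsD(2)[OF p] by blast
      then show ?thesis using fun_cong[OF e, of a] by simp
    qed
    then show "\<sigma> = \<tau>"
      using s by (intro extensionalityI[of _ "carrier H"]) (auto simp: Sp_eq)
  qed
qed

lemma reduction_class_exists:
  assumes x: "x \<in> carrier (rp C)"
  obtains D \<pi> where "\<pi> \<in> reductions (rp C) x (rp D)"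
    "class_order C = (group.ord (rp C) x)\<^sup>2 * class_order D"
proof -
  obtain H :: "nat sympl" and \<pi> where H: "symplectic_group H" "\<pi> \<in> reductions (rp C) x H"
    "order (rp C) = (group.ord (rp C) x)\<^sup>2 * order H"
    using reduction_exists[OF symplectic_rep x] .
  obtain D where D: "sympl_isomorphic H (rp D)" using class_exists[OF H(1)] .
  then obtain h where "h \<in> sympl_iso H (rp D)" by (auto simp: sympl_isomorphic_def)
  from reductions_compose_iso[OF H(2) this] show ?thesis
    using that H(3) order_cong[OF D] by (simp add: class_order.rep_eq)
qed

text \<open>The data d, D and c determine the class. This serves twice: for finiteness by induction
  on the order, and to see that all triples with the same c live over one class.\<close>

lemma class_eq_by_reduction:
  assumes "(x1, z1) \<in> frames (rp C1) d" "(x2, z2) \<in> frames (rp C2) d"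
    and "\<pi>1 \<in> reductions (rp C1) x1 (rp D)" "\<pi>2 \<in> reductions (rp C2) x2 (rp D)"
    and "\<pi>1 (z1 [^]\<^bsub>rp C1\<^esub> d) = \<pi>2 (z2 [^]\<^bsub>rp C2\<^esub> d)"
  shows "C1 = C2"
  using reduction_lift[OF symplectic_rep symplectic_rep symplectic_rep assms] class_eqI
  by metis

lemma class_order_one_unique:
  assumes "class_order C = 1" "class_order D = 1"
  shows "C = D"
proof -
  interpret C: symplectic_group "rp C" by (rule symplectic_rep)
  interpret D: symplectic_group "rp D" by (rule symplectic_rep)
  have c: "carrier (rp C) = {\<one>\<^bsub>rp C\<^esub>}"
    using assms(1) C.order_one_triv_iff by (simp add: class_order.rep_eq)
  have d: "carrier (rp D) = {\<one>\<^bsub>rp D\<^esub>}"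
    using assms(2) D.order_one_triv_iff by (simp add: class_order.rep_eq)
  obtain \<theta> where "\<theta> \<in> sympl_iso (rp C) (rp D)"
    by (rule sympl_iso_of_relation[OF symplectic_rep symplectic_rep,
          of "\<lambda>a b. a = \<one>\<^bsub>rp C\<^esub> \<and> b = \<one>\<^bsub>rp D\<^esub>"]) (auto simp: c d)
  then show ?thesis by (rule class_eqI)
qed

text \<open>A class of order n >= 2 has an element of order d >= 2, so it is recovered from d <= n,
  a class D of smaller order and an element c of D; by induction these are finitely many. Finiteness
  must come first, since a sum over an infinite set of classes would have the default value
  0.\<close>

lemma finite_class_order: "finite {C. class_order C = n}"
proof (induction n rule: less_induct)
  case (less n)
  consider "n = 0" | "n = 1" | "n \<ge> 2" by linarith
  then show ?case
  proof cases
    case 1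
    then show ?thesis using class_order_pos by (metis (mono_tags) Collect_empty_eq finite.emptyI less_not_refl)
  next
    case 2
    then have "{C. class_order C = n} \<subseteq> {SOME C. class_order C = 1}"
      using class_order_one_unique by (auto intro: someI2)
    then show ?thesis by (rule finite_subset) simp
  next
    case 3
    define R where "R C t \<longleftrightarrow> (case t of (d, D, c) \<Rightarrow> \<exists>x z \<pi>. (x, z) \<in> frames (rp C) d \<and>
      \<pi> \<in> reductions (rp C) x (rp D) \<and> c = \<pi> (z [^]\<^bsub>rp C\<^esub> d))" for C t
    define T where "T = {..n} \<times> (SIGMA D:(\<Union>m<n. {D. class_order D = m}). carrier (rp D))"
    have ex: "\<exists>t\<in>T. R C t" if C: "class_order C = n" for C
    proof -
      interpret symplectic_group "rp C" by (rule symplectic_rep)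
      have "carrier (rp C) \<noteq> {\<one>\<^bsub>rp C\<^esub>}"
        using C 3 order_one_triv_iff by (auto simp: class_order.rep_eq)
      then obtain x where x: "x \<in> carrier (rp C)" "x \<noteq> \<one>\<^bsub>rp C\<^esub>" using one_closed by blast
      define d where "d = ord x"
      have "d \<noteq> 0" "d \<noteq> 1" using x ord_pos ord_eq_1 by (auto simp: d_def)
      then have d2: "d \<ge> 2" by linarith
      obtain z where z: "(x, z) \<in> frames (rp C) d" using frame_exists[OF x(1)] by (auto simp: d_def)
      obtain D \<pi> where D: "\<pi> \<in> reductions (rp C) x (rp D)" "class_order C = d\<^sup>2 * class_order D"
        using reduction_class_exists[OF x(1)] unfolding d_def by blast
      have "1 < d\<^sup>2" using d2 one_less_power[of d 2] by simp
      then have "class_order D < n" using D(2) C class_order_pos[of D] by simp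
      moreover have "d \<le> n"
        using D(2) C class_order_pos[of D] d2 by (simp add: power2_eq_square)
      moreover have "\<pi> (z [^]\<^bsub>rp C\<^esub> d) \<in> carrier (rp D)"
        using reductionsD(1)[OF D(1)] pow_ord_in_perp[of x z] z x by (auto simp: d_def frames_def)
      ultimately have "(d, D, \<pi> (z [^]\<^bsub>rp C\<^esub> d)) \<in> T" by (auto simp: T_def)
      moreover have "R C (d, D, \<pi> (z [^]\<^bsub>rp C\<^esub> d))" using z D by (auto simp: R_def)
      ultimately show ?thesis by blast
    qed
    have unique: "C1 = C2" if "R C1 t" "R C2 t" for C1 C2 t
      using that class_eq_by_reduction by (cases t) (auto simp: R_def)
    have "{C. class_order C = n} \<subseteq> (\<lambda>t. SOME C. R C t) ` T"
    proof
      fix C assume "C \<in> {C. class_order C = n}"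
      then have "class_order C = n" by simp
      from ex[OF this] obtain t where t: "t \<in> T" "R C t" by blast
      then have "(SOME C. R C t) = C" using unique by (metis someI_ex)
      then show "C \<in> (\<lambda>t. SOME C. R C t) ` T" using t by blast
    qed
    moreover have "finite T"
      unfolding T_def using less.IH symplectic_group.fin[OF symplectic_rep] by auto
    ultimately show ?thesis using finite_subset by blast
  qed
qed

lemma finite_class_order_le: "finite {C. class_order C \<le> n}"
proof -
  have "{C. class_order C \<le> n} = (\<Union>m\<le>n. {C. class_order C = m})" by auto
  then show ?thesis using finite_class_order by auto
qed

section \<open>The recursive inequality for b(n), here \<open>mass n\<close>\<close>

definition mass :: "nat \<Rightarrow> real"
  where "mass n = (\<Sum>C | class_order C = n. class_weight C)"

lemma mass_nonneg: "mass n \<ge> 0"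
  unfolding mass_def using class_weight_pos by (intro sum_nonneg) (auto intro: less_imp_le)

text \<open>Over a fixed target \<open>D\<close> and a fixed image \<open>c\<close> of \<open>z [^] d\<close>, all triples \<open>(x, z, \<pi>)\<close> lie in one
  class \<open>C\<close>, and \<open>Sp\<close> of its representative acts on them simply transitively.\<close>

lemma sum_card_reductions_le:
  "(\<Sum>C | class_order C = n. \<Sum>(x, z)\<in>frames (rp C) d.
      real (card (reductions (rp C) x (rp D))) / real (card (Sp (rp C)))) \<le> real (class_order D)"
proof -
  interpret D: symplectic_group "rp D" by (rule symplectic_rep)
  define Q where "Q = (SIGMA C:{C. class_order C = n}. SIGMA xz:frames (rp C) d.
    reductions (rp C) (fst xz) (rp D))"
  define g where "g = (\<lambda>(C, (x :: nat, z :: nat), \<pi> :: nat \<Rightarrow> nat). \<pi> (z [^]\<^bsub>rp C\<^esub> d))"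
  define s where "s C = real (card (Sp (rp C)))" for C
  have s: "s C > 0" for C using card_Sp_pos[OF symplectic_rep] by (simp add: s_def)
  have fin1: "finite (SIGMA xz:frames (rp C) d. reductions (rp C) (fst xz) (rp D))" for C
    using symplectic_group.finite_frames[OF symplectic_rep]
      finite_reductions[OF symplectic_rep symplectic_rep] by auto
  have finQ: "finite Q" unfolding Q_def using finite_class_order fin1 by auto
  have gQ: "g ` Q \<subseteq> carrier (rp D)"
  proof (rule image_subsetI)
    fix q assume "q \<in> Q"
    then obtain C x z \<pi> where q: "q = (C, (x, z), \<pi>)" "(x, z) \<in> frames (rp C) d"
      "\<pi> \<in> reductions (rp C) x (rp D)" by (auto simp: Q_def)
    interpret symplectic_group "rp C" by (rule symplectic_rep)
    have "z [^]\<^bsub>rp C\<^esub> d \<in> perp (rp C) x" using q(2) pow_ord_in_perp by (auto simp: frames_def)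
    then show "g q \<in> carrier (rp D)" using reductionsD(1)[OF q(3)] q(1) by (simp add: g_def)
  qed
  have fibre: "(\<Sum>q\<in>{q \<in> Q. g q = c}. 1 / s (fst q)) \<le> 1" for c
  proof (cases "{q \<in> Q. g q = c} = {}")
    case True
    then show ?thesis by (simp only:) simp
  next
    case False
    then obtain C0 x0 z0 \<pi>0 where q0: "(x0, z0) \<in> frames (rp C0) d"
      "\<pi>0 \<in> reductions (rp C0) x0 (rp D)" "c = \<pi>0 (z0 [^]\<^bsub>rp C0\<^esub> d)"
      by (auto simp: Q_def g_def)
    have same: "C = C0" if "(C, (x, z), \<pi>) \<in> Q" "g (C, (x, z), \<pi>) = c" for C x z \<pi>
      using that q0 by (intro class_eq_by_reduction[of x z C d x0 z0 C0 \<pi> D \<pi>0])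
        (auto simp: Q_def g_def)
    \<comment> \<open>The automorphism \<open>\<theta>\<close> carries the base triple to q. Every q
      in the fibre admits such a \<open>\<theta>\<close>, and \<open>\<theta>\<close> determines q,
      so the fibre has at most #Sp(C0) members, each contributing 1 / #Sp(C0).\<close>
    define L where "L q \<theta> \<longleftrightarrow> (case q of (C :: sympl_class, (x, z), \<pi>) \<Rightarrow>
      \<theta> \<in> Sp (rp C0) \<and> \<theta> x0 = x \<and> \<theta> z0 = z \<and>
      (\<forall>a\<in>perp (rp C0) x0. \<theta> a \<in> perp (rp C0) x \<and> \<pi> (\<theta> a) = \<pi>0 a))" for q \<theta>
    have L_ex: "\<exists>\<theta>. L q \<theta>" if q: "q \<in> {q \<in> Q. g q = c}" for q
    proof -
      obtain C x z \<pi> where q': "q = (C, (x, z), \<pi>)" by (metis prod.collapse)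
      have C: "C = C0" using q q' same by auto
      have f: "(x, z) \<in> frames (rp C0) d" "\<pi> \<in> reductions (rp C0) x (rp D)"
        "\<pi>0 (z0 [^]\<^bsub>rp C0\<^esub> d) = \<pi> (z [^]\<^bsub>rp C0\<^esub> d)"
        using q C q0 unfolding q' by (auto simp: Q_def g_def)
      show ?thesis
      proof (rule reduction_lift[OF symplectic_rep symplectic_rep symplectic_rep
            q0(1) f(1) q0(2) f(2,3)])
        fix \<theta> assume t: "\<theta> \<in> sympl_iso (rp C0) (rp C0)" "\<theta> \<in> extensional (carrier (rp C0))"
          "\<theta> x0 = x" "\<theta> z0 = z" "\<And>a. a \<in> perp (rp C0) x0 \<Longrightarrow> \<pi> (\<theta> a) = \<pi>0 a"
        have "\<theta> a \<in> perp (rp C0) x" if "a \<in> perp (rp C0) x0" for a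
        proof -
          have "a \<in> carrier (rp C0)" "pairing (rp C0) x0 a = \<one>\<^bsub>QZ\<^esub>" "x0 \<in> carrier (rp C0)"
            using that q0(1) by (auto simp: perp_def frames_def)
          then show ?thesis
            using sympl_isoD[OF t(1)] t(3) by (auto simp: perp_def bij_betwE)
        qed
        then show ?thesis using t by (auto simp: L_def q' Sp_eq)
      qed
    qed
    have L_inj: "q = q'" if "q \<in> {q \<in> Q. g q = c}" "q' \<in> {q \<in> Q. g q = c}"
      "L q \<theta>" "L q' \<theta>" for q q' \<theta>
    proof -
      obtain C x z \<pi> where q: "q = (C, (x, z), \<pi>)" by (metis prod.collapse)
      obtain C' x' z' \<pi>' where q': "q' = (C', (x', z'), \<pi>')" by (metis prod.collapse)
      have C: "C = C0" "C' = C0" using that(1,2) same unfolding q q' by auto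
      have th: "\<theta> \<in> Sp (rp C0)" and x: "x = \<theta> x0" "x' = \<theta> x0" "z = z'"
        using that(3,4) by (auto simp: L_def q q')
      have x0: "x0 \<in> carrier (rp C0)" using q0(1) by (auto simp: frames_def)
      have i: "\<theta> \<in> sympl_iso (rp C0) (rp C0)" using th by (simp add: Sp_eq)
      \<comment> \<open>Because \<open>\<theta>\<close> maps the complement of \<open>x0\<close>
        onto that of x, the values of both reductions can be read off from
        \<open>\<pi>0\<close>.\<close>
      have "perp (rp C0) x \<subseteq> \<theta> ` perp (rp C0) x0"
      proof
        fix b assume b: "b \<in> perp (rp C0) x"
        then have "b \<in> carrier (rp C0)" by (simp add: perp_def)
        then obtain a where a: "a \<in> carrier (rp C0)" "b = \<theta> a"
          using sympl_isoD(1)[OF i] by (auto simp: bij_betw_def)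
        then have "a \<in> perp (rp C0) x0"
          using b sympl_isoD(3)[OF i x0] x by (auto simp: perp_def)
        then show "b \<in> \<theta> ` perp (rp C0) x0" using a by blast
      qed
      then have "\<pi> b = \<pi>' b" if "b \<in> perp (rp C0) x" for b
        using \<open>L q \<theta>\<close> \<open>L q' \<theta>\<close> that by (auto simp: L_def q q')
      moreover have "\<pi> \<in> extensional (perp (rp C0) x)" "\<pi>' \<in> extensional (perp (rp C0) x)"
        using that(1,2) reductionsD(4) C x unfolding q q' by (auto simp: Q_def)
      ultimately have "\<pi> = \<pi>'" by (intro extensionalityI[of _ "perp (rp C0) x"]) auto
      then show ?thesis using q q' C x by simp
    qed
    have "card {q \<in> Q. g q = c} \<le> card (Sp (rp C0))"
    proof (rule card_inj_on_le)
      let ?f = "\<lambda>q. SOME \<theta>. L q \<theta>"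
      have L: "L q (?f q)" if "q \<in> {q \<in> Q. g q = c}" for q using L_ex[OF that] by (rule someI_ex)
      show "inj_on ?f {q \<in> Q. g q = c}"
      proof (rule inj_onI)
        fix q q' assume "q \<in> {q \<in> Q. g q = c}" "q' \<in> {q \<in> Q. g q = c}" "?f q = ?f q'"
        then show "q = q'" using L_inj[of q q' "?f q"] L[of q] L[of q'] by auto
      qed
      show "?f ` {q \<in> Q. g q = c} \<subseteq> Sp (rp C0)"
      proof (rule image_subsetI)
        fix q assume "q \<in> {q \<in> Q. g q = c}"
        from L[OF this] show "?f q \<in> Sp (rp C0)" by (cases q) (auto simp: L_def)
      qed
      show "finite (Sp (rp C0))" by (rule symplectic_group.Sp_finite[OF symplectic_rep])
    qed
    then have "real (card {q \<in> Q. g q = c}) \<le> s C0" by (simp add: s_def)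
    moreover have "(\<Sum>q\<in>{q \<in> Q. g q = c}. 1 / s (fst q)) = (\<Sum>q\<in>{q \<in> Q. g q = c}. 1 / s C0)"
    proof (rule sum.cong)
      fix q assume "q \<in> {q \<in> Q. g q = c}"
      then show "1 / s (fst q) = 1 / s C0" using same by (cases q) auto
    qed simp
    ultimately show ?thesis using s[of C0] by simp
  qed
  have "(\<Sum>C | class_order C = n. \<Sum>(x, z)\<in>frames (rp C) d.
      real (card (reductions (rp C) x (rp D))) / s C) =
    (\<Sum>C | class_order C = n. \<Sum>xz\<in>frames (rp C) d. \<Sum>\<pi>\<in>reductions (rp C) (fst xz) (rp D).
      1 / s C)"
    by (intro sum.cong) auto
  also have "\<dots> = (\<Sum>C | class_order C = n.
      \<Sum>q\<in>(SIGMA xz:frames (rp C) d. reductions (rp C) (fst xz) (rp D)). 1 / s C)"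
    using symplectic_group.finite_frames[OF symplectic_rep]
      finite_reductions[OF symplectic_rep symplectic_rep]
    by (intro sum.cong refl, subst sum.Sigma) (auto simp: split_def)
  also have "\<dots> = (\<Sum>q\<in>Q. 1 / s (fst q))"
    unfolding Q_def using finite_class_order fin1 by (subst sum.Sigma) (auto simp: split_def)
  \<comment> \<open>Regrouping by the parameter c: each of the #D possible values contributes at
    most 1.\<close>
  also have "\<dots> = (\<Sum>c\<in>carrier (rp D). \<Sum>q\<in>{q \<in> Q. g q = c}. 1 / s (fst q))"
    by (rule sum.group[OF finQ D.fin gQ, symmetric])
  also have "\<dots> \<le> (\<Sum>c\<in>carrier (rp D). 1)" by (intro sum_mono fibre)
  also have "\<dots> = real (class_order D)" by (simp add: class_order.rep_eq order_def)
  finally show ?thesis by (simp add: s_def)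
qed

text \<open>Every frame has a reduction to some D with n = d^2 #D, hence at least #Sp(D) of them, so
  counting reductions with weight 1 / #Sp(D) counts each frame at least once. After exchanging the
  sums, D contributes at most #D / #Sp(D), its weight.\<close>

lemma sum_card_frames_le:
  assumes "d > 0"
  shows "(\<Sum>C | class_order C = n. real (card (frames (rp C) d)) / real (card (Sp (rp C)))) \<le>
    (if d\<^sup>2 dvd n then mass (n div d\<^sup>2) else 0)"
proof -
  define s where "s C = real (card (Sp (rp C)))" for C
  have s: "s C > 0" for C using card_Sp_pos[OF symplectic_rep] by (simp add: s_def)
  define E where "E = {D. n = d\<^sup>2 * class_order D}"
  have E: "E = (if d\<^sup>2 dvd n then {D. class_order D = n div d\<^sup>2} else {})"
    using assms by (auto simp: E_def)
  have finE: "finite E" using finite_class_order by (simp add: E)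
  have le: "1 / s C \<le> (\<Sum>D\<in>E. real (card (reductions (rp C) x (rp D))) / s C / s D)"
    if C: "class_order C = n" and f: "(x, z) \<in> frames (rp C) d" for C x z
  proof -
    have x: "x \<in> carrier (rp C)" "group.ord (rp C) x = d" using f by (auto simp: frames_def)
    obtain D \<pi> where D: "\<pi> \<in> reductions (rp C) x (rp D)" "D \<in> E"
      using reduction_class_exists[OF x(1)] x(2) C unfolding E_def by blast
    have "s D \<le> real (card (reductions (rp C) x (rp D)))"
      using card_Sp_le_card_reductions[OF symplectic_rep symplectic_rep D(1)] by (simp add: s_def)
    then have "1 / s C \<le> real (card (reductions (rp C) x (rp D))) / s C / s D"
      using s[of C] s[of D] by (simp add: field_simps)
    also have "\<dots> \<le> (\<Sum>D\<in>E. real (card (reductions (rp C) x (rp D))) / s C / s D)"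
      using finE D(2) by (intro member_le_sum) (auto simp: s_def)
    finally show ?thesis .
  qed
  have "(\<Sum>C | class_order C = n. real (card (frames (rp C) d)) / s C) =
    (\<Sum>C | class_order C = n. \<Sum>(x, z)\<in>frames (rp C) d. 1 / s C)"
    by (simp add: split_def)
  also have "\<dots> \<le> (\<Sum>C | class_order C = n. \<Sum>(x, z)\<in>frames (rp C) d.
      \<Sum>D\<in>E. real (card (reductions (rp C) x (rp D))) / s C / s D)"
    using le by (intro sum_mono) auto
  also have "\<dots> = (\<Sum>D\<in>E. (\<Sum>C | class_order C = n. \<Sum>(x, z)\<in>frames (rp C) d.
      real (card (reductions (rp C) x (rp D))) / s C) / s D)"
    by (simp add: split_def sum_divide_distrib sum.swap[of _ E])
  also have "\<dots> \<le> (\<Sum>D\<in>E. real (class_order D) / s D)"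
    using s sum_card_reductions_le[folded s_def]
    by (intro sum_mono divide_right_mono) (auto intro: less_imp_le)
  also have "\<dots> = (if d\<^sup>2 dvd n then mass (n div d\<^sup>2) else 0)"
    by (simp add: E mass_def class_weight_eq s_def)
  finally show ?thesis by (simp add: s_def)
qed

text \<open>Sorting the n elements of G by their order d, and replacing the number of elements of
  order d by d / n times the number of frames, turns the numerator of each weight into a sum of
  frame counts.\<close>

lemma mass_le_sum_divisors:
  assumes "n > 0"
  shows "mass n \<le> (\<Sum>d | d \<in> {1..n} \<and> d\<^sup>2 dvd n. real d / real n * mass (n div d\<^sup>2))"
proof -
  define s where "s C = real (card (Sp (rp C)))" for C
  have weight: "class_weight C = (\<Sum>d\<in>{1..n}. real d / real n * (real (card (frames (rp C) d)) / s C))"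
    if C: "class_order C = n" for C
  proof -
    interpret symplectic_group "rp C" by (rule symplectic_rep)
    have o: "order (rp C) = n" using C by (simp add: class_order.rep_eq)
    have "ord ` carrier (rp C) \<subseteq> {1..n}"
      using fin ord_ge_1 ord_le_group_order o by force
    then have "n = (\<Sum>d\<in>{1..n}. card {x \<in> carrier (rp C). ord x = d})"
      using sum.group[OF fin, of "{1..n}" ord "\<lambda>_. 1 :: nat"] o by (simp add: order_def)
    then have "real n = (\<Sum>d\<in>{1..n}. real (card {x \<in> carrier (rp C). ord x = d}))"
      by (metis of_nat_sum)
    also have "\<dots> = (\<Sum>d\<in>{1..n}. real d / real n * real (card (frames (rp C) d)))"
    proof (rule sum.cong)
      fix d
      have "real (card (frames (rp C) d)) * real d = real (card {x \<in> carrier (rp C). ord x = d}) * real n"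
        using card_frames[of d] o by (metis of_nat_mult)
      then show "real (card {x \<in> carrier (rp C). ord x = d}) = real d / real n * real (card (frames (rp C) d))"
        using assms by (simp add: field_simps)
    qed simp
    finally have "real n / s C = (\<Sum>d\<in>{1..n}. real d / real n * real (card (frames (rp C) d))) / s C"
      by simp
    then show ?thesis using C by (simp add: class_weight_eq s_def sum_divide_distrib)
  qed
  have "mass n = (\<Sum>C | class_order C = n. \<Sum>d\<in>{1..n}. real d / real n * (real (card (frames (rp C) d)) / s C))"
    unfolding mass_def by (intro sum.cong weight) auto
  also have "\<dots> = (\<Sum>d\<in>{1..n}. real d / real n *
      (\<Sum>C | class_order C = n. real (card (frames (rp C) d)) / s C))"
    by (subst sum.swap) (simp add: sum_distrib_left)
  also have "\<dots> \<le> (\<Sum>d\<in>{1..n}. real d / real n * (if d\<^sup>2 dvd n then mass (n div d\<^sup>2) else 0))"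
    unfolding s_def by (intro sum_mono mult_left_mono sum_card_frames_le) auto
  also have "\<dots> = (\<Sum>d\<in>{1..n}. if d\<^sup>2 dvd n then real d / real n * mass (n div d\<^sup>2) else 0)"
    by (intro sum.cong) auto
  also have "\<dots> = (\<Sum>d\<in>{d \<in> {1..n}. d\<^sup>2 dvd n}. real d / real n * mass (n div d\<^sup>2))"
    by (rule sum.inter_filter[symmetric]) simp
  finally show ?thesis by simp
qed

section \<open>Bounds on the mass\<close>

text \<open>Dividing a nonsquare by d^2 leaves a nonsquare, so by induction only d = 1 survives in
  the recursion. What remains is b(n) <= b(n) / n, which forces b(n) = 0 for n >= 2.\<close>

lemma mass_nonsquare:
  assumes "\<And>N. n \<noteq> N\<^sup>2"
  shows "mass n = 0"
  using assms
proof (induction n rule: less_induct)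
  case (less n)
  have "n \<noteq> 0" "n \<noteq> 1" using less.prems[of 0] less.prems[of 1] by auto
  then have n: "n \<ge> 2" by linarith
  let ?D = "{d \<in> {1..n}. d\<^sup>2 dvd n}"
  have "mass n \<le> (\<Sum>d\<in>?D. real d / real n * mass (n div d\<^sup>2))"
    using mass_le_sum_divisors[of n] n by simp
  also have "\<dots> = (\<Sum>d\<in>?D. if d = 1 then mass n / real n else 0)"
  proof (rule sum.cong)
    fix d assume d: "d \<in> ?D"
    show "real d / real n * mass (n div d\<^sup>2) = (if d = 1 then mass n / real n else 0)"
    proof (cases "d = 1")
      case False
      with d have d2: "d \<ge> 2" by auto
      then have "1 < d\<^sup>2" using one_less_power[of d 2] by simp
      then have "n div d\<^sup>2 < n" using n by simp
      moreover have "n div d\<^sup>2 \<noteq> N\<^sup>2" for N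
        using d less.prems[of "d * N"] by (auto simp: power_mult_distrib)
      ultimately show ?thesis using less.IH False by simp
    qed simp
  qed simp
  also have "\<dots> = mass n / real n" using n by (simp add: sum.delta)
  finally have "mass n * (real n - 1) \<le> 0" using n by (simp add: field_simps)
  then have "mass n \<le> 0" using n by (simp add: mult_le_0_iff)
  then show ?case using mass_nonneg[of n] by simp
qed

text \<open>The divisors d of N are traded for e = N / d, which turns the factor N d / N^2 into 1 /
  e. Enlarging the range from the divisors of N to all e <= N makes the right side a partial sum of
  one fixed series, which can be telescoped.\<close>

lemma mass_square_recursion:
  assumes "N \<ge> 1"
  shows "real N * mass (N\<^sup>2) \<le> (\<Sum>e\<in>{1..N}. mass (e\<^sup>2) / real e)"
proof -
  let ?D = "{d \<in> {1..N\<^sup>2}. d\<^sup>2 dvd N\<^sup>2}"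
  have D: "d dvd N" "d \<ge> 1" if "d \<in> ?D" for d using that by auto
  have "real N * mass (N\<^sup>2) \<le> real N * (\<Sum>d\<in>?D. real d / real (N\<^sup>2) * mass (N\<^sup>2 div d\<^sup>2))"
    using mass_le_sum_divisors[of "N\<^sup>2"] assms by (intro mult_left_mono) auto
  also have "\<dots> = (\<Sum>d\<in>?D. mass ((N div d)\<^sup>2) / real (N div d))"
    unfolding sum_distrib_left
  proof (rule sum.cong)
    fix d assume d: "d \<in> ?D"
    obtain e where e: "N = d * e" using D(1)[OF d] by blast
    then show "real N * (real d / real (N\<^sup>2) * mass (N\<^sup>2 div d\<^sup>2)) = mass ((N div d)\<^sup>2) / real (N div d)"
      using D(2)[OF d] assms by (auto simp: power_mult_distrib power2_eq_square)
  qed simp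
  also have "\<dots> = (\<Sum>e\<in>(\<lambda>d. N div d) ` ?D. mass (e\<^sup>2) / real e)"
  proof (subst sum.reindex)
    show "inj_on (\<lambda>d. N div d) ?D"
    proof (rule inj_onI)
      fix d d' assume d: "d \<in> ?D" "d' \<in> ?D" "N div d = N div d'"
      have "d * (N div d) = N" "d' * (N div d') = N" using D d by auto
      then show "d = d'" using d(3) assms by (metis mult_cancel2 mult_zero_right not_one_le_zero)
    qed
  qed simp
  also have "\<dots> \<le> (\<Sum>e\<in>{1..N}. mass (e\<^sup>2) / real e)"
  proof (rule sum_mono2)
    show "(\<lambda>d. N div d) ` ?D \<subseteq> {1..N}"
      using D assms by (auto simp: Suc_le_eq div_greater_zero_iff dest!: dvd_imp_le)
  qed (auto simp: mass_nonneg)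
  finally show ?thesis .
qed

text \<open>The telescoping product of the factors \<open>1 - 1 / j\<^sup>2\<close> gives the constant \<open>2\<close>.\<close>

lemma mass_square_le:
  assumes "N \<ge> 1"
  shows "mass (N\<^sup>2) \<le> 2 * mass 1 / real N"
proof -
  define S where "S n = (\<Sum>e\<in>{1..n}. mass (e\<^sup>2) / real e)" for n
  \<comment> \<open>If the recursion held with equality, S(n) (1 - 1 / n^2) = S(n - 1) would follow;
    the right side is its solution with S(1) = b(1).\<close>
  have S: "S n \<le> 2 * real n / (real n + 1) * mass 1" if "n \<ge> 1" for n
    using that
  proof (induction n rule: dec_induct)
    case base
    then show ?case by (simp add: S_def)
  next
    case (step n)
    define m where "m = real (Suc n)"
    have m: "m \<ge> 2" "real n = m - 1" using step by (auto simp: m_def)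
    have "m * mass ((Suc n)\<^sup>2) \<le> S (Suc n)"
      using mass_square_recursion[of "Suc n"] by (simp add: S_def m_def)
    then have "mass ((Suc n)\<^sup>2) / m \<le> S (Suc n) / m\<^sup>2"
      using m by (simp add: field_simps power2_eq_square)
    moreover have "S (Suc n) = S n + mass ((Suc n)\<^sup>2) / m" by (simp add: S_def m_def)
    ultimately have "S (Suc n) - S (Suc n) / m\<^sup>2 \<le> S n" by linarith
    also have "\<dots> \<le> 2 * (m - 1) / m * mass 1" using step.IH m by simp
    finally have "S (Suc n) * (1 - 1 / m\<^sup>2) \<le> 2 * (m - 1) / m * mass 1"
      by (simp add: right_diff_distrib)
    moreover have "S (Suc n) * (1 - 1 / m\<^sup>2) = S (Suc n) * (m + 1) * (m - 1) / m\<^sup>2"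
      using m by (simp add: field_simps power2_eq_square)
    moreover have "2 * (m - 1) / m * mass 1 = (2 * m * mass 1) * (m - 1) / m\<^sup>2"
      using m by (simp add: field_simps power2_eq_square)
    ultimately have "S (Suc n) * (m + 1) * (m - 1) \<le> (2 * m * mass 1) * (m - 1)"
      using m by (simp add: divide_le_cancel)
    then have "S (Suc n) * (m + 1) \<le> 2 * m * mass 1"
      using m by (simp add: mult_le_cancel_right)
    then show ?case using m by (simp add: field_simps flip: m_def)
  qed
  have "real N * mass (N\<^sup>2) \<le> S N" using mass_square_recursion[OF assms] by (simp add: S_def)
  also have "\<dots> \<le> (2 * real N / (real N + 1)) * mass 1" by (rule S[OF assms])
  also have "\<dots> \<le> 2 * mass 1"
    using mass_nonneg[of 1] by (intro mult_right_mono) (auto simp: field_simps)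
  finally show ?thesis using assms by (simp add: field_simps)
qed

section \<open>Total weight over ranges of orders\<close>

lemma sum_class_weight_eq:
  assumes "finite I"
  shows "(\<Sum>C | class_order C \<in> I. class_weight C) = (\<Sum>m\<in>I. mass m)"
proof -
  have "{C. class_order C \<in> I} = (\<Union>m\<in>I. {C. class_order C = m})" by auto
  then have fin: "finite {C. class_order C \<in> I}" using assms finite_class_order by simp
  have "(\<Sum>m\<in>I. mass m) = (\<Sum>m\<in>I. \<Sum>C\<in>{C \<in> {C. class_order C \<in> I}. class_order C = m}.
      class_weight C)"
    unfolding mass_def by (intro sum.cong) auto
  also have "\<dots> = (\<Sum>C | class_order C \<in> I. class_weight C)"
    by (rule sum.group[OF fin assms]) auto
  finally show ?thesis ..
qed

lemma sum_mass_eq_squares: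
  assumes "finite I"
  shows "(\<Sum>m\<in>I. mass m) = (\<Sum>N | N\<^sup>2 \<in> I. mass (N\<^sup>2))"
proof -
  have "(\<Sum>m\<in>I. mass m) = (\<Sum>m\<in>(\<lambda>N. N\<^sup>2) ` {N. N\<^sup>2 \<in> I}. mass m)"
  proof (rule sum.mono_neutral_right[OF assms])
    show "\<forall>i\<in>I - (\<lambda>N. N\<^sup>2) ` {N. N\<^sup>2 \<in> I}. mass i = 0"
      by (intro ballI mass_nonsquare) auto
  qed auto
  also have "\<dots> = (\<Sum>N | N\<^sup>2 \<in> I. mass (N\<^sup>2))"
    by (subst sum.reindex) (auto simp: inj_on_def)
  finally show ?thesis .
qed

text \<open>Only squares N^2 count, and with r the square root of n there are at most r of them.
  From n < N^2 h and N <= r one gets r <= N h, so each has mass at most 2 b(1) h / r. The cruder r /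
  h in place of r / sqrt h costs only a factor depending on h.\<close>

lemma sum_mass_short_interval:
  assumes "h \<ge> 1"
  shows "(\<Sum>m\<in>{n div h<..n}. mass m) \<le> 2 * mass 1 * real h"
proof -
  let ?A = "{N. N\<^sup>2 \<in> {n div h<..n}}"
  define r where "r = sqrt (real n)"
  have A: "N \<ge> 1" "1 / real N \<le> real h / r" "real N \<le> r" "n > 0" if "N \<in> ?A" for N
  proof -
    have N: "n div h < N\<^sup>2" "N\<^sup>2 \<le> n" using that by auto
    then show N1: "N \<ge> 1" and n0: "n > 0" by (auto simp: Suc_le_eq intro!: gr0I)
    have "real (N\<^sup>2) \<le> real n" using N(2) by (simp only: of_nat_le_iff)
    then show Nr: "real N \<le> r" unfolding r_def by (intro real_le_rsqrt) simp
    have "n < N\<^sup>2 * h" using N(1) assms by (simp add: div_less_iff_less_mult)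
    then have "real n < real (N\<^sup>2 * h)" by (simp only: of_nat_less_iff)
    then have "r * r \<le> real N * real N * real h" by (simp add: r_def power2_eq_square)
    also have "\<dots> \<le> real N * r * real h"
      using Nr by (intro mult_right_mono mult_left_mono) auto
    finally have "r * r \<le> real N * real h * r" by (simp add: algebra_simps)
    moreover have r: "r > 0" using n0 by (simp add: r_def)
    ultimately have "r \<le> real N * real h" by (simp add: mult_le_cancel_right)
    then show "1 / real N \<le> real h / r" using N1 r by (simp add: field_simps)
  qed
  have sub: "?A \<subseteq> {1..nat \<lfloor>r\<rfloor>}" using A by (force simp: le_nat_floor)
  have "(\<Sum>m\<in>{n div h<..n}. mass m) = (\<Sum>N\<in>?A. mass (N\<^sup>2))"
    by (rule sum_mass_eq_squares) simp
  also have "\<dots> \<le> (\<Sum>N\<in>?A. 2 * mass 1 * (real h / r))"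
  proof (rule sum_mono)
    fix N assume N: "N \<in> ?A"
    have "mass (N\<^sup>2) \<le> 2 * mass 1 * (1 / real N)" using mass_square_le[OF A(1)[OF N]] by simp
    also have "\<dots> \<le> 2 * mass 1 * (real h / r)"
      using A(2)[OF N] mass_nonneg[of 1] by (intro mult_left_mono) auto
    finally show "mass (N\<^sup>2) \<le> 2 * mass 1 * (real h / r)" .
  qed
  also have "\<dots> = real (card ?A) * (2 * mass 1 * (real h / r))" by simp
  also have "\<dots> \<le> r * (2 * mass 1 * (real h / r))"
  proof (rule mult_right_mono)
    have "card ?A \<le> nat \<lfloor>r\<rfloor>" using card_mono[OF _ sub] by simp
    then have "real (card ?A) \<le> real (nat \<lfloor>r\<rfloor>)" by (rule of_nat_mono)
    also have "\<dots> \<le> r" by (rule of_nat_floor) (simp add: r_def)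
    finally show "real (card ?A) \<le> r" .
    show "0 \<le> 2 * mass 1 * (real h / r)" using mass_nonneg[of 1] by (simp add: r_def)
  qed
  also have "\<dots> \<le> 2 * mass 1 * real h" using mass_nonneg[of 1] by (cases "r = 0") auto
  finally show ?thesis .
qed

text \<open>A truncated Euler product: admitting one more prime p enlarges the sum by a factor of at
  most 1 / (1 - 1 / p), which is below exp (2 / p). The cutoff M keeps the sums finite, while the
  bound is independent of it.\<close>

lemma sum_inverse_smooth_le:
  assumes "finite Q" "\<And>p. p \<in> Q \<Longrightarrow> prime p"
  shows "(\<Sum>N | N \<in> {1..M} \<and> prime_factors N \<subseteq> Q. 1 / real N) \<le> exp (2 * (\<Sum>p\<in>Q. 1 / real p))"
  using assms
proof (induction Q rule: finite_induct)
  case empty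
  have "{N \<in> {1..M}. prime_factors N \<subseteq> {}} \<subseteq> {1}"
    by (auto simp: prime_factorization_empty_iff)
  then have "(\<Sum>N | N \<in> {1..M} \<and> prime_factors N \<subseteq> {}. 1 / real N) \<le> (\<Sum>N\<in>{1}. 1 / real N)"
    by (intro sum_mono2) auto
  then show ?case by simp
next
  case (insert p Q)
  have p: "prime p" "p \<ge> 2" using insert.prems prime_ge_2_nat by auto
  let ?T = "{N \<in> {1..M}. prime_factors N \<subseteq> Q}"
  let ?T' = "{N \<in> {1..M}. prime_factors N \<subseteq> insert p Q}"
  let ?F = "\<Sum>N\<in>?T. 1 / real N" and ?F' = "\<Sum>N\<in>?T'. 1 / real N"
  \<comment> \<open>A number divisible by p is p times an element of the same set, so F' <= F + F' /
    p, where F and F' are the sums before and after admitting p. This replaces the geometric series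
    in p.\<close>
  have sub: "?T' \<subseteq> ?T \<union> (\<lambda>k. p * k) ` ?T'"
  proof
    fix N assume N: "N \<in> ?T'"
    show "N \<in> ?T \<union> (\<lambda>k. p * k) ` ?T'"
    proof (cases "p dvd N")
      case True
      then obtain k where k: "N = p * k" by blast
      have "k \<in> ?T'"
        using N p k dvd_prime_factors[of N k] by (auto simp: Suc_le_eq intro: order_trans[rotated])
      then show ?thesis using k by blast
    next
      case False
      then show ?thesis using N by (auto simp: prime_factors_dvd)
    qed
  qed
  have "?F' \<le> (\<Sum>N\<in>?T \<union> (\<lambda>k. p * k) ` ?T'. 1 / real N)"
    by (rule sum_mono2[OF _ sub]) auto
  also have "\<dots> \<le> ?F + (\<Sum>N\<in>(\<lambda>k. p * k) ` ?T'. 1 / real N)"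
    by (subst sum.union_inter[symmetric]) (auto intro!: sum_nonneg)
  also have "(\<Sum>N\<in>(\<lambda>k. p * k) ` ?T'. 1 / real N) = ?F' / real p"
    using p by (subst sum.reindex) (auto simp: inj_on_def sum_divide_distrib mult.commute)
  finally have 1: "?F' * (1 - 1 / real p) \<le> ?F" by (simp add: algebra_simps)
  define t where "t = 1 / real p"
  have t: "0 < t" "t \<le> 1 / 2" using p by (auto simp: t_def field_simps)
  \<comment> \<open>The product is 1 + t (1 - 2 t), and t <= 1 / 2 because p >= 2; this is where the
    2 in the exponent comes from.\<close>
  have "1 \<le> (1 + 2 * t) * (1 - t)" using t by (simp add: algebra_simps)
  also have "\<dots> \<le> exp (2 * t) * (1 - t)"
    using t exp_ge_add_one_self[of "2 * t"] by (intro mult_right_mono) auto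
  finally have "?F' * 1 \<le> ?F' * (exp (2 * t) * (1 - t))"
    by (intro mult_left_mono) (auto intro: sum_nonneg)
  also have "\<dots> = exp (2 * t) * (?F' * (1 - 1 / real p))" by (simp add: t_def)
  also have "\<dots> \<le> exp (2 * t) * ?F" using 1 by (intro mult_left_mono) auto
  also have "\<dots> \<le> exp (2 * t) * exp (2 * (\<Sum>p\<in>Q. 1 / real p))"
    using insert by (intro mult_left_mono) auto
  also have "\<dots> = exp (2 * (\<Sum>p\<in>insert p Q. 1 / real p))"
    using insert.hyps by (simp add: t_def algebra_simps flip: exp_add)
  finally show ?case by simp
qed

text \<open>A finite set of P-classes involves only orders N^2 up to some M and primes up to M. The
  bound 2 b(1) / N on b(N^2) and the truncated Euler product then give a constant that does not
  depend on M.\<close>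

lemma class_weight_summable_on_P_classes:
  assumes P: "\<And>p. p \<in> P \<Longrightarrow> prime p" and sum: "(\<lambda>p. 1 / real p) summable_on P"
  shows "class_weight summable_on P_classes P"
proof (rule nonneg_bdd_above_summable_on)
  show "class_weight C \<ge> 0" for C using class_weight_pos[of C] by simp
  define B where "B = 2 * mass 1 * exp (2 * (\<Sum>\<^sub>\<infinity>p\<in>P. 1 / real p))"
  have "sum class_weight F \<le> B" if F: "F \<subseteq> P_classes P" "finite F" for F
  proof -
    \<comment> \<open>Inserting 0 gives the maximum a meaning when F is empty.\<close>
    define M where "M = Max (insert 0 (class_order ` F))"
    have M: "class_order C \<le> M" if "C \<in> F" for C
      using that F(2) by (simp add: M_def)
    let ?I = "{m \<in> {1..M}. prime_factors m \<subseteq> P}"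
    let ?J = "{N \<in> {1..M}. prime_factors N \<subseteq> P \<inter> {..M}}"
    have "{C. class_order C \<in> ?I} \<subseteq> {C. class_order C \<le> M}" by auto
    then have "finite {C. class_order C \<in> ?I}" using finite_class_order_le finite_subset by blast
    then have "sum class_weight F \<le> (\<Sum>C | class_order C \<in> ?I. class_weight C)"
      using F M class_order_pos class_weight_pos
      by (intro sum_mono2) (force simp: P_classes_def Suc_le_eq intro: less_imp_le)+
    also have "\<dots> = (\<Sum>N | N\<^sup>2 \<in> ?I. mass (N\<^sup>2))"
      using sum_class_weight_eq[of ?I] sum_mass_eq_squares[of ?I] by simp
    also have "\<dots> \<le> (\<Sum>N | N\<^sup>2 \<in> ?I. 2 * mass 1 * (1 / real N))"
    proof (rule sum_mono)
      fix N assume "N \<in> {N. N\<^sup>2 \<in> ?I}"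
      then have "N \<ge> 1" by (cases N) auto
      then show "mass (N\<^sup>2) \<le> 2 * mass 1 * (1 / real N)" using mass_square_le by simp
    qed
    also have "\<dots> \<le> (\<Sum>N\<in>?J. 2 * mass 1 * (1 / real N))"
    proof (rule sum_mono2)
      show "{N. N\<^sup>2 \<in> ?I} \<subseteq> ?J"
      proof
        fix N assume N: "N \<in> {N. N\<^sup>2 \<in> ?I}"
        then have N0: "N > 0" by (cases N) auto
        then have "N \<le> N\<^sup>2" by (simp add: power2_eq_square)
        then have "N \<le> M" using N by auto
        moreover have "prime_factors N \<subseteq> P"
          using N N0 dvd_prime_factors[of "N\<^sup>2" N] by (auto simp: power2_eq_square)
        moreover have "prime_factors N \<subseteq> {..N}" using N0 by (auto simp: prime_factors_dvd dvd_imp_le)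
        ultimately show "N \<in> ?J" using N0 by auto
      qed
    qed (auto simp: mass_nonneg)
    also have "\<dots> = 2 * mass 1 * (\<Sum>N\<in>?J. 1 / real N)" by (simp add: sum_distrib_left)
    also have "\<dots> \<le> 2 * mass 1 * exp (2 * (\<Sum>p\<in>P \<inter> {..M}. 1 / real p))"
      using sum_inverse_smooth_le[of "P \<inter> {..M}" M] P mass_nonneg[of 1]
      by (intro mult_left_mono) auto
    also have "\<dots> \<le> B"
    proof -
      have "(\<Sum>p\<in>P \<inter> {..M}. 1 / real p) \<le> (\<Sum>\<^sub>\<infinity>p\<in>P. 1 / real p)"
        by (rule finite_sum_le_infsum[OF sum]) auto
      then show ?thesis unfolding B_def using mass_nonneg[of 1] by (intro mult_left_mono) auto
    qed
    finally show ?thesis .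
  qed
  then show "bdd_above (sum class_weight ` {F. F \<subseteq> P_classes P \<and> finite F})"
    by (auto simp: bdd_above_def)
qed

section \<open>Divergence of the total weight\<close>

lemma qz_of_int_div_eq_one_iff:
  assumes "N > 0"
  shows "qz (of_int i / of_nat N) = \<one>\<^bsub>QZ\<^esub> \<longleftrightarrow> int N dvd i"
proof
  assume "qz (of_int i / of_nat N) = \<one>\<^bsub>QZ\<^esub>"
  then obtain k where "(of_int i :: rat) / of_nat N = of_int k"
    by (auto simp: qz_eq_one_iff elim: Ints_cases)
  then have "(of_int i :: rat) = of_int (int N * k)" using assms by (simp add: field_simps)
  then show "int N dvd i" by (simp only: of_int_eq_iff) simp
next
  assume "int N dvd i"
  then show "qz (of_int i / of_nat N) = \<one>\<^bsub>QZ\<^esub>" using assms by (auto simp: qz_eq_one_iff)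
qed

lemma qz_of_int_div_cong:
  assumes "N > 0" "i mod int N = j mod int N"
  shows "qz (of_int i / of_nat N) = qz (of_int j / of_nat N)"
proof -
  have "int N dvd i - j" using assms(2) by (simp add: mod_eq_dvd_iff)
  then have "qz (of_int (i - j) / of_nat N) = \<one>\<^bsub>QZ\<^esub>"
    using qz_of_int_div_eq_one_iff[OF assms(1)] by blast
  moreover have "(of_int i :: rat) / of_nat N = of_int (i - j) / of_nat N + of_int j / of_nat N"
    by (simp add: diff_divide_distrib)
  ultimately show ?thesis by (metis QZ.l_one qz_add qz_in_carrier)
qed

text \<open>The group (Z/N)^2 with the determinant divided by N as pairing. Pairs are coded as
  natural numbers because the classes are formed from groups on subsets of nat.\<close>

definition torus :: "nat \<Rightarrow> nat sympl"
  where "torus N = \<lparr>carrier = prod_encode ` ({..<N} \<times> {..<N}),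
    monoid.mult = (\<lambda>u v. case (prod_decode u, prod_decode v) of
      ((a, b), (c, d)) \<Rightarrow> prod_encode ((a + c) mod N, (b + d) mod N)),
    one = prod_encode (0, 0),
    pairing = (\<lambda>u v. case (prod_decode u, prod_decode v) of
      ((a, b), (c, d)) \<Rightarrow> qz (of_int (int a * int d - int b * int c) / of_nat N))\<rparr>"

lemma carrier_torus [simp]: "carrier (torus N) = prod_encode ` ({..<N} \<times> {..<N})"
  by (simp add: torus_def)

lemma mult_torus [simp]: "prod_encode (a, b) \<otimes>\<^bsub>torus N\<^esub> prod_encode (c, d) =
    prod_encode ((a + c) mod N, (b + d) mod N)"
  by (simp add: torus_def)

lemma one_torus [simp]: "\<one>\<^bsub>torus N\<^esub> = prod_encode (0, 0)"
  by (simp add: torus_def)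

lemma pairing_torus [simp]: "pairing (torus N) (prod_encode (a, b)) (prod_encode (c, d)) =
    qz (of_int (int a * int d - int b * int c) / of_nat N)"
  by (simp add: torus_def)

lemma mod_det:
  fixes n :: int
  shows "(x * (c mod n) - y * (d mod n)) mod n = (x * c - y * d) mod n"
  by (metis mod_diff_eq mod_mult_right_eq)

lemma symplectic_torus:
  assumes N: "N \<ge> 2"
  shows "symplectic_group (torus N)"
proof -
  have N0: "N > 0" using N by simp
  interpret comm_group "torus N"
  proof (rule comm_groupI)
    fix u assume "u \<in> carrier (torus N)"
    then obtain a b where u: "u = prod_encode (a, b)" "a < N" "b < N" by auto
    have "prod_encode ((N - a) mod N, (N - b) mod N) \<in> carrier (torus N)" using N0 by auto
    moreover have "prod_encode ((N - a) mod N, (N - b) mod N) \<otimes>\<^bsub>torus N\<^esub> u = \<one>\<^bsub>torus N\<^esub>"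
      using u by (simp add: mod_simps)
    ultimately show "\<exists>v\<in>carrier (torus N). v \<otimes>\<^bsub>torus N\<^esub> u = \<one>\<^bsub>torus N\<^esub>" by blast
  qed (use N0 in \<open>auto simp: mod_simps algebra_simps\<close>)
  have add: "qz (of_int i / of_nat N) \<otimes>\<^bsub>QZ\<^esub> qz (of_int j / of_nat N) = qz (of_int (i + j) / of_nat N)"
    for i j by (simp add: qz_add add_divide_distrib)
  show ?thesis
  proof
    fix u assume "u \<in> carrier (torus N)"
    then obtain a b where u: "u = prod_encode (a, b)" "a < N" "b < N" by auto
    show "pairing (torus N) u \<in> hom (torus N) QZ"
    proof (rule homI)
      fix v w assume "v \<in> carrier (torus N)" "w \<in> carrier (torus N)"
      then obtain c d c' d' where v: "v = prod_encode (c, d)" "w = prod_encode (c', d')" by auto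
      show "pairing (torus N) u (v \<otimes>\<^bsub>torus N\<^esub> w) = pairing (torus N) u v \<otimes>\<^bsub>QZ\<^esub> pairing (torus N) u w"
        unfolding u v pairing_torus mult_torus add
      proof (rule qz_of_int_div_cong[OF N0])
        show "(int a * int ((d + d') mod N) - int b * int ((c + c') mod N)) mod int N =
          (int a * int d - int b * int c + (int a * int d' - int b * int c')) mod int N"
          unfolding zmod_int mod_det by (simp add: algebra_simps)
      qed
    qed (use u in auto)
    show "(\<lambda>v. pairing (torus N) v u) \<in> hom (torus N) QZ"
    proof (rule homI)
      fix v w assume "v \<in> carrier (torus N)" "w \<in> carrier (torus N)"
      then obtain c d c' d' where v: "v = prod_encode (c, d)" "w = prod_encode (c', d')" by auto
      show "pairing (torus N) (v \<otimes>\<^bsub>torus N\<^esub> w) u = pairing (torus N) v u \<otimes>\<^bsub>QZ\<^esub> pairing (torus N) w u"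
        unfolding u v pairing_torus mult_torus add
      proof (rule qz_of_int_div_cong[OF N0])
        show "(int ((c + c') mod N) * int b - int ((d + d') mod N) * int a) mod int N =
          (int c * int b - int d * int a + (int c' * int b - int d' * int a)) mod int N"
          unfolding zmod_int mult.commute[of "_ mod _"] mod_det by (simp add: algebra_simps)
      qed
    qed (use u in auto)
    show "pairing (torus N) u u = \<one>\<^bsub>QZ\<^esub>" by (simp add: u mult.commute)
    assume orth: "\<And>v. v \<in> carrier (torus N) \<Longrightarrow> pairing (torus N) u v = \<one>\<^bsub>QZ\<^esub>"
    \<comment> \<open>Pairing with the two basis vectors reads off the coordinates up to sign; N >=
      2 makes 1 a legitimate coordinate.\<close>
    have "int N dvd int a"
      using orth[of "prod_encode (0, 1)"] N qz_of_int_div_eq_one_iff[OF N0, of "int a"] by (simp add: u)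
    moreover have "int N dvd - int b"
      using orth[of "prod_encode (1, 0)"] N qz_of_int_div_eq_one_iff[OF N0, of "- int b"] by (simp add: u)
    ultimately show "u = \<one>\<^bsub>torus N\<^esub>" using u by (auto dest!: zdvd_imp_le)
  qed auto
qed

lemma order_torus: "order (torus N) = N\<^sup>2"
  by (simp add: order_def card_image inj_on_def power2_eq_square)

text \<open>An automorphism is determined by the images u and v of the basis vectors, with <u, v> =
  1 / N. There are N^2 choices for u. If some v exists, then N divides the order of u, and the fibre
  of the pairing with u has N^2 / ord u <= N elements.\<close>

lemma card_Sp_torus_le:
  assumes N: "N \<ge> 2"
  shows "card (Sp (torus N)) \<le> N ^ 3"
proof -
  let ?G = "torus N"
  have N0: "N > 0" using N by simp
  interpret symplectic_group ?G by (rule symplectic_torus[OF N])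
  define e1 where "e1 = prod_encode (1 :: nat, 0 :: nat)"
  define e2 where "e2 = prod_encode (0 :: nat, 1 :: nat)"
  have e: "e1 \<in> carrier ?G" "e2 \<in> carrier ?G" using N by (auto simp: e1_def e2_def)
  have pe: "pairing ?G e1 e2 = qz (1 / of_nat N)" by (simp add: e1_def e2_def)
  have pow1: "e1 [^]\<^bsub>?G\<^esub> k = prod_encode (k mod N, 0)" for k :: nat
    by (induction k) (auto simp: e1_def mod_simps)
  have pow2: "e2 [^]\<^bsub>?G\<^esub> k = prod_encode (0, k mod N)" for k :: nat
    by (induction k) (auto simp: e2_def mod_simps)
  let ?V = "\<lambda>u. {v \<in> carrier ?G. pairing ?G u v = qz (1 / of_nat N)}"
  have V: "card (?V u) \<le> N" if u: "u \<in> carrier ?G" for u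
  proof (cases "?V u = {}")
    case False
    then obtain v where v: "v \<in> carrier ?G" "pairing ?G u v = qz (1 / of_nat N)" by blast
    then have "qz (of_int (int (ord u)) / of_nat N) = \<one>\<^bsub>QZ\<^esub>"
      using pairing_pow_ord[OF u v(1)] by (simp add: qz_pow)
    then have "int N dvd int (ord u)" using qz_of_int_div_eq_one_iff[OF N0] by blast
    then have "N \<le> ord u" using ord_pos[OF u] by (simp add: dvd_imp_le)
    have "qz (1 / of_nat N) \<in> pairing ?G u ` carrier ?G" using v by force
    then have "card (?V u) * ord u = N\<^sup>2"
      using card_pairing_fibre[OF u] order_eq_card_perp[OF u] by (simp add: order_torus)
    moreover have "card (?V u) * N \<le> card (?V u) * ord u" using \<open>N \<le> ord u\<close> by simp
    ultimately have "card (?V u) * N \<le> N * N" unfolding power2_eq_square by linarith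
    then show ?thesis using N0 by simp
  qed (simp only: card.empty)
  have "card (Sp ?G) \<le> card (SIGMA u:carrier ?G. ?V u)"
  proof (rule card_inj_on_le)
    let ?f = "\<lambda>\<theta>. (\<theta> e1, \<theta> e2)"
    show "?f ` Sp ?G \<subseteq> (SIGMA u:carrier ?G. ?V u)"
    proof (rule image_subsetI)
      fix \<theta> assume "\<theta> \<in> Sp ?G"
      then have i: "\<theta> \<in> sympl_iso ?G ?G" by (simp add: Sp_eq)
      show "?f \<theta> \<in> (SIGMA u:carrier ?G. ?V u)"
        using sympl_isoD(3)[OF i e] bij_betwE[OF sympl_isoD(1)[OF i]] e pe by auto
    qed
    show "finite (SIGMA u:carrier ?G. ?V u)" using fin by auto
    show "inj_on ?f (Sp ?G)"
    proof (rule inj_onI)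
      fix \<theta> \<tau> assume s: "\<theta> \<in> Sp ?G" "\<tau> \<in> Sp ?G" and eq: "?f \<theta> = ?f \<tau>"
      have h: "group_hom ?G ?G \<theta>" "group_hom ?G ?G \<tau>"
        using s by (auto simp: Sp_eq group_hom_def group_hom_axioms_def group_axioms dest: sympl_isoD(2))
      have "\<theta> u = \<tau> u" if uc: "u \<in> carrier ?G" for u
      proof -
        obtain a b where "u = prod_encode (a, b)" "a < N" "b < N" using uc by auto
        then have u: "u = e1 [^]\<^bsub>?G\<^esub> a \<otimes>\<^bsub>?G\<^esub> e2 [^]\<^bsub>?G\<^esub> b" by (simp add: pow1 pow2)
        have hom: "\<sigma> u = \<sigma> e1 [^]\<^bsub>?G\<^esub> a \<otimes>\<^bsub>?G\<^esub> \<sigma> e2 [^]\<^bsub>?G\<^esub> b" if "group_hom ?G ?G \<sigma>" for \<sigma>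
          unfolding u using e by (simp add: group_hom.hom_mult[OF that] group_hom.hom_nat_pow[OF that] del: carrier_torus)
        show ?thesis using hom[OF h(1)] hom[OF h(2)] eq by simp
      qed
      then show "\<theta> = \<tau>"
        using s by (intro extensionalityI[of _ "carrier ?G"]) (auto simp: Sp_eq)
    qed
  qed
  also have "\<dots> = (\<Sum>u\<in>carrier ?G. card (?V u))" using fin by simp
  also have "\<dots> \<le> (\<Sum>u\<in>carrier ?G. N)" by (intro sum_mono V)
  also have "\<dots> = N ^ 3" using order_torus[of N] by (simp add: order_def power2_eq_square power3_eq_cube)
  finally show ?thesis .
qed

lemma mass_square_ge:
  assumes N: "N \<ge> 2"
  shows "1 / real N \<le> mass (N\<^sup>2)"
proof -
  obtain C where C: "sympl_isomorphic (torus N) (rp C)"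
    using class_exists[OF symplectic_torus[OF N]] .
  have "class_order C = N\<^sup>2" using order_cong[OF C] by (simp add: class_order.rep_eq order_torus)
  have "card (Sp (torus N)) > 0" by (rule card_Sp_pos[OF symplectic_torus[OF N]])
  moreover have "real (card (Sp (torus N))) \<le> real N ^ 3"
    using card_Sp_torus_le[OF N] by (metis of_nat_le_iff of_nat_power)
  ultimately have "real N ^ 2 / real N ^ 3 \<le> weight (torus N)"
    using N by (auto simp: weight_def order_torus intro!: divide_left_mono)
  then have "1 / real N \<le> weight (torus N)"
    using N by (simp add: power2_eq_square power3_eq_cube)
  also have "\<dots> = class_weight C" using weight_cong[OF C] by (simp add: class_weight.rep_eq)
  also have "\<dots> \<le> mass (N\<^sup>2)"
    unfolding mass_def using finite_class_order class_weight_pos \<open>class_order C = N\<^sup>2\<close>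
    by (intro member_le_sum) (auto intro: less_imp_le)
  finally show ?thesis .
qed

lemma sum_class_weight_at_top:
  "filterlim (\<lambda>n. \<Sum>C | class_order C \<le> n. class_weight C) at_top sequentially"
  unfolding filterlim_at_top
proof
  fix Z :: real
  \<comment> \<open>The extra 1 pays for the term N = 1 of the harmonic sum, as the lower bound on
    the mass starts at N = 2.\<close>
  have "\<forall>\<^sub>F M in sequentially. harm M \<ge> Z + 1"
    using harm_at_top unfolding filterlim_at_top by blast
  then obtain M where M: "M \<ge> 1" "harm M \<ge> Z + 1"
    unfolding eventually_sequentially by (metis nat_le_linear)
  have "Z \<le> (\<Sum>C | class_order C \<le> n. class_weight C)" if n: "n \<ge> M\<^sup>2" for n
  proof -
    have "harm M = 1 + (\<Sum>N\<in>{2..M}. 1 / real N)"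
      using M(1) by (simp add: harm_def sum.atLeast_Suc_atMost numeral_2_eq_2 inverse_eq_divide)
    then have "Z \<le> (\<Sum>N\<in>{2..M}. 1 / real N)" using M by simp
    also have "\<dots> \<le> (\<Sum>N\<in>{2..M}. mass (N\<^sup>2))" by (intro sum_mono mass_square_ge) auto
    also have "\<dots> \<le> (\<Sum>N | N\<^sup>2 \<in> {..n}. mass (N\<^sup>2))"
    proof (rule sum_mono2)
      have "{N. N\<^sup>2 \<in> {..n}} \<subseteq> {..n}"
      proof
        fix N assume "N \<in> {N. N\<^sup>2 \<in> {..n}}"
        then show "N \<in> {..n}" using order_trans[OF le_square[of N]] by (simp add: power2_eq_square)
      qed
      then show "finite {N. N\<^sup>2 \<in> {..n}}" using finite_subset by blast
      show "{2..M} \<subseteq> {N. N\<^sup>2 \<in> {..n}}"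
      proof
        fix N assume "N \<in> {2..M}"
        then have "N\<^sup>2 \<le> M\<^sup>2" by (intro power_mono) auto
        then have "N\<^sup>2 \<le> n" using n by (rule order_trans)
        then show "N \<in> {N. N\<^sup>2 \<in> {..n}}" by simp
      qed
    qed (auto simp: mass_nonneg)
    also have "\<dots> = (\<Sum>C | class_order C \<in> {..n}. class_weight C)"
      by (simp only: sum_class_weight_eq[of "{..n}"] sum_mass_eq_squares[of "{..n}"] finite_atMost)
    finally show ?thesis by simp
  qed
  then show "\<forall>\<^sub>F n in sequentially. Z \<le> (\<Sum>C | class_order C \<le> n. class_weight C)"
    unfolding eventually_sequentially by blast
qed

section \<open>Multiplicativity of the weight\<close>

lemma P_part_sympl_iso:
  assumes "symplectic_group G" "symplectic_group H" and h: "h \<in> sympl_iso G H"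
  shows "h \<in> sympl_iso (P_part P G) (P_part P H)"
proof -
  interpret G: symplectic_group G by fact
  interpret H: symplectic_group H by fact
  note hd = sympl_isoD[OF h]
  interpret h: group_hom G H h using hd(2) by unfold_locales
  have inj: "inj_on h (carrier G)" using hd(1) by (simp add: bij_betw_def)
  have ord: "H.ord (h x) = G.ord x" if x: "x \<in> carrier G" for x
  proof -
    have "h x [^]\<^bsub>H\<^esub> n = \<one>\<^bsub>H\<^esub> \<longleftrightarrow> x [^]\<^bsub>G\<^esub> n = \<one>\<^bsub>G\<^esub>" for n :: nat
      using x inj by (metis G.nat_pow_closed G.one_closed h.hom_nat_pow h.hom_one inj_onD)
    then show ?thesis using x H.ord_unique G.pow_eq_id by auto
  qed
  have "h ` carrier (P_part P G) = carrier (P_part P H)"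
  proof (intro equalityI subsetI)
    fix y assume y: "y \<in> carrier (P_part P H)"
    then obtain x where "x \<in> carrier G" "y = h x"
      using hd(1) by (auto simp: bij_betw_def)
    then show "y \<in> h ` carrier (P_part P G)" using y ord by auto
  qed (use ord in auto)
  moreover have "inj_on h (carrier (P_part P G))" using inj by (rule inj_on_subset) auto
  moreover have "h \<in> hom (P_part P G) (P_part P H)" using h.homh ord by (auto simp: hom_def)
  ultimately show ?thesis
    using hd(3) by (auto simp: sympl_iso_def iso_def bij_betw_def)
qed

lemma (in symplectic_group) P_part_decompE:
  assumes "a \<in> carrier G"
  obtains x y where "x \<in> carrier (P_part P G)" "y \<in> carrier (P_part (- P) G)" "a = x \<otimes> y"
  using assms P_part_decomp[of P] unfolding set_mult_def by blast

lemma (in symplectic_group) P_part_decomp_inj: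
  assumes x: "x \<in> carrier (P_part P G)" "x' \<in> carrier (P_part P G)"
    and y: "y \<in> carrier (P_part (- P) G)" "y' \<in> carrier (P_part (- P) G)"
    and eq: "x \<otimes> y = x' \<otimes> y'"
  shows "x = x' \<and> y = y'"
proof -
  have c: "x \<in> carrier G" "x' \<in> carrier G" "y \<in> carrier G" "y' \<in> carrier G" using x y by auto
  have "inv x' \<otimes> x = inv x' \<otimes> (x \<otimes> y) \<otimes> inv y" using c by (simp add: m_assoc)
  also have "\<dots> = inv x' \<otimes> (x' \<otimes> y') \<otimes> inv y" by (simp only: eq)
  also have "\<dots> = y' \<otimes> inv y" using c by (simp flip: m_assoc)
  finally have "inv x' \<otimes> x = y' \<otimes> inv y" .
  moreover have "inv x' \<otimes> x \<in> carrier (P_part P G)"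
    using x subgroup.m_closed[OF subgroup_P_part] subgroup.m_inv_closed[OF subgroup_P_part] by metis
  moreover have "y' \<otimes> inv y \<in> carrier (P_part (- P) G)"
    using y subgroup.m_closed[OF subgroup_P_part] subgroup.m_inv_closed[OF subgroup_P_part] by metis
  ultimately have "inv x' \<otimes> x \<in> {\<one>}" unfolding P_part_Int[of P, symmetric] by auto
  then have "inv x' \<otimes> x = \<one>" by simp
  then have "x = x'" using c by (metis inv_equality inv_inv inv_closed m_comm)
  then show ?thesis using eq c by simp
qed

lemma (in symplectic_group) pairing_P_part_decomp:
  assumes x: "x \<in> carrier (P_part P G)" "x' \<in> carrier (P_part P G)"
    and y: "y \<in> carrier (P_part (- P) G)" "y' \<in> carrier (P_part (- P) G)"
  shows "pairing G (x \<otimes> y) (x' \<otimes> y') = pairing G x x' \<otimes>\<^bsub>QZ\<^esub> pairing G y y'"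
proof -
  have "pairing G x y' = \<one>\<^bsub>QZ\<^esub>" by (rule P_part_orthogonal) (fact x y)+
  moreover have "pairing G y x' = \<one>\<^bsub>QZ\<^esub>"
    by (rule P_part_orthogonal[of _ "- P"]) (use x y in auto)
  moreover have "x \<in> carrier G" "x' \<in> carrier G" "y \<in> carrier G" "y' \<in> carrier G"
    using x y by auto
  ultimately show ?thesis by (simp add: pairing_mult_left pairing_mult_right)
qed

text \<open>The two parts are orthogonal, so the pairing of products splits without cross terms and
  the relation pairing x y with \<open>\<phi> x\<close> times \<open>\<psi> y\<close> preserves it.
  The glued map serves both to count Sp and to recover a class from its two parts.\<close>

lemma sympl_iso_of_P_parts:
  assumes "symplectic_group G" "symplectic_group H"
    and f: "\<phi> \<in> sympl_iso (P_part P G) (P_part P H)"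
    and g: "\<psi> \<in> sympl_iso (P_part (- P) G) (P_part (- P) H)"
  obtains \<theta> where "\<theta> \<in> sympl_iso G H" "\<theta> \<in> extensional (carrier G)"
    "\<And>x. x \<in> carrier (P_part P G) \<Longrightarrow> \<theta> x = \<phi> x"
    "\<And>y. y \<in> carrier (P_part (- P) G) \<Longrightarrow> \<theta> y = \<psi> y"
proof -
  interpret G: symplectic_group G by fact
  interpret H: symplectic_group H by fact
  interpret PG: symplectic_group "P_part P G" by (rule G.symplectic_group_P_part)
  interpret NG: symplectic_group "P_part (- P) G" by (rule G.symplectic_group_P_part)
  interpret PH: symplectic_group "P_part P H" by (rule H.symplectic_group_P_part)
  interpret NH: symplectic_group "P_part (- P) H" by (rule H.symplectic_group_P_part)
  note fd = sympl_isoD[OF f] and gd = sympl_isoD[OF g]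
  have f1: "\<phi> \<one>\<^bsub>G\<^esub> = \<one>\<^bsub>H\<^esub>"
    using hom_one[OF fd(2) PG.is_group PH.is_group] by simp
  have g1: "\<psi> \<one>\<^bsub>G\<^esub> = \<one>\<^bsub>H\<^esub>"
    using hom_one[OF gd(2) NG.is_group NH.is_group] by simp
  have fc: "\<phi> x \<in> carrier (P_part P H)" if "x \<in> carrier (P_part P G)" for x
    using bij_betwE[OF fd(1)] that by blast
  have gc: "\<psi> x \<in> carrier (P_part (- P) H)" if "x \<in> carrier (P_part (- P) G)" for x
    using bij_betwE[OF gd(1)] that by blast
  define R where "R a b \<longleftrightarrow> (\<exists>x\<in>carrier (P_part P G). \<exists>y\<in>carrier (P_part (- P) G).
    a = x \<otimes>\<^bsub>G\<^esub> y \<and> b = \<phi> x \<otimes>\<^bsub>H\<^esub> \<psi> y)" for a b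
  obtain \<theta> where t: "\<theta> \<in> sympl_iso G H" "\<theta> \<in> extensional (carrier G)" "\<And>a b. R a b \<Longrightarrow> \<theta> a = b"
  proof (rule sympl_iso_of_relation[OF assms(1,2), of R])
    show "a \<in> carrier G \<and> b \<in> carrier H" if "R a b" for a b
      using that fc gc by (auto simp: R_def)
    show "\<exists>b. R a b" if "a \<in> carrier G" for a
      using G.P_part_decompE[OF that, of P] unfolding R_def by metis
    show "\<exists>a. R a b" if b: "b \<in> carrier H" for b
    proof -
      obtain u v where u: "u \<in> carrier (P_part P H)" "v \<in> carrier (P_part (- P) H)" "b = u \<otimes>\<^bsub>H\<^esub> v"
        using H.P_part_decompE[OF b, of P] .
      obtain x where x: "x \<in> carrier (P_part P G)" "u = \<phi> x"
        using u(1) fd(1) unfolding bij_betw_def by blast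
      obtain y where y: "y \<in> carrier (P_part (- P) G)" "v = \<psi> y"
        using u(2) gd(1) unfolding bij_betw_def by blast
      show ?thesis using u(3) x y unfolding R_def by blast
    qed
    show "pairing G a a' = pairing H b b'" if "R a b" "R a' b'" for a b a' b'
    proof -
      obtain x y where xy: "x \<in> carrier (P_part P G)" "y \<in> carrier (P_part (- P) G)"
        "a = x \<otimes>\<^bsub>G\<^esub> y" "b = \<phi> x \<otimes>\<^bsub>H\<^esub> \<psi> y" using \<open>R a b\<close> unfolding R_def by blast
      obtain x' y' where xy': "x' \<in> carrier (P_part P G)" "y' \<in> carrier (P_part (- P) G)"
        "a' = x' \<otimes>\<^bsub>G\<^esub> y'" "b' = \<phi> x' \<otimes>\<^bsub>H\<^esub> \<psi> y'" using \<open>R a' b'\<close> unfolding R_def by blast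
      have "pairing G a a' = pairing G x x' \<otimes>\<^bsub>QZ\<^esub> pairing G y y'"
        unfolding xy(3) xy'(3) by (rule G.pairing_P_part_decomp) fact+
      also have "\<dots> = pairing H (\<phi> x) (\<phi> x') \<otimes>\<^bsub>QZ\<^esub> pairing H (\<psi> y) (\<psi> y')"
        using fd(3)[OF xy(1) xy'(1)] gd(3)[OF xy(2) xy'(2)] by simp
      also have "\<dots> = pairing H b b'"
        unfolding xy(4) xy'(4) using H.pairing_P_part_decomp fc[OF xy(1)] fc[OF xy'(1)]
          gc[OF xy(2)] gc[OF xy'(2)] by metis
      finally show ?thesis .
    qed
  qed blast
  have "\<theta> x = \<phi> x" if x: "x \<in> carrier (P_part P G)" for x
  proof (rule t(3))
    have "\<phi> x \<in> carrier H" "x \<in> carrier G" using fc[OF x] x by auto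
    then show "R x (\<phi> x)"
      unfolding R_def using x NG.one_closed g1
      by (intro bexI[of _ x] bexI[of _ "\<one>\<^bsub>G\<^esub>"]) auto
  qed
  moreover have "\<theta> y = \<psi> y" if y: "y \<in> carrier (P_part (- P) G)" for y
  proof (rule t(3))
    have "\<psi> y \<in> carrier H" "y \<in> carrier G" using gc[OF y] y by auto
    then show "R y (\<psi> y)"
      unfolding R_def using y PG.one_closed f1
      by (intro bexI[of _ "\<one>\<^bsub>G\<^esub>"] bexI[of _ y]) auto
  qed
  ultimately show ?thesis using that t by blast
qed

lemma sympl_iso_restrict:
  assumes "symplectic_group G" "h \<in> sympl_iso G H"
  shows "restrict h (carrier G) \<in> sympl_iso G H"
proof -
  interpret symplectic_group G by fact
  show ?thesis
    using iso_eq[of h H "restrict h (carrier G)"] assms(2) by (auto simp: sympl_iso_def)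
qed

context symplectic_group
begin

text \<open>Automorphisms preserve the orders of elements, hence both parts; restriction to the
  parts is injective because they generate G, and onto by gluing. Restricted maps are extensional,
  so each automorphism of a part is met once.\<close>

lemma card_Sp_P_parts: "card (Sp G) = card (Sp (P_part P G)) * card (Sp (P_part (- P) G))"
proof -
  let ?C = "carrier (P_part P G)" and ?D = "carrier (P_part (- P) G)"
  let ?f = "\<lambda>\<theta>. (restrict \<theta> ?C, restrict \<theta> ?D)"
  have sg: "symplectic_group G" by unfold_locales
  have "bij_betw ?f (Sp G) (Sp (P_part P G) \<times> Sp (P_part (- P) G))"
    unfolding bij_betw_def
  proof
    show "inj_on ?f (Sp G)"
    proof (rule inj_onI)
      fix \<theta> \<tau> assume s: "\<theta> \<in> Sp G" "\<tau> \<in> Sp G" and e: "?f \<theta> = ?f \<tau>"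
      have C: "\<theta> x = \<tau> x" if "x \<in> ?C" for x
        using e that by (metis (no_types, lifting) fst_conv restrict_apply')
      have D: "\<theta> x = \<tau> x" if "x \<in> ?D" for x
        using e that by (metis (no_types, lifting) snd_conv restrict_apply')
      have hom: "\<sigma> (x \<otimes> y) = \<sigma> x \<otimes> \<sigma> y" if "\<sigma> \<in> Sp G" "x \<in> carrier G" "y \<in> carrier G" for \<sigma> x y
        using that sympl_isoD(2)[of \<sigma> G G] by (auto simp: Sp_eq hom_def)
      have "\<theta> a = \<tau> a" if a: "a \<in> carrier G" for a
      proof -
        obtain x y where xy: "x \<in> ?C" "y \<in> ?D" "a = x \<otimes> y" using P_part_decompE[OF a] .
        then have "x \<in> carrier G" "y \<in> carrier G" by auto
        then show ?thesis using hom[OF s(1)] hom[OF s(2)] C[OF xy(1)] D[OF xy(2)] xy(3) by simp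
      qed
      then show "\<theta> = \<tau>"
        using s by (intro extensionalityI[of _ "carrier G"]) (auto simp: Sp_eq)
    qed
    show "?f ` Sp G = Sp (P_part P G) \<times> Sp (P_part (- P) G)"
    proof (intro equalityI subsetI)
      fix q assume "q \<in> ?f ` Sp G"
      then obtain \<theta> where t: "\<theta> \<in> sympl_iso G G" "q = ?f \<theta>" by (auto simp: Sp_eq)
      show "q \<in> Sp (P_part P G) \<times> Sp (P_part (- P) G)"
        unfolding t(2) Sp_eq
        using sympl_iso_restrict[OF symplectic_group_P_part P_part_sympl_iso[OF sg sg t(1)]]
        by blast
    next
      fix q assume "q \<in> Sp (P_part P G) \<times> Sp (P_part (- P) G)"
      then obtain \<phi> \<psi> where q: "q = (\<phi>, \<psi>)" "\<phi> \<in> Sp (P_part P G)" "\<psi> \<in> Sp (P_part (- P) G)" by blast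
      then have fg: "\<phi> \<in> sympl_iso (P_part P G) (P_part P G)" "\<phi> \<in> extensional ?C"
        "\<psi> \<in> sympl_iso (P_part (- P) G) (P_part (- P) G)" "\<psi> \<in> extensional ?D"
        by (simp_all only: Sp_eq Int_iff)
      obtain \<theta> where t: "\<theta> \<in> sympl_iso G G" "\<theta> \<in> extensional (carrier G)"
        "\<And>x. x \<in> ?C \<Longrightarrow> \<theta> x = \<phi> x" "\<And>y. y \<in> ?D \<Longrightarrow> \<theta> y = \<psi> y"
        using sympl_iso_of_P_parts[OF sg sg fg(1,3)] by blast
      have "restrict \<theta> ?C = \<phi>"
        by (rule extensionalityI[OF restrict_extensional fg(2)]) (use t(3) in \<open>metis restrict_apply'\<close>)
      moreover have "restrict \<theta> ?D = \<psi>"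
        by (rule extensionalityI[OF restrict_extensional fg(4)]) (use t(4) in \<open>metis restrict_apply'\<close>)
      moreover have "\<theta> \<in> Sp G" using t by (simp add: Sp_eq)
      ultimately show "q \<in> ?f ` Sp G" using q by blast
    qed
  qed
  then show ?thesis by (simp add: bij_betw_same_card card_cartesian_product)
qed

lemma order_P_parts: "order G = order (P_part P G) * order (P_part (- P) G)"
proof -
  let ?C = "carrier (P_part P G)" and ?D = "carrier (P_part (- P) G)"
  have "bij_betw (\<lambda>(x, y). x \<otimes> y) (?C \<times> ?D) (carrier G)"
    unfolding bij_betw_def
  proof
    show "inj_on (\<lambda>(x, y). x \<otimes> y) (?C \<times> ?D)"
      by (rule inj_onI) (use P_part_decomp_inj[of _ P] in \<open>clarify, blast\<close>)
    show "(\<lambda>(x, y). x \<otimes> y) ` (?C \<times> ?D) = carrier G"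
      unfolding P_part_decomp[of P] set_mult_def by auto
  qed
  then show ?thesis unfolding order_def by (simp flip: bij_betw_same_card card_cartesian_product)
qed

lemma weight_P_parts: "weight G = weight (P_part P G) * weight (P_part (- P) G)"
  using order_P_parts[of P] card_Sp_P_parts[of P] by (simp add: weight_def)

lemma carrier_P_part_eq:
  assumes "prime_factors (order G) \<subseteq> P"
  shows "carrier (P_part P G) = carrier G"
proof -
  have "prime_factors (ord x) \<subseteq> P" if "x \<in> carrier G" for x
    using assms dvd_prime_factors[OF _ ord_dvd_group_order[OF that]] order_pos by auto
  then show ?thesis by auto
qed

lemma carrier_P_part_trivial:
  assumes "prime_factors (order G) \<subseteq> - P"
  shows "carrier (P_part P G) = {\<one>}"
  using P_part_Int[of P] carrier_P_part_eq[OF assms] by auto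

end

section \<open>Orthogonal sums: groups with prescribed parts\<close>

definition orth_sum :: "nat sympl \<Rightarrow> nat sympl \<Rightarrow> nat sympl"
  where "orth_sum H K = \<lparr>carrier = prod_encode ` (carrier H \<times> carrier K),
    monoid.mult = (\<lambda>u v. case (prod_decode u, prod_decode v) of
      ((a, b), (c, d)) \<Rightarrow> prod_encode (a \<otimes>\<^bsub>H\<^esub> c, b \<otimes>\<^bsub>K\<^esub> d)),
    one = prod_encode (\<one>\<^bsub>H\<^esub>, \<one>\<^bsub>K\<^esub>),
    pairing = (\<lambda>u v. case (prod_decode u, prod_decode v) of
      ((a, b), (c, d)) \<Rightarrow> pairing H a c \<otimes>\<^bsub>QZ\<^esub> pairing K b d)\<rparr>"

lemma carrier_orth_sum [simp]:
    "carrier (orth_sum H K) = prod_encode ` (carrier H \<times> carrier K)"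
  and mult_orth_sum [simp]: "prod_encode (a, b) \<otimes>\<^bsub>orth_sum H K\<^esub> prod_encode (c, d) =
    prod_encode (a \<otimes>\<^bsub>H\<^esub> c, b \<otimes>\<^bsub>K\<^esub> d)"
  and one_orth_sum [simp]: "\<one>\<^bsub>orth_sum H K\<^esub> = prod_encode (\<one>\<^bsub>H\<^esub>, \<one>\<^bsub>K\<^esub>)"
  and pairing_orth_sum [simp]:
    "pairing (orth_sum H K) (prod_encode (a, b)) (prod_encode (c, d)) =
      pairing H a c \<otimes>\<^bsub>QZ\<^esub> pairing K b d"
  by (simp_all add: orth_sum_def)

lemma pow_orth_sum: "prod_encode (a, b) [^]\<^bsub>orth_sum H K\<^esub> (k::nat) =
    prod_encode (a [^]\<^bsub>H\<^esub> k, b [^]\<^bsub>K\<^esub> k)"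
  by (induction k) (auto simp: nat_pow_def)

lemma symplectic_orth_sum:
  assumes "symplectic_group H" "symplectic_group K"
  shows "symplectic_group (orth_sum H K)"
proof -
  interpret H: symplectic_group H by fact
  interpret K: symplectic_group K by fact
  let ?S = "orth_sum H K"
  interpret comm_group ?S
  proof (rule comm_groupI)
    fix u assume "u \<in> carrier ?S"
    then obtain a b where u: "u = prod_encode (a, b)" "a \<in> carrier H" "b \<in> carrier K" by auto
    then have "prod_encode (inv\<^bsub>H\<^esub> a, inv\<^bsub>K\<^esub> b) \<otimes>\<^bsub>?S\<^esub> u = \<one>\<^bsub>?S\<^esub>" by simp
    moreover have "prod_encode (inv\<^bsub>H\<^esub> a, inv\<^bsub>K\<^esub> b) \<in> carrier ?S" using u by simp
    ultimately show "\<exists>v\<in>carrier ?S. v \<otimes>\<^bsub>?S\<^esub> u = \<one>\<^bsub>?S\<^esub>" by blast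
  qed (auto simp: H.m_ac K.m_ac)
  show ?thesis
  proof
    show "finite (carrier ?S)" using H.fin K.fin by simp
  next
    fix u assume "u \<in> carrier ?S"
    then obtain a b where u: "u = prod_encode (a, b)" "a \<in> carrier H" "b \<in> carrier K" by auto
    show "pairing ?S u \<in> hom ?S QZ"
      using u by (auto simp: hom_def H.pairing_mult_right K.pairing_mult_right QZ.m_ac)
    show "(\<lambda>v. pairing ?S v u) \<in> hom ?S QZ"
      using u by (auto simp: hom_def H.pairing_mult_left K.pairing_mult_left QZ.m_ac)
    show "pairing ?S u u = \<one>\<^bsub>QZ\<^esub>" using u by (simp add: H.alternating K.alternating)
    assume orth: "\<And>v. v \<in> carrier ?S \<Longrightarrow> pairing ?S u v = \<one>\<^bsub>QZ\<^esub>"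
    have "a = \<one>\<^bsub>H\<^esub>"
    proof (rule H.nondegenerate[OF u(2)])
      fix c assume "c \<in> carrier H"
      then show "pairing H a c = \<one>\<^bsub>QZ\<^esub>" using orth[of "prod_encode (c, \<one>\<^bsub>K\<^esub>)"] u by simp
    qed
    moreover have "b = \<one>\<^bsub>K\<^esub>"
    proof (rule K.nondegenerate[OF u(3)])
      fix c assume "c \<in> carrier K"
      then show "pairing K b c = \<one>\<^bsub>QZ\<^esub>" using orth[of "prod_encode (\<one>\<^bsub>H\<^esub>, c)"] u by simp
    qed
    ultimately show "u = \<one>\<^bsub>?S\<^esub>" using u by simp
  qed
qed

lemma P_part_orth_sum:
  assumes "symplectic_group H" "symplectic_group K"
  shows "carrier (P_part Q (orth_sum H K)) =
    prod_encode ` (carrier (P_part Q H) \<times> carrier (P_part Q K))"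
proof -
  interpret H: symplectic_group H by fact
  interpret K: symplectic_group K by fact
  let ?S = "orth_sum H K"
  interpret S: symplectic_group ?S by (rule symplectic_orth_sum) fact+
  have iff: "prime_factors (S.ord (prod_encode (a, b))) \<subseteq> Q \<longleftrightarrow>
      prime_factors (H.ord a) \<subseteq> Q \<and> prime_factors (K.ord b) \<subseteq> Q"
    if a: "a \<in> carrier H" and b: "b \<in> carrier K" for a b
  proof
    have c: "prod_encode (a, b) \<in> carrier ?S" using a b by simp
    show "prime_factors (H.ord a) \<subseteq> Q \<and> prime_factors (K.ord b) \<subseteq> Q"
      if "prime_factors (S.ord (prod_encode (a, b))) \<subseteq> Q"
      using that a b S.prime_factors_ord_iff[OF c] H.prime_factors_ord_iff[OF a]
        K.prime_factors_ord_iff[OF b] by (auto simp: pow_orth_sum)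
    show "prime_factors (S.ord (prod_encode (a, b))) \<subseteq> Q"
      if *: "prime_factors (H.ord a) \<subseteq> Q \<and> prime_factors (K.ord b) \<subseteq> Q"
      unfolding S.prime_factors_ord_iff[OF c]
    proof (intro exI conjI)
      let ?m = "H.ord a * K.ord b"
      show "0 < ?m" using H.ord_pos[OF a] K.ord_pos[OF b] by simp
      show "prime_factors ?m \<subseteq> Q"
        using * H.ord_pos[OF a] K.ord_pos[OF b] by (simp add: prime_factors_product)
      show "prod_encode (a, b) [^]\<^bsub>?S\<^esub> ?m = \<one>\<^bsub>?S\<^esub>"
        using a b H.pow_eq_id[OF a, of ?m] K.pow_eq_id[OF b, of ?m] by (simp add: pow_orth_sum)
    qed
  qed
  show ?thesis
  proof (intro equalityI subsetI)
    fix u assume u: "u \<in> carrier (P_part Q ?S)"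
    then obtain a b where "u = prod_encode (a, b)" "a \<in> carrier H" "b \<in> carrier K" by auto
    then show "u \<in> prod_encode ` (carrier (P_part Q H) \<times> carrier (P_part Q K))"
      using u iff[of a b] by simp
  next
    fix u assume "u \<in> prod_encode ` (carrier (P_part Q H) \<times> carrier (P_part Q K))"
    then obtain a b where "u = prod_encode (a, b)" "a \<in> carrier (P_part Q H)"
      "b \<in> carrier (P_part Q K)" by blast
    then show "u \<in> carrier (P_part Q ?S)" using iff[of a b] by simp
  qed
qed

lemma sympl_isomorphicI: "symplectic_group G \<Longrightarrow> symplectic_group H \<Longrightarrow> h \<in> sympl_iso G H \<Longrightarrow>
    sympl_isomorphic G H"
  by (auto simp: sympl_isomorphic_def)

lemma sympl_isomorphic_P_part_orth_sum:
  assumes H: "symplectic_group H" and K: "symplectic_group K"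
    and pH: "prime_factors (order H) \<subseteq> P" and pK: "prime_factors (order K) \<subseteq> - P"
  shows "sympl_isomorphic H (P_part P (orth_sum H K))"
    and "sympl_isomorphic K (P_part (- P) (orth_sum H K))"
proof -
  interpret H: symplectic_group H by fact
  interpret K: symplectic_group K by fact
  let ?S = "orth_sum H K"
  interpret S: symplectic_group ?S by (rule symplectic_orth_sum) fact+
  have c1: "carrier (P_part P ?S) = prod_encode ` (carrier H \<times> {\<one>\<^bsub>K\<^esub>})"
    using P_part_orth_sum[OF H K, of P] H.carrier_P_part_eq[OF pH] K.carrier_P_part_trivial[OF pK]
    by simp
  have c2: "carrier (P_part (- P) ?S) = prod_encode ` ({\<one>\<^bsub>H\<^esub>} \<times> carrier K)"
    using P_part_orth_sum[OF H K, of "- P"] H.carrier_P_part_trivial[of "- P"] pH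
      K.carrier_P_part_eq[OF pK] by simp
  obtain h where "h \<in> sympl_iso H (P_part P ?S)"
  proof (rule sympl_iso_of_relation[OF H S.symplectic_group_P_part[of P],
        of "\<lambda>a u. a \<in> carrier H \<and> u = prod_encode (a, \<one>\<^bsub>K\<^esub>)"])
  qed (unfold c1, auto)
  then show "sympl_isomorphic H (P_part P ?S)"
    using sympl_isomorphicI[OF H S.symplectic_group_P_part] by blast
  obtain k where "k \<in> sympl_iso K (P_part (- P) ?S)"
  proof (rule sympl_iso_of_relation[OF K S.symplectic_group_P_part[of "- P"],
        of "\<lambda>b u. b \<in> carrier K \<and> u = prod_encode (\<one>\<^bsub>H\<^esub>, b)"])
  qed (unfold c2, auto)
  then show "sympl_isomorphic K (P_part (- P) ?S)"
    using sympl_isomorphicI[OF K S.symplectic_group_P_part] by blast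
qed

section \<open>Isomorphism classes as pairs of parts\<close>

lemma class_P_part_rep: "sympl_isomorphic (P_part P (rp C)) (rp (class_P_part P C))"
proof -
  have "sympl_isomorphic (P_part P (rp C)) (P_part P (rp C))"
    by (rule P_part_cong[OF sympl_isomorphic_rep])
  then have "sympl_isomorphic (rp (abs_sympl_class (P_part P (rp C)))) (P_part P (rp C))"
    using Quotient_rep_abs[OF Quotient_sympl_class] by blast
  moreover have "class_P_part P C = abs_sympl_class (P_part P (rp C))"
    by (simp add: class_P_part_def)
  ultimately show ?thesis using sympl_isomorphic_sym by metis
qed

lemma class_order_P_parts:
  "class_order C = class_order (class_P_part P C) * class_order (class_P_part (- P) C)"
  using symplectic_group.order_P_parts[OF symplectic_rep, of C P]
    order_cong[OF class_P_part_rep[of P C]] order_cong[OF class_P_part_rep[of "- P" C]]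
  by (simp add: class_order.rep_eq)

lemma class_weight_P_parts:
  "class_weight C = class_weight (class_P_part P C) * class_weight (class_P_part (- P) C)"
  using symplectic_group.weight_P_parts[OF symplectic_rep, of C P]
    weight_cong[OF class_P_part_rep[of P C]] weight_cong[OF class_P_part_rep[of "- P" C]]
  by (simp add: class_weight.rep_eq)

lemma class_P_part_in_P_classes: "class_P_part P C \<in> P_classes P"
  using symplectic_group.P_part_order[OF symplectic_rep, of P C]
    order_cong[OF class_P_part_rep[of P C]]
  by (simp add: P_classes_def class_order.rep_eq)

lemma class_eq_by_P_parts:
  assumes "class_P_part P C = class_P_part P D" "class_P_part (- P) C = class_P_part (- P) D"
  shows "C = D"
proof -
  have "sympl_isomorphic (P_part Q (rp C)) (P_part Q (rp D))"
    if "class_P_part Q C = class_P_part Q D" for Q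
    using class_P_part_rep[of Q C] class_P_part_rep[of Q D] that
    by (metis sympl_isomorphic_sym sympl_isomorphic_trans)
  from this[OF assms(1)] this[OF assms(2)] obtain \<phi> \<psi>
    where "\<phi> \<in> sympl_iso (P_part P (rp C)) (P_part P (rp D))"
      "\<psi> \<in> sympl_iso (P_part (- P) (rp C)) (P_part (- P) (rp D))"
    unfolding sympl_isomorphic_def by blast
  from sympl_iso_of_P_parts[OF symplectic_rep symplectic_rep this] show ?thesis
    using class_eqI by metis
qed

lemma class_exists_P_parts:
  assumes "H \<in> P_classes P" "K \<in> P_classes (- P)"
  obtains C where "class_P_part P C = H" "class_P_part (- P) C = K"
proof -
  let ?S = "orth_sum (rp H) (rp K)"
  have p: "prime_factors (order (rp H)) \<subseteq> P" "prime_factors (order (rp K)) \<subseteq> - P"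
    using assms by (auto simp: P_classes_def class_order.rep_eq)
  obtain C where C: "sympl_isomorphic ?S (rp C)"
    using class_exists[OF symplectic_orth_sum[OF symplectic_rep symplectic_rep]] .
  have eq: "class_P_part Q C = D" if "sympl_isomorphic (rp D) (P_part Q ?S)" for Q D
    using that P_part_cong[OF C, of Q] class_P_part_rep[of Q C]
    by (metis sympl_isomorphic_rep_iff sympl_isomorphic_trans)
  show ?thesis
    using that eq sympl_isomorphic_P_part_orth_sum[OF symplectic_rep symplectic_rep p] by blast
qed

text \<open>Classes C correspond bijectively to pairs (H, K) of parts, with multiplicative order and
  weight. The condition #H #K <= n is the same as #K <= \<open>n div class_order H\<close>, so
  rounding in the integer division loses nothing.\<close>

lemma sum_by_P_parts:
  fixes f :: "sympl_class \<Rightarrow> real"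
  shows "(\<Sum>C | class_order C \<le> n. f (class_P_part P C) * class_weight C) =
    (\<Sum>H\<in>{H \<in> P_classes P. class_order H \<le> n}. f H * class_weight H *
      (\<Sum>K\<in>{K \<in> P_classes (- P). class_order K \<le> n div class_order H}. class_weight K))"
proof -
  let ?A = "{H \<in> P_classes P. class_order H \<le> n}"
  let ?B = "\<lambda>H. {K \<in> P_classes (- P). class_order K \<le> n div class_order H}"
  let ?\<Phi> = "\<lambda>C. (class_P_part P C, class_P_part (- P) C)"
  have "bij_betw ?\<Phi> {C. class_order C \<le> n} (Sigma ?A ?B)"
    unfolding bij_betw_def
  proof
    show "inj_on ?\<Phi> {C. class_order C \<le> n}"
      by (rule inj_onI) (use class_eq_by_P_parts in blast)
    show "?\<Phi> ` {C. class_order C \<le> n} = Sigma ?A ?B"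
    proof (intro equalityI subsetI)
      fix q assume "q \<in> ?\<Phi> ` {C. class_order C \<le> n}"
      then obtain C where C: "class_order C \<le> n" "q = ?\<Phi> C" by blast
      define H where "H = class_P_part P C"
      define K where "K = class_P_part (- P) C"
      have o: "class_order K * class_order H \<le> n"
        using C(1) class_order_P_parts[of C P] by (simp add: H_def K_def mult.commute)
      then have "class_order K \<le> n div class_order H"
        using class_order_pos[of H] by (simp add: less_eq_div_iff_mult_less_eq)
      moreover have "class_order H \<le> n"
        using class_order_pos[of K] by (intro order_trans[OF _ o]) simp
      ultimately show "q \<in> Sigma ?A ?B"
        using C(2) class_P_part_in_P_classes[of P C] class_P_part_in_P_classes[of "- P" C]
        unfolding H_def K_def by auto
    next
      fix q assume "q \<in> Sigma ?A ?B"
      then obtain H K where q: "q = (H, K)" "H \<in> P_classes P" "K \<in> P_classes (- P)"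
        "class_order K \<le> n div class_order H" by blast
      obtain C where C: "class_P_part P C = H" "class_P_part (- P) C = K"
        using class_exists_P_parts[OF q(2,3)] .
      have "class_order K * class_order H \<le> n"
        using q(4) class_order_pos[of H] by (simp add: less_eq_div_iff_mult_less_eq)
      then have "class_order C \<le> n"
        using class_order_P_parts[of C P] C by (simp add: mult.commute)
      then show "q \<in> ?\<Phi> ` {C. class_order C \<le> n}" using q(1) C by blast
    qed
  qed
  then have "(\<Sum>(H, K)\<in>Sigma ?A ?B. f H * class_weight H * class_weight K) =
    (\<Sum>C | class_order C \<le> n. f (class_P_part P C) * class_weight (class_P_part P C) *
      class_weight (class_P_part (- P) C))"
    by (subst sum.reindex_bij_betw[symmetric]) (auto simp: split_def)
  also have "\<dots> = (\<Sum>C | class_order C \<le> n. f (class_P_part P C) * class_weight C)"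
    by (intro sum.cong refl) (simp only: class_weight_P_parts[where P = P, symmetric] mult.assoc)
  finally have "(\<Sum>C | class_order C \<le> n. f (class_P_part P C) * class_weight C) =
    (\<Sum>(H, K)\<in>Sigma ?A ?B. f H * class_weight H * class_weight K)" ..
  also have "\<dots> = (\<Sum>H\<in>?A. \<Sum>K\<in>?B H. f H * class_weight H * class_weight K)"
  proof (rule sum.Sigma[symmetric])
    show "finite ?A" by (rule finite_subset[OF _ finite_class_order_le[of n]]) auto
    show "\<forall>H\<in>?A. finite (?B H)"
      by (intro ballI finite_subset[OF _ finite_class_order_le]) auto
  qed
  finally show ?thesis by (simp add: sum_distrib_left)
qed

section \<open>The limit\<close>

text \<open>Dominated convergence for unordered sums: by the Weierstrass test with majorant |a| the
  finite partial sums converge uniformly in n, which permits exchanging the limit in n with the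
  limit over finite subsets.\<close>

lemma tendsto_infsum_dominated:
  fixes a :: "'a \<Rightarrow> real"
  assumes a: "(\<lambda>x. \<bar>a x\<bar>) summable_on X"
    and g: "\<And>n x. x \<in> X \<Longrightarrow> 0 \<le> g n x \<and> g n x \<le> 1"
    and lim: "\<And>x. x \<in> X \<Longrightarrow> (\<lambda>n. g n x) \<longlonglongrightarrow> 1"
  shows "(\<lambda>n. \<Sum>\<^sub>\<infinity>x\<in>X. a x * g n x) \<longlonglongrightarrow> (\<Sum>\<^sub>\<infinity>x\<in>X. a x)"
proof (rule swap_uniform_limit')
  show "uniform_limit UNIV (\<lambda>F n. \<Sum>x\<in>F. a x * g n x) (\<lambda>n. \<Sum>\<^sub>\<infinity>x\<in>X. a x * g n x)
    (finite_subsets_at_top X)"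
  proof (rule Weierstrass_m_test_general[OF _ a])
    fix x n assume "x \<in> X"
    then show "norm (a x * g n x) \<le> \<bar>a x\<bar>"
      using g[of x n] by (simp add: abs_mult mult_left_le)
  qed
  show "\<forall>\<^sub>F F in finite_subsets_at_top X. (\<lambda>n. \<Sum>x\<in>F. a x * g n x) \<longlonglongrightarrow> (\<Sum>x\<in>F. a x)"
  proof (rule eventually_finite_subsets_at_top_weakI)
    fix F assume "F \<subseteq> X"
    then have "(\<lambda>n. \<Sum>x\<in>F. a x * g n x) \<longlonglongrightarrow> (\<Sum>x\<in>F. a x * 1)"
      using lim by (intro tendsto_intros) auto
    then show "(\<lambda>n. \<Sum>x\<in>F. a x * g n x) \<longlonglongrightarrow> (\<Sum>x\<in>F. a x)" by simp
  qed
  have "a summable_on X" by (rule abs_summable_summable) (use a in simp)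
  then show "(sum a \<longlongrightarrow> (\<Sum>\<^sub>\<infinity>x\<in>X. a x)) (finite_subsets_at_top X)"
    using has_sum_infsum by (auto simp: has_sum_def)
qed auto

theorem theorem5p16:
  fixes P :: "nat set" and f :: "sympl_class \<Rightarrow> real"
  assumes "\<forall>p\<in>P. prime p"
    and "(\<lambda>p. 1 / real p) summable_on P"
    and "sympl_L1 P f"
  shows "(\<lambda>n::nat. (\<Sum>G | class_order G \<le> n. f (class_P_part P G) * class_weight G)
            / (\<Sum>G | class_order G \<le> n. class_weight G))
         \<longlonglongrightarrow> sympl_integral P f"
proof -
  define A where "A n = (\<Sum>K\<in>{K \<in> P_classes (- P). class_order K \<le> n}. class_weight K)" for n
  define W where "W = (\<Sum>\<^sub>\<infinity>H\<in>P_classes P. class_weight H)"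
  define g where "g n H = A (n div class_order H) / A n" for n H
  have w: "class_weight C \<ge> 0" for C using class_weight_pos[of C] by simp
  have fin: "finite {K \<in> Q. class_order K \<le> n}" for Q n
    by (rule finite_subset[OF _ finite_class_order_le[of n]]) auto
  have A_mono: "A m \<le> A n" if "m \<le> n" for m n
    unfolding A_def using fin w that by (intro sum_mono2) auto
  have A_nonneg: "A n \<ge> 0" for n unfolding A_def using w by (intro sum_nonneg) auto
  \<comment> \<open>For #H > n the quotient \<open>n div class_order H\<close> is 0, so A(0) = 0
    removes such H and lets finite sums be written over all P-classes.\<close>
  have "{K \<in> P_classes (- P). class_order K \<le> 0} = {}" using class_order_pos by (simp add: neq0_conv)
  then have A_0: "A 0 = 0" by (simp only: A_def sum.empty)
  have sumW: "class_weight summable_on P_classes P"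
    using class_weight_summable_on_P_classes assms(1,2) by blast
  have split: "(\<Sum>C | class_order C \<le> n. h (class_P_part P C) * class_weight C) =
      (\<Sum>H\<in>{H \<in> P_classes P. class_order H \<le> n}. h H * class_weight H * A (n div class_order H))"
    for n h unfolding A_def by (rule sum_by_P_parts)
  \<comment> \<open>This transfers the divergence of the total weight to A. The factor W + 1 is
    visibly positive, so it can be divided by before W > 0 is established.\<close>
  have "(\<Sum>C | class_order C \<le> n. class_weight C) \<le> (W + 1) * A n" for n
  proof -
    have "(\<Sum>C | class_order C \<le> n. class_weight C) =
        (\<Sum>H\<in>{H \<in> P_classes P. class_order H \<le> n}. class_weight H * A (n div class_order H))"
      using split[of "\<lambda>_. 1" n] by simp
    also have "\<dots> \<le> (\<Sum>H\<in>{H \<in> P_classes P. class_order H \<le> n}. class_weight H * A n)"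
      using w by (intro sum_mono mult_left_mono A_mono) auto
    also have "\<dots> = (\<Sum>H\<in>{H \<in> P_classes P. class_order H \<le> n}. class_weight H) * A n"
      by (simp add: sum_distrib_right)
    also have "\<dots> \<le> W * A n"
      unfolding W_def using w fin A_nonneg
      by (intro mult_right_mono finite_sum_le_infsum[OF sumW]) auto
    finally show ?thesis using A_nonneg[of n] by (simp add: algebra_simps)
  qed
  moreover have W_nonneg: "W \<ge> 0" unfolding W_def using w by (intro infsum_nonneg) auto
  ultimately have A_ge: "1 / (W + 1) * (\<Sum>C | class_order C \<le> n. class_weight C) \<le> A n" for n
    by (simp add: field_simps)
  have "filterlim (\<lambda>n. 1 / (W + 1) * (\<Sum>C | class_order C \<le> n. class_weight C))
      at_top sequentially"
    by (rule filterlim_tendsto_pos_mult_at_top[OF tendsto_const _ sum_class_weight_at_top])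
      (use W_nonneg in simp)
  then have A_top: "filterlim A at_top sequentially"
    by (rule filterlim_at_top_mono) (use A_ge in simp)
  \<comment> \<open>The difference A(n) - A(n div h) is bounded in terms of h alone by the short
    interval estimate, while A tends to infinity.\<close>
  have g_lim: "(\<lambda>n. g n H) \<longlonglongrightarrow> 1" for H
  proof -
    define h where "h = class_order H"
    have h: "h \<ge> 1" using class_order_pos[of H] by (simp add: h_def)
    have diff: "A n - A (n div h) \<le> 2 * mass 1 * real h" for n
    proof -
      have "{K \<in> P_classes (- P). class_order K \<le> n} =
          {K \<in> P_classes (- P). class_order K \<le> n div h} \<union>
          {K \<in> P_classes (- P). class_order K \<in> {n div h<..n}}"
        by (auto intro: order_trans[OF _ div_le_dividend])
      moreover have "finite {K \<in> P_classes (- P). class_order K \<in> {n div h<..n}}"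
        by (rule finite_subset[OF _ finite_class_order_le[of n]]) auto
      ultimately have "A n = A (n div h) +
          (\<Sum>K\<in>{K \<in> P_classes (- P). class_order K \<in> {n div h<..n}}. class_weight K)"
        unfolding A_def using fin by (simp only:) (rule sum.union_disjoint, auto)
      also have "\<dots> \<le> A (n div h) + (\<Sum>K | class_order K \<in> {n div h<..n}. class_weight K)"
      proof (intro add_left_mono sum_mono2)
        show "finite {K. class_order K \<in> {n div h<..n}}"
          by (rule finite_subset[OF _ finite_class_order_le[of n]]) auto
      qed (use w in auto)
      also have "(\<Sum>K | class_order K \<in> {n div h<..n}. class_weight K) \<le> 2 * mass 1 * real h"
        using sum_class_weight_eq[of "{n div h<..n}"] sum_mass_short_interval[OF h, of n] by simp
      finally show ?thesis by simp
    qed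
    have pos: "\<forall>\<^sub>F n in sequentially. A n > 0"
      using A_top by (simp add: filterlim_at_top_dense)
    show ?thesis
    proof (rule tendsto_sandwich)
      have "(\<lambda>n. 1 - 2 * mass 1 * real h / A n) \<longlonglongrightarrow> 1 - 0"
        by (intro tendsto_diff tendsto_const real_tendsto_divide_at_top[OF tendsto_const A_top])
      then show "(\<lambda>n. 1 - 2 * mass 1 * real h / A n) \<longlonglongrightarrow> 1" by simp
      show "\<forall>\<^sub>F n in sequentially. 1 - 2 * mass 1 * real h / A n \<le> g n H"
        using pos
      proof eventually_elim
        case (elim n)
        have "(A n - A (n div h)) / A n \<le> 2 * mass 1 * real h / A n"
          using diff[of n] elim by (intro divide_right_mono) auto
        then show ?case using elim by (simp add: g_def h_def diff_divide_distrib)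
      qed
      show "\<forall>\<^sub>F n in sequentially. g n H \<le> 1"
        using pos
      proof eventually_elim
        case (elim n)
        then show ?case using A_mono[of "n div h" n] by (simp add: g_def h_def field_simps)
      qed
    qed simp
  qed
  \<comment> \<open>This holds for all n: where A(n) = 0 the quotient has the default value
    0.\<close>
  have g_bounds: "0 \<le> g n H \<and> g n H \<le> 1" for n H
    using A_nonneg[of n] A_nonneg[of "n div class_order H"] A_mono[of "n div class_order H" n]
    by (auto simp: g_def divide_le_eq_1)
  have sum_eq: "(\<Sum>C | class_order C \<le> n. h (class_P_part P C) * class_weight C) =
      A n * (\<Sum>\<^sub>\<infinity>H\<in>P_classes P. h H * class_weight H * g n H)" if "A n > 0" for n h
  proof -
    have "(\<Sum>\<^sub>\<infinity>H\<in>P_classes P. h H * class_weight H * g n H) =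
        (\<Sum>\<^sub>\<infinity>H\<in>{H \<in> P_classes P. class_order H \<le> n}. h H * class_weight H * g n H)"
      by (rule infsum_cong_neutral) (auto simp: g_def A_0)
    also have "\<dots> = (\<Sum>H\<in>{H \<in> P_classes P. class_order H \<le> n}. h H * class_weight H * g n H)"
      using fin by simp
    finally show ?thesis using that by (simp add: split g_def sum_distrib_left)
  qed
  define N where "N n = (\<Sum>\<^sub>\<infinity>H\<in>P_classes P. f H * class_weight H * g n H)" for n
  define D where "D n = (\<Sum>\<^sub>\<infinity>H\<in>P_classes P. class_weight H * g n H)" for n
  have N: "N \<longlonglongrightarrow> (\<Sum>\<^sub>\<infinity>H\<in>P_classes P. f H * class_weight H)"
    unfolding N_def
  proof (rule tendsto_infsum_dominated)
    show "(\<lambda>H. \<bar>f H * class_weight H\<bar>) summable_on P_classes P"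
      using assms(3) w by (simp add: sympl_L1_def abs_mult)
  qed (use g_bounds g_lim in auto)
  have D: "D \<longlonglongrightarrow> W"
    unfolding D_def W_def
    by (rule tendsto_infsum_dominated) (use sumW w g_bounds g_lim in auto)
  have "W > 0"
  proof -
    \<comment> \<open>The part of an arbitrary class is a P-class, so the sum W has at least one
      term, and all its terms are positive.\<close>
    define C where "C = class_P_part P undefined"
    have "0 < class_weight C" by (rule class_weight_pos)
    also have "\<dots> \<le> W"
      unfolding W_def using finite_sum_le_infsum[OF sumW, of "{C}"] w class_P_part_in_P_classes
      by (simp add: C_def)
    finally show ?thesis .
  qed
  then have "(\<lambda>n. N n / D n) \<longlonglongrightarrow> sympl_integral P f"
    using tendsto_divide[OF N D] by (simp add: sympl_integral_def W_def)
  moreover have "\<forall>\<^sub>F n in sequentially. N n / D n =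
      (\<Sum>G | class_order G \<le> n. f (class_P_part P G) * class_weight G)
        / (\<Sum>G | class_order G \<le> n. class_weight G)"
  proof -
    \<comment> \<open>Numerator and denominator are \<open>sum_eq\<close> for h = f and h = 1, and
      their common factor A(n) cancels as soon as it is positive.\<close>
    have "\<forall>\<^sub>F n in sequentially. A n > 0"
      using A_top by (simp add: filterlim_at_top_dense)
    then show ?thesis
    proof eventually_elim
      case (elim n)
      then show ?case
        using sum_eq[OF elim, of f] sum_eq[OF elim, of "\<lambda>_. 1"] by (simp add: N_def D_def)
    qed
  qed
  ultimately show ?thesis by (rule Lim_transform_eventually)
qed

end
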